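(* Let $\mathsf{k}\ge1$, let $\mathfrak{m}=(m_1,\dots,m_{\mathsf{k}})\in\mathbb{Z}^{\mathsf{k}}$ with all $m_i\neq0$, and let $\mathfrak{M}:=\prod_{i=1}^{\mathsf{k}}m_i$. Let $\mathfrak{e}:=\mathbf{x}_1\cdots\mathbf{x}_{\mathsf{k}}$, let $\mathcal{F}$ be the fixed point algebra of the gauge action on $\mathcal{O}_{\Lambda(\mathds{1}_{\mathsf{k}},\mathfrak{m})}$, and for $n\in\mathbb{N}$ let $$\mathcal{F}_{n\mathds{1}_{\mathsf{k}}}:=\overline{\operatorname{span}}\{s_{\mathfrak{e}^n}u_{a^p}s_{\mathfrak{e}^n}^*:p\in\mathbb{Z}\}.$$ Consider the inclusions $\varphi_n:\mathcal{F}_{n\mathds{1}_{\mathsf{k}}}\hookrightarrow\mathcal{F}_{(n+1)\mathds{1}_{\mathsf{k}}}$ given by $\varphi_n(s_{\mathfrak{e}^n}u_{a^p}s_{\mathfrak{e}^n}^* )=s_{\mathfrak{e}^{n+1}}u_{a^{p\mathfrak{M}}}s_{\mathfrak{e}^{n+1}}^*$. Then $\mathcal{F}=\varinjlim_{n\to\infty}\mathcal{F}_{n\mathds{1}_{\mathsf{k}}}$, and the spectrum of $\mathcal{F}$ is homeomorphic to the solenoid $S_{\mathfrak{M}}$.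
   Context: Write $\mathbb{Z}=\langle a\rangle$ multiplicatively, $\mathds{1}_{\mathsf k}=(1,\dots,1)\in\mathbb{N}^{\mathsf k}$, and $\mathfrak{m}^{\mathbf{p}}=\prod_i m_i^{p_i}$ for $\mathbf{p}\in\mathbb{N}^{\mathsf{k}}$. $\Lambda_{\mathds{1}_{\mathsf{k}}}$ is the single-vertex $\mathsf{k}$-graph with exactly one edge $\mathbf{x}_i$ of each colour $i$; as a monoid it is the free commutative monoid on $\mathbf{x}_1,\dots,\mathbf{x}_{\mathsf{k}}$, with degree map $d(\mathbf{x}_1^{p_1}\cdots\mathbf{x}_{\mathsf{k}}^{p_{\mathsf{k}}})=(p_1,\dots,p_{\mathsf{k}})$. $\Lambda(\mathds{1}_{\mathsf{k}},\mathfrak{m})$ is the self-similar $\mathsf{k}$-graph $(\mathbb{Z},\Lambda_{\mathds{1}_{\mathsf{k}}})$ in which $\mathbb{Z}$ acts trivially, $a^\ell\cdot\mu=\mu$, with restriction $a^\ell|_\mu=a^{\ell\mathfrak{m}^{d(\mu)}}$. $\mathcal{O}_{\Lambda(\mathds{1}_{\mathsf{k}},\mathfrak{m})}$ is the universal unital C*-algebra generated by unitaries $\{u_g\}_{g\in\mathbb{Z}}$ and isometries $\{s_\mu:\mu\in\Lambda_{\mathds{1}_{\mathsf{k}}}\}$ with $u_{gh}=u_gu_h$, $s_\mu s_\nu=s_{\mu\nu}$, $s_\mu s_\mu^*=1$ for all $\mu$ (so each $s_\mu$ is unitary), and $u_gs_\mu=s_{\mu}u_{g|_\mu}$. The gauge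 action $\gamma$ of $\mathbb{T}^{\mathsf{k}}$ is $\gamma_{\mathbf{t}}(s_\mu u_gs_\nu^* )=\mathbf{t}^{d(\mu)-d(\nu)}s_\mu u_gs_\nu^*$. (The algebra $\mathcal{F}$ is commutative and unital.) The solenoid $S_{\mathfrak{M}}$ is the inverse limit $\{(z_n)_{n\in\mathbb{N}}\in\prod_{n\in\mathbb{N}}\mathbb{T}: z_n=z_{n+1}^{\mathfrak{M}}\text{ for all }n\}$ with the subspace topology of the product. *)

theory Defs
  imports
    "HOL-Analysis.Analysis"
    "HOL-Algebra.Module"
    "HOL-Library.Multiset"
begin

section \<open>C*-algebras with explicit carrier\<close>

definition complex_ring :: "complex ring"
  where "complex_ring = \<lparr>carrier = UNIV, mult = (*), one = 1, zero = 0, add = (+)\<rparr>"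

record 'a cstar_alg = "(complex, 'a) module" +
  star :: "'a \<Rightarrow> 'a"
  cnorm :: "'a \<Rightarrow> real"

text \<open>The locale \<^locale>\<open>Metric_space\<close> wants a distance that is non-negative and symmetric on the
  whole type, so the distance is set to zero off the carrier.\<close>

definition cdist :: "'a cstar_alg \<Rightarrow> 'a \<Rightarrow> 'a \<Rightarrow> real"
  where "cdist A x y =
    (if x \<in> carrier A \<and> y \<in> carrier A then cnorm A (x \<ominus>\<^bsub>A\<^esub> y) else 0)"

definition norm_topology :: "'a cstar_alg \<Rightarrow> 'a topology"
  where "norm_topology A = Metric_space.mtopology (carrier A) (cdist A)"

text \<open>No unit is assumed here: the field \<^const>\<open>one\<close> is unconstrained.\<close>

locale cstar_algebra = Module.module complex_ring A for A :: "'a cstar_alg" (structure) +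
  assumes cmult_closed: "\<lbrakk>x \<in> carrier A; y \<in> carrier A\<rbrakk> \<Longrightarrow> x \<otimes> y \<in> carrier A"
    and cmult_assoc: "\<lbrakk>x \<in> carrier A; y \<in> carrier A; z \<in> carrier A\<rbrakk>
      \<Longrightarrow> (x \<otimes> y) \<otimes> z = x \<otimes> (y \<otimes> z)"
    and l_distrib: "\<lbrakk>x \<in> carrier A; y \<in> carrier A; z \<in> carrier A\<rbrakk>
      \<Longrightarrow> (x \<oplus> y) \<otimes> z = x \<otimes> z \<oplus> y \<otimes> z"
    and r_distrib: "\<lbrakk>x \<in> carrier A; y \<in> carrier A; z \<in> carrier A\<rbrakk>
      \<Longrightarrow> z \<otimes> (x \<oplus> y) = z \<otimes> x \<oplus> z \<otimes> y"
    and smult_mult_left: "\<lbrakk>x \<in> carrier A; y \<in> carrier A\<rbrakk>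
      \<Longrightarrow> (c \<odot> x) \<otimes> y = c \<odot> (x \<otimes> y)"
    and smult_mult_right: "\<lbrakk>x \<in> carrier A; y \<in> carrier A\<rbrakk>
      \<Longrightarrow> x \<otimes> (c \<odot> y) = c \<odot> (x \<otimes> y)"
    and star_closed: "x \<in> carrier A \<Longrightarrow> star A x \<in> carrier A"
    and star_star: "x \<in> carrier A \<Longrightarrow> star A (star A x) = x"
    and star_add: "\<lbrakk>x \<in> carrier A; y \<in> carrier A\<rbrakk>
      \<Longrightarrow> star A (x \<oplus> y) = star A x \<oplus> star A y"
    and star_smult: "x \<in> carrier A \<Longrightarrow> star A (c \<odot> x) = cnj c \<odot> star A x"
    and star_mult: "\<lbrakk>x \<in> carrier A; y \<in> carrier A\<rbrakk>
      \<Longrightarrow> star A (x \<otimes> y) = star A y \<otimes> star A x"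
    and cnorm_nonneg: "x \<in> carrier A \<Longrightarrow> 0 \<le> cnorm A x"
    and cnorm_eq_zero: "x \<in> carrier A \<Longrightarrow> cnorm A x = 0 \<longleftrightarrow> x = \<zero>"
    and cnorm_triangle: "\<lbrakk>x \<in> carrier A; y \<in> carrier A\<rbrakk>
      \<Longrightarrow> cnorm A (x \<oplus> y) \<le> cnorm A x + cnorm A y"
    and cnorm_smult: "x \<in> carrier A \<Longrightarrow> cnorm A (c \<odot> x) = cmod c * cnorm A x"
    and cnorm_mult: "\<lbrakk>x \<in> carrier A; y \<in> carrier A\<rbrakk>
      \<Longrightarrow> cnorm A (x \<otimes> y) \<le> cnorm A x * cnorm A y"
    and cstar_identity: "x \<in> carrier A \<Longrightarrow> cnorm A (star A x \<otimes> x) = (cnorm A x)\<^sup>2"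
    and norm_complete: "Metric_space.mcomplete (carrier A) (cdist A)"

locale unital_cstar_algebra = cstar_algebra A + ring A for A :: "'a cstar_alg" (structure) +
  assumes one_neq_zero: "\<one> \<noteq> \<zero>"

text \<open>Star homomorphisms need not preserve units.\<close>

definition star_hom :: "'a cstar_alg \<Rightarrow> 'b cstar_alg \<Rightarrow> ('a \<Rightarrow> 'b) set"
  where "star_hom A B = {\<phi>. \<phi> \<in> carrier A \<rightarrow> carrier B \<and>
    (\<forall>x\<in>carrier A. \<forall>y\<in>carrier A. \<phi> (x \<oplus>\<^bsub>A\<^esub> y) = \<phi> x \<oplus>\<^bsub>B\<^esub> \<phi> y) \<and>
    (\<forall>x\<in>carrier A. \<forall>y\<in>carrier A. \<phi> (x \<otimes>\<^bsub>A\<^esub> y) = \<phi> x \<otimes>\<^bsub>B\<^esub> \<phi> y) \<and>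
    (\<forall>c. \<forall>x\<in>carrier A. \<phi> (c \<odot>\<^bsub>A\<^esub> x) = c \<odot>\<^bsub>B\<^esub> \<phi> x) \<and>
    (\<forall>x\<in>carrier A. \<phi> (star A x) = star B (\<phi> x))}"

definition unital_star_hom :: "'a cstar_alg \<Rightarrow> 'b cstar_alg \<Rightarrow> ('a \<Rightarrow> 'b) set"
  where "unital_star_hom A B = {\<phi> \<in> star_hom A B. \<phi> \<one>\<^bsub>A\<^esub> = \<one>\<^bsub>B\<^esub>}"

definition star_automorphism :: "'a cstar_alg \<Rightarrow> ('a \<Rightarrow> 'a) \<Rightarrow> bool"
  where "star_automorphism A \<phi> \<longleftrightarrow>
    \<phi> \<in> unital_star_hom A A \<and> bij_betw \<phi> (carrier A) (carrier A)"

definition lin_span :: "'a cstar_alg \<Rightarrow> 'a set \<Rightarrow> 'a set"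
  where "lin_span A S = \<Inter>{V. submodule V complex_ring A \<and> S \<subseteq> V}"

definition closed_span :: "'a cstar_alg \<Rightarrow> 'a set \<Rightarrow> 'a set"
  where "closed_span A S = norm_topology A closure_of lin_span A S"

definition unital_cstar_subalgebra :: "'a set \<Rightarrow> 'a cstar_alg \<Rightarrow> bool"
  where "unital_cstar_subalgebra V A \<longleftrightarrow>
    submodule V complex_ring A \<and> \<one>\<^bsub>A\<^esub> \<in> V \<and>
    (\<forall>x\<in>V. \<forall>y\<in>V. x \<otimes>\<^bsub>A\<^esub> y \<in> V) \<and> (\<forall>x\<in>V. star A x \<in> V) \<and>
    closedin (norm_topology A) V"

text \<open>The direct limit of a sequence of C*-algebras, by its universal property. The targets range
  over all C*-algebras with carrier in the type \<^typ>\<open>'b\<close>, which is arbitrary; a theorem that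
  leaves \<^typ>\<open>'b\<close> free therefore covers all targets.\<close>

definition cstar_direct_limit ::
  "'b itself \<Rightarrow> (nat \<Rightarrow> 'a cstar_alg) \<Rightarrow> (nat \<Rightarrow> 'a \<Rightarrow> 'a) \<Rightarrow>
   'c cstar_alg \<Rightarrow> (nat \<Rightarrow> 'a \<Rightarrow> 'c) \<Rightarrow> bool"
  where "cstar_direct_limit TYPE('b) X \<phi> L \<iota> \<longleftrightarrow>
    (\<forall>n. cstar_algebra (X n)) \<and> (\<forall>n. \<phi> n \<in> star_hom (X n) (X (Suc n))) \<and>
    cstar_algebra L \<and> (\<forall>n. \<iota> n \<in> star_hom (X n) L) \<and>
    (\<forall>n. \<forall>x\<in>carrier (X n). \<iota> (Suc n) (\<phi> n x) = \<iota> n x) \<and>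
    (\<forall>(B :: 'b cstar_alg) \<psi>.
      cstar_algebra B \<and> (\<forall>n. \<psi> n \<in> star_hom (X n) B) \<and>
      (\<forall>n. \<forall>x\<in>carrier (X n). \<psi> (Suc n) (\<phi> n x) = \<psi> n x) \<longrightarrow>
      (\<exists>!h. h \<in> star_hom L B \<and> h \<in> extensional (carrier L) \<and>
        (\<forall>n. \<forall>x\<in>carrier (X n). h (\<iota> n x) = \<psi> n x)))"

text \<open>The spectrum of a commutative C*-algebra: the nonzero multiplicative linear functionals
  with the weak-* topology, i.e. the topology of pointwise convergence on the carrier.\<close>

definition characters :: "'a cstar_alg \<Rightarrow> ('a \<Rightarrow> complex) set"
  where "characters A = {f \<in> extensional (carrier A).
    (\<forall>x\<in>carrier A. \<forall>y\<in>carrier A. f (x \<oplus>\<^bsub>A\<^esub> y) = f x + f y) \<and>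
    (\<forall>x\<in>carrier A. \<forall>y\<in>carrier A. f (x \<otimes>\<^bsub>A\<^esub> y) = f x * f y) \<and>
    (\<forall>c. \<forall>x\<in>carrier A. f (c \<odot>\<^bsub>A\<^esub> x) = c * f x) \<and>
    (\<exists>x\<in>carrier A. f x \<noteq> 0)}"

definition spectrum :: "'a cstar_alg \<Rightarrow> ('a \<Rightarrow> complex) topology"
  where "spectrum A =
    subtopology (product_topology (\<lambda>_. euclidean) (carrier A)) (characters A)"


section \<open>The algebra of the self-similar graph\<close>

text \<open>The colours are the elements of a finite type \<^typ>\<open>'k\<close>, so k is its cardinality. Paths of
  the single-vertex graph with one edge of each colour form the free commutative monoid on the
  edges, i.e. multisets under addition; the degree map is \<^const>\<open>count\<close>. The group element
  \<open>a\<^sup>\<ell>\<close> is represented by the integer \<open>\<ell>\<close>, so the group operation is addition.\<close>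

type_synonym 'k path = "'k multiset"

definition edge :: "'k \<Rightarrow> 'k path"
  where "edge i = {#i#}"

definition degree :: "'k path \<Rightarrow> 'k \<Rightarrow> nat"
  where "degree \<mu> = count \<mu>"

definition all_edges :: "'k::finite path"
  where "all_edges = (\<Sum>i\<in>UNIV. edge i)"

text \<open>The restriction of \<open>a\<^sup>\<ell>\<close> along a path; the action itself is trivial.\<close>

definition restriction :: "('k::finite \<Rightarrow> int) \<Rightarrow> int \<Rightarrow> 'k path \<Rightarrow> int"
  where "restriction m l \<mu> = l * (\<Prod>i\<in>UNIV. m i ^ degree \<mu> i)"

definition is_isometry :: "'a cstar_alg \<Rightarrow> 'a \<Rightarrow> bool"
  where "is_isometry A x \<longleftrightarrow> x \<in> carrier A \<and> star A x \<otimes>\<^bsub>A\<^esub> x = \<one>\<^bsub>A\<^esub>"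

definition is_unitary :: "'a cstar_alg \<Rightarrow> 'a \<Rightarrow> bool"
  where "is_unitary A x \<longleftrightarrow> is_isometry A x \<and> x \<otimes>\<^bsub>A\<^esub> star A x = \<one>\<^bsub>A\<^esub>"

definition graph_family ::
  "('k::finite \<Rightarrow> int) \<Rightarrow> 'a cstar_alg \<Rightarrow> (int \<Rightarrow> 'a) \<Rightarrow> ('k path \<Rightarrow> 'a) \<Rightarrow> bool"
  where "graph_family m A u s \<longleftrightarrow>
    (\<forall>g. is_unitary A (u g)) \<and> (\<forall>\<mu>. is_isometry A (s \<mu>)) \<and>
    (\<forall>g h. u (g + h) = u g \<otimes>\<^bsub>A\<^esub> u h) \<and>
    (\<forall>\<mu> \<nu>. s \<mu> \<otimes>\<^bsub>A\<^esub> s \<nu> = s (\<mu> + \<nu>)) \<and>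
    (\<forall>\<mu>. s \<mu> \<otimes>\<^bsub>A\<^esub> star A (s \<mu>) = \<one>\<^bsub>A\<^esub>) \<and>
    (\<forall>g \<mu>. u g \<otimes>\<^bsub>A\<^esub> s \<mu> = s \<mu> \<otimes>\<^bsub>A\<^esub> u (restriction m g \<mu>))"

text \<open>\<open>A\<close> with \<open>u\<close> and \<open>s\<close> is the universal unital C*-algebra of the relations. A hypothesis cannot
  quantify over types, so the targets are all unital C*-algebras with carrier inside the same type
  \<^typ>\<open>'a\<close>. This is no restriction: \<open>A\<close> is nonzero, so \<^typ>\<open>'a\<close> has at least
  the cardinality of the continuum, while the C*-algebra generated by the
  countably many elements of a family in any unital C*-algebra has at most that cardinality and
  hence has an isomorphic copy with carrier inside \<^typ>\<open>'a\<close>. The induced homomorphism is unique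
  because \<open>A\<close> is generated by the family.\<close>

definition universal_graph_algebra ::
  "('k::finite \<Rightarrow> int) \<Rightarrow> 'a cstar_alg \<Rightarrow> (int \<Rightarrow> 'a) \<Rightarrow> ('k path \<Rightarrow> 'a) \<Rightarrow> bool"
  where "universal_graph_algebra m A u s \<longleftrightarrow>
    unital_cstar_algebra A \<and> graph_family m A u s \<and>
    (\<forall>V. unital_cstar_subalgebra V A \<and> range u \<union> range s \<subseteq> V \<longrightarrow> V = carrier A) \<and>
    (\<forall>(B :: 'a cstar_alg) U S. unital_cstar_algebra B \<and> graph_family m B U S \<longrightarrow>
      (\<exists>\<phi>\<in>unital_star_hom A B. (\<forall>g. \<phi> (u g) = U g) \<and> (\<forall>\<mu>. \<phi> (s \<mu>) = S \<mu>)))"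

definition torus :: "('k \<Rightarrow> complex) set"
  where "torus = {t. \<forall>i. cmod (t i) = 1}"

definition gauge_action ::
  "'a cstar_alg \<Rightarrow> (int \<Rightarrow> 'a) \<Rightarrow> ('k::finite path \<Rightarrow> 'a) \<Rightarrow> ('k \<Rightarrow> complex) \<Rightarrow> 'a \<Rightarrow> 'a"
  where "gauge_action A u s t = (THE \<gamma>.
    \<gamma> \<in> extensional (carrier A) \<and> star_automorphism A \<gamma> \<and>
    (\<forall>\<mu> g \<nu>. \<gamma> (s \<mu> \<otimes>\<^bsub>A\<^esub> u g \<otimes>\<^bsub>A\<^esub> star A (s \<nu>)) =
      (\<Prod>i\<in>UNIV. t i powi (int (degree \<mu> i) - int (degree \<nu> i)))
        \<odot>\<^bsub>A\<^esub> (s \<mu> \<otimes>\<^bsub>A\<^esub> u g \<otimes>\<^bsub>A\<^esub> star A (s \<nu>))))"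

definition gauge_fixed_algebra ::
  "'a cstar_alg \<Rightarrow> (int \<Rightarrow> 'a) \<Rightarrow> ('k::finite path \<Rightarrow> 'a) \<Rightarrow> 'a cstar_alg"
  where "gauge_fixed_algebra A u s =
    A\<lparr>carrier := {x \<in> carrier A. \<forall>t\<in>torus. gauge_action A u s t x = x}\<rparr>"

text \<open>The spanning element with path \<open>\<ee>\<^sup>n\<close> and group element \<open>a\<^sup>p\<close>, where \<open>\<ee>\<close> is
  \<^const>\<open>all_edges\<close>; powers in the path monoid are \<^const>\<open>repeat_mset\<close>.\<close>

definition stage_generator ::
  "'a cstar_alg \<Rightarrow> (int \<Rightarrow> 'a) \<Rightarrow> ('k::finite path \<Rightarrow> 'a) \<Rightarrow> nat \<Rightarrow> int \<Rightarrow> 'a"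
  where "stage_generator A u s n p =
    s (repeat_mset n all_edges) \<otimes>\<^bsub>A\<^esub> u p \<otimes>\<^bsub>A\<^esub> star A (s (repeat_mset n all_edges))"

definition stage_algebra ::
  "'a cstar_alg \<Rightarrow> (int \<Rightarrow> 'a) \<Rightarrow> ('k::finite path \<Rightarrow> 'a) \<Rightarrow> nat \<Rightarrow> 'a cstar_alg"
  where "stage_algebra A u s n =
    A\<lparr>carrier := closed_span A (range (stage_generator A u s n))\<rparr>"

definition solenoid :: "int \<Rightarrow> (nat \<Rightarrow> complex) topology"
  where "solenoid M =
    subtopology (product_topology (\<lambda>_. top_of_set (sphere 0 1)) UNIV)
      {z. \<forall>n. z n = z (Suc n) powi M}"

end

(* Averaging over the gauge action with parameters t such that t^d = -1 removes components of nonzero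
   degree d, so the fixed point algebra F is the closure of the union of the stages F_n; the universal
   property of the limit is extension by continuity, star homomorphisms being contractive.

   A character of F is determined by the points z_n at which it sends the unitaries
   s_{e^n} u_a s_{e^n}^*, and these satisfy z_n = z_{n+1}^M. This gives a continuous injection of the
   compact spectrum into the solenoid. It is onto because its closed image contains every point whose
   coordinates are N-th roots of unity with N coprime to M, and such points are dense. These points come
   from representations on finite-dimensional spaces: u acts diagonally with all N-th roots of unity as
   eigenvalues, and s_i permutes the eigenvectors by z -> z^{m_i}. The universal property only speaks
   about algebras inside the type of A, so the matrix algebras are moved there along an injection, which
   exists because they have the cardinality of the continuum. *)
theory Submission
  imports Defs "HOL-Number_Theory.Cong"
begin

section \<open>Norm geometry of C*-algebras with explicit carrier\<close>

text \<open>What spectral theory usually supplies comes from Banach's fixed point theorem here. It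
  is used twice: on a closed set of self-adjoint elements, for contractivity of star homomorphisms,
  and on a whole algebra, to bound characters by the norm. The second bound makes the spectrum
  compact by Tychonoff's theorem. The conditional expectation onto F would be an integral over the
  torus. An element of the linear span of the words has only finitely many degrees, so a finite
  composition of averages does the same work for it, and density does the rest. The orbit of a point
  of infinite order under the power maps is in general infinite, which rules out a
  finite-dimensional model. For N-th roots of unity N must be coprime to M because each s_i has to
  be unitary, so that z -> z^{m_i} must permute the roots. Density concerns finitely many
  coordinates at a time, and these are powers of the last one: it suffices to approximate a single
  point of the circle, for which N = |M| L + 1 with L large works.\<close>

lemma complex_ring_simps [simp]:
  "carrier complex_ring = UNIV" "x \<otimes>\<^bsub>complex_ring\<^esub> y = x * y" "\<one>\<^bsub>complex_ring\<^esub> = 1"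
  "\<zero>\<^bsub>complex_ring\<^esub> = 0" "x \<oplus>\<^bsub>complex_ring\<^esub> y = x + y"
  by (simp_all add: complex_ring_def)

lemma cring_complex_ring: "cring complex_ring"
  by (intro cringI abelian_groupI comm_monoidI)
    (auto simp: algebra_simps intro: exI[of _ "- x" for x])

definition closed_subspace :: "'a cstar_alg \<Rightarrow> 'a set \<Rightarrow> bool"
  where "closed_subspace A V \<longleftrightarrow>
    submodule V complex_ring A \<and> closedin (norm_topology A) V"

text \<open>The unspecified \<open>\<sigma>\<close> admits the conjugate linear star operation next
  to linear maps. Preimages of subspaces do not see which scalar comes out.\<close>

definition bounded_semilinear :: "'a cstar_alg \<Rightarrow> 'b cstar_alg \<Rightarrow> ('a \<Rightarrow> 'b) \<Rightarrow> bool"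
  where "bounded_semilinear A B T \<longleftrightarrow> T \<in> carrier A \<rightarrow> carrier B \<and>
    (\<forall>x\<in>carrier A. \<forall>y\<in>carrier A. T (x \<oplus>\<^bsub>A\<^esub> y) = T x \<oplus>\<^bsub>B\<^esub> T y) \<and>
    (\<exists>\<sigma>. \<forall>c. \<forall>x\<in>carrier A. T (c \<odot>\<^bsub>A\<^esub> x) = \<sigma> c \<odot>\<^bsub>B\<^esub> T x) \<and>
    (\<exists>C. \<forall>x\<in>carrier A. cnorm B (T x) \<le> C * cnorm A x)"

section \<open>Algebraic rules and norm estimates\<close>

context cstar_algebra
begin

lemma csmult_closed [simp]: "x \<in> carrier A \<Longrightarrow> c \<odot> x \<in> carrier A"
  by (rule smult_closed) auto

lemma csmult_add_left: "x \<in> carrier A \<Longrightarrow> (c + d) \<odot> x = c \<odot> x \<oplus> d \<odot> x"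
  using smult_l_distr[of c d x] by simp

lemma csmult_add_right:
  "\<lbrakk>x \<in> carrier A; y \<in> carrier A\<rbrakk> \<Longrightarrow> c \<odot> (x \<oplus> y) = c \<odot> x \<oplus> c \<odot> y"
  using smult_r_distr[of c x y] by simp

lemma csmult_csmult: "x \<in> carrier A \<Longrightarrow> c \<odot> (d \<odot> x) = (c * d) \<odot> x"
  using smult_assoc1[of c d x] by simp

lemma csmult_one [simp]: "x \<in> carrier A \<Longrightarrow> 1 \<odot> x = x"
  using smult_one[of x] by simp

lemma csmult_zero_left [simp]: "x \<in> carrier A \<Longrightarrow> 0 \<odot> x = \<zero>"
  using smult_l_null[of x] by simp

lemma a_inv_conv_smult: "x \<in> carrier A \<Longrightarrow> \<ominus> x = (-1) \<odot> x"
  using csmult_add_left[of x "1" "-1"]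
  by (metis M.add.m_closed M.minus_equality M.a_comm add.right_inverse csmult_closed csmult_one
      csmult_zero_left)

lemma minus_conv_smult: "x \<in> carrier A \<Longrightarrow> y \<in> carrier A \<Longrightarrow> x \<ominus> y = x \<oplus> (-1) \<odot> y"
  by (simp add: a_minus_def a_inv_conv_smult)

lemmas c_closed [simp] = cmult_closed star_closed

lemma mult_minus_distrib_left:
  "\<lbrakk>x \<in> carrier A; y \<in> carrier A; z \<in> carrier A\<rbrakk> \<Longrightarrow> z \<otimes> (x \<ominus> y) = z \<otimes> x \<ominus> z \<otimes> y"
  by (simp add: minus_conv_smult r_distrib smult_mult_right)

lemma mult_minus_distrib_right:
  "\<lbrakk>x \<in> carrier A; y \<in> carrier A; z \<in> carrier A\<rbrakk> \<Longrightarrow> (x \<ominus> y) \<otimes> z = x \<otimes> z \<ominus> y \<otimes> z"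
  by (simp add: minus_conv_smult l_distrib smult_mult_left)

lemma csmult_minus:
  "\<lbrakk>x \<in> carrier A; y \<in> carrier A\<rbrakk> \<Longrightarrow> c \<odot> (x \<ominus> y) = c \<odot> x \<ominus> c \<odot> y"
  by (simp add: minus_conv_smult csmult_add_right csmult_csmult)

lemma mult_zero_left [simp]: "x \<in> carrier A \<Longrightarrow> \<zero> \<otimes> x = \<zero>"
  using smult_mult_left[of \<zero> x 0] by simp

lemma mult_zero_right [simp]: "x \<in> carrier A \<Longrightarrow> x \<otimes> \<zero> = \<zero>"
  using smult_mult_right[of x \<zero> 0] by simp

lemma star_zero [simp]: "star A \<zero> = \<zero>"
  using star_smult[of \<zero> 0] by simp

lemma cnorm_zero [simp]: "cnorm A \<zero> = 0"
  using cnorm_eq_zero by blast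

lemma cnorm_uminus: "x \<in> carrier A \<Longrightarrow> cnorm A (\<ominus> x) = cnorm A x"
  by (simp add: a_inv_conv_smult cnorm_smult)

text \<open>The C*-identity and submultiplicativity bound the square of the norm of y by the product
  of the norms of y and its adjoint. Cancelling gives one inequality, and the adjoint in place of y
  gives the other.\<close>

lemma cnorm_star [simp]:
  assumes "x \<in> carrier A" shows "cnorm A (star A x) = cnorm A x"
proof -
  have le: "cnorm A y \<le> cnorm A (star A y)" if "y \<in> carrier A" for y
  proof (cases "cnorm A y = 0")
    case False
    have "cnorm A y * cnorm A y \<le> cnorm A (star A y) * cnorm A y"
      using cstar_identity[of y] cnorm_mult[of "star A y" y] that by (simp add: power2_eq_square)
    then show ?thesis using False cnorm_nonneg[OF that] by simp
  qed (use that cnorm_nonneg in simp)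
  show ?thesis using le[of x] le[of "star A x"] assms star_star by simp
qed

lemma minus_add_cancel: 
  "\<lbrakk>x \<in> carrier A; y \<in> carrier A; z \<in> carrier A\<rbrakk> \<Longrightarrow> x \<ominus> z = (x \<ominus> y) \<oplus> (y \<ominus> z)"
  by (simp add: a_minus_def M.a_assoc M.add.inv_solve_left M.a_lcomm M.l_neg M.r_neg1 M.r_neg2)

lemma cnorm_minus_triangle:
  assumes "x \<in> carrier A" "y \<in> carrier A" "z \<in> carrier A"
  shows "cnorm A (x \<ominus> z) \<le> cnorm A (x \<ominus> y) + cnorm A (y \<ominus> z)"
  using minus_add_cancel[OF assms] cnorm_triangle[of "x \<ominus> y" "y \<ominus> z"] assms by simp

lemma cnorm_minus_commute:
  assumes "x \<in> carrier A" "y \<in> carrier A"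
  shows "cnorm A (x \<ominus> y) = cnorm A (y \<ominus> x)"
proof -
  have "y \<ominus> x = \<ominus> (x \<ominus> y)"
    using assms by (simp add: a_minus_def M.minus_add M.minus_minus M.a_comm)
  then show ?thesis using cnorm_uminus[of "x \<ominus> y"] assms by simp
qed

lemma minus_eq_zero_iff [simp]:
  "\<lbrakk>x \<in> carrier A; y \<in> carrier A\<rbrakk> \<Longrightarrow> x \<ominus> y = \<zero> \<longleftrightarrow> x = y"
  by (metis a_minus_def M.a_inv_closed M.minus_equality M.minus_minus M.r_neg)

lemma minus_self [simp]: "x \<in> carrier A \<Longrightarrow> x \<ominus> x = \<zero>"
  by simp

lemma cnorm_minus_eq_zero:
  "\<lbrakk>x \<in> carrier A; y \<in> carrier A\<rbrakk> \<Longrightarrow> cnorm A (x \<ominus> y) = 0 \<longleftrightarrow> x = y"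
  by (simp add: cnorm_eq_zero)

lemma add_minus_add:
  "\<lbrakk>x \<in> carrier A; y \<in> carrier A; x' \<in> carrier A; y' \<in> carrier A\<rbrakk>
    \<Longrightarrow> (x \<oplus> y) \<ominus> (x' \<oplus> y') = (x \<ominus> x') \<oplus> (y \<ominus> y')"
  by (simp add: a_minus_def M.minus_add M.a_ac)

lemma cnorm_add_minus_add:
  "\<lbrakk>x \<in> carrier A; y \<in> carrier A; x' \<in> carrier A; y' \<in> carrier A\<rbrakk>
    \<Longrightarrow> cnorm A ((x \<oplus> y) \<ominus> (x' \<oplus> y')) \<le> cnorm A (x \<ominus> x') + cnorm A (y \<ominus> y')"
  by (simp add: add_minus_add cnorm_triangle)

lemma cnorm_smult_minus:
  "\<lbrakk>x \<in> carrier A; y \<in> carrier A\<rbrakk> \<Longrightarrow>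
    cnorm A (c \<odot> x \<ominus> c \<odot> y) = cmod c * cnorm A (x \<ominus> y)"
  by (simp flip: csmult_minus add: cnorm_smult)

lemma cnorm_star_minus:
  assumes "x \<in> carrier A" "y \<in> carrier A"
  shows "cnorm A (star A x \<ominus> star A y) = cnorm A (x \<ominus> y)"
proof -
  have "star A x \<ominus> star A y = star A (x \<ominus> y)"
    using assms by (simp add: minus_conv_smult star_add star_smult)
  then show ?thesis using assms by simp
qed

lemma cnorm_mult_minus_mult:
  assumes "x \<in> carrier A" "y \<in> carrier A" "x' \<in> carrier A" "y' \<in> carrier A"
  shows "cnorm A (x \<otimes> y \<ominus> x' \<otimes> y')
    \<le> cnorm A (x \<ominus> x') * cnorm A y + cnorm A x' * cnorm A (y \<ominus> y')"
proof -
  have "cnorm A (x \<otimes> y \<ominus> x' \<otimes> y')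
      \<le> cnorm A (x \<otimes> y \<ominus> x' \<otimes> y) + cnorm A (x' \<otimes> y \<ominus> x' \<otimes> y')"
    by (rule cnorm_minus_triangle) (use assms in auto)
  also have "x \<otimes> y \<ominus> x' \<otimes> y = (x \<ominus> x') \<otimes> y"
    by (rule mult_minus_distrib_right[symmetric]) (use assms in auto)
  also have "x' \<otimes> y \<ominus> x' \<otimes> y' = x' \<otimes> (y \<ominus> y')"
    by (rule mult_minus_distrib_left[symmetric]) (use assms in auto)
  finally show ?thesis
    using cnorm_mult[of "x \<ominus> x'" y] cnorm_mult[of x' "y \<ominus> y'"] assms by simp
qed

sublocale met: Metric_space "carrier A" "cdist A"
proof
  show "cdist A x y = cdist A y x" for x y
    using cnorm_minus_commute by (simp add: cdist_def)
  show "cdist A x z \<le> cdist A x y + cdist A y z"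
    if "x \<in> carrier A" "y \<in> carrier A" "z \<in> carrier A" for x y z
    using that cnorm_minus_triangle by (simp add: cdist_def)
qed (use cnorm_nonneg cnorm_minus_eq_zero in \<open>auto simp: cdist_def\<close>)

lemma cdist_eq: "x \<in> carrier A \<Longrightarrow> y \<in> carrier A \<Longrightarrow> cdist A x y = cnorm A (x \<ominus> y)"
  by (simp add: cdist_def)

section \<open>Closed subspaces\<close>

lemma in_closure_of_iff:
  assumes "S \<subseteq> carrier A"
  shows "x \<in> norm_topology A closure_of S \<longleftrightarrow>
    x \<in> carrier A \<and> (\<forall>e>0. \<exists>y\<in>S. cnorm A (x \<ominus> y) < e)"
  using assms unfolding norm_topology_def met.metric_closure_of
  by (auto simp: met.in_mball cdist_eq subset_iff) (metis cdist_eq)+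

lemma closedin_norm_iff:
  "closedin (norm_topology A) V \<longleftrightarrow> V \<subseteq> carrier A \<and>
    (\<forall>x\<in>carrier A. (\<forall>e>0. \<exists>y\<in>V. cnorm A (x \<ominus> y) < e) \<longrightarrow> x \<in> V)"
proof -
  have "topspace (norm_topology A) = carrier A" by (simp add: norm_topology_def)
  then show ?thesis
    using in_closure_of_iff[of V] closure_of_subset_eq[of V "norm_topology A"]
    by (metis closedin_subset subsetI subsetD)
qed

lemma closed_approx:
  "\<lbrakk>closedin (norm_topology A) V; x \<in> carrier A; \<And>e. e > 0 \<Longrightarrow> \<exists>y\<in>V. cnorm A (x \<ominus> y) < e\<rbrakk>
    \<Longrightarrow> x \<in> V"
  by (auto simp: closedin_norm_iff)

lemma submodule_complexI:
  assumes "V \<subseteq> carrier A" "\<zero> \<in> V" "\<And>x y. \<lbrakk>x \<in> V; y \<in> V\<rbrakk> \<Longrightarrow> x \<oplus> y \<in> V"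
    and "\<And>c x. x \<in> V \<Longrightarrow> c \<odot> x \<in> V"
  shows "submodule V complex_ring A"
  using assms by (intro submoduleI) (auto simp: a_inv_conv_smult subset_iff)

lemma submodule_complexD:
  assumes "submodule V complex_ring A"
  shows "V \<subseteq> carrier A" "\<zero> \<in> V" "\<lbrakk>x \<in> V; y \<in> V\<rbrakk> \<Longrightarrow> x \<oplus> y \<in> V"
    and "x \<in> V \<Longrightarrow> c \<odot> x \<in> V" "\<lbrakk>x \<in> V; y \<in> V\<rbrakk> \<Longrightarrow> x \<ominus> y \<in> V"
proof -
  note * = submoduleE[OF assms]
  show "V \<subseteq> carrier A" "\<lbrakk>x \<in> V; y \<in> V\<rbrakk> \<Longrightarrow> x \<oplus> y \<in> V" "x \<in> V \<Longrightarrow> c \<odot> x \<in> V"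
    using * by auto
  show "\<lbrakk>x \<in> V; y \<in> V\<rbrakk> \<Longrightarrow> x \<ominus> y \<in> V"
    using * by (auto simp: a_minus_def)
  obtain v where "v \<in> V" using * by auto
  then have "v \<in> carrier A" "0 \<odot> v \<in> V" using * by auto
  then show "\<zero> \<in> V" by simp
qed

lemma closed_subspaceI:
  assumes "V \<subseteq> carrier A" "\<zero> \<in> V" "\<And>x y. \<lbrakk>x \<in> V; y \<in> V\<rbrakk> \<Longrightarrow> x \<oplus> y \<in> V"
    and "\<And>c x. x \<in> V \<Longrightarrow> c \<odot> x \<in> V"
    and "\<And>x. \<lbrakk>x \<in> carrier A; \<And>e. e > 0 \<Longrightarrow> \<exists>y\<in>V. cnorm A (x \<ominus> y) < e\<rbrakk> \<Longrightarrow> x \<in> V"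
  shows "closed_subspace A V"
  using assms submodule_complexI[of V] by (auto simp: closed_subspace_def closedin_norm_iff)

lemma closed_subspaceD:
  assumes "closed_subspace A V"
  shows "V \<subseteq> carrier A" "\<zero> \<in> V" "\<lbrakk>x \<in> V; y \<in> V\<rbrakk> \<Longrightarrow> x \<oplus> y \<in> V"
    and "x \<in> V \<Longrightarrow> c \<odot> x \<in> V" "\<lbrakk>x \<in> V; y \<in> V\<rbrakk> \<Longrightarrow> x \<ominus> y \<in> V"
    and "\<lbrakk>x \<in> carrier A; \<And>e. e > 0 \<Longrightarrow> \<exists>y\<in>V. cnorm A (x \<ominus> y) < e\<rbrakk> \<Longrightarrow> x \<in> V"
  using assms submodule_complexD[of V] closed_approx[of V] by (auto simp: closed_subspace_def)

lemma closed_subspace_zero: "closed_subspace A {\<zero>}"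
proof (rule closed_subspaceI)
  fix x assume x: "x \<in> carrier A" and a: "\<And>e. e > 0 \<Longrightarrow> \<exists>y\<in>{\<zero>}. cnorm A (x \<ominus> y) < e"
  have "cnorm A (x \<ominus> \<zero>) < e" if "e > 0" for e using a[OF that] by simp
  then have "cnorm A (x \<ominus> \<zero>) \<le> 0" by (meson field_lbound_gt_zero less_irrefl not_le)
  then show "x \<in> {\<zero>}"
    using cnorm_minus_eq_zero[of x \<zero>] cnorm_nonneg[of "x \<ominus> \<zero>"] x by simp
qed auto

lemma closed_subspace_carrier: "closed_subspace A (carrier A)"
  by (rule closed_subspaceI) auto

lemma closed_subspace_closure:
  assumes "submodule V complex_ring A"
  shows "closed_subspace A (norm_topology A closure_of V)"
proof (rule closed_subspaceI)
  note V = submodule_complexD[OF assms]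
  let ?C = "norm_topology A closure_of V"
  have mem: "x \<in> ?C \<longleftrightarrow> x \<in> carrier A \<and> (\<forall>e>0. \<exists>y\<in>V. cnorm A (x \<ominus> y) < e)" for x
    by (rule in_closure_of_iff) (rule V)
  show "?C \<subseteq> carrier A" using mem by auto
  have VC: "V \<subseteq> ?C" using V(1) closure_of_subset[of V "norm_topology A"] 
    by (simp add: norm_topology_def)
  then show "\<zero> \<in> ?C" using V by auto
  show "x \<oplus> y \<in> ?C" if xy: "x \<in> ?C" "y \<in> ?C" for x y
    unfolding mem
  proof (intro conjI allI impI)
    fix e :: real assume "e > 0"
    then have e2: "e/2 > 0" by simp
    obtain x' where x': "x' \<in> V" "cnorm A (x \<ominus> x') < e/2" using xy(1) e2 unfolding mem by blast
    obtain y' where y': "y' \<in> V" "cnorm A (y \<ominus> y') < e/2" using xy(2) e2 unfolding mem by blast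
    have "x \<in> carrier A" "y \<in> carrier A" "x' \<in> carrier A" "y' \<in> carrier A"
      using x' y' xy V(1) mem by auto
    then have "cnorm A (x \<oplus> y \<ominus> (x' \<oplus> y')) < e"
      using cnorm_add_minus_add[of x y x' y'] x'(2) y'(2) by simp
    then show "\<exists>z\<in>V. cnorm A (x \<oplus> y \<ominus> z) < e" using V x' y' by blast
  qed (use xy mem in auto)
  show "c \<odot> x \<in> ?C" if xC: "x \<in> ?C" for x c
    unfolding mem
  proof (intro conjI allI impI)
    fix e :: real assume "e > 0"
    \<comment> \<open>The extra 1 keeps the denominator positive when c = 0.\<close>
    then have e2: "e/(cmod c+1) > 0" by (simp add: add_nonneg_pos)
    obtain x' where x': "x' \<in> V" "cnorm A (x \<ominus> x') < e/(cmod c + 1)"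
      using xC e2 unfolding mem by blast
    have "x \<in> carrier A" "x' \<in> carrier A" using xC x' mem V(1) by auto
    then have "cnorm A (c \<odot> x \<ominus> c \<odot> x') \<le> (cmod c + 1) * cnorm A (x \<ominus> x')"
      by (simp add: cnorm_smult_minus cnorm_nonneg mult_right_mono)
    also have "\<dots> < e"
      using x' by (simp add: less_divide_eq mult.commute add_nonneg_pos)
    finally show "\<exists>z\<in>V. cnorm A (c \<odot> x \<ominus> z) < e" using V x' by blast
  qed (use xC mem in auto)
  show "x \<in> ?C" if "x \<in> carrier A" "\<And>e. e > 0 \<Longrightarrow> \<exists>y\<in>?C. cnorm A (x \<ominus> y) < e" for x
    using closed_approx[of ?C x] that by simp
qed

section \<open>Linear and closed spans\<close>

lemma submodule_lin_span:
  assumes "S \<subseteq> carrier A" shows "submodule (lin_span A S) complex_ring A"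
proof -
  have 1: "carrier A \<in> {V. submodule V complex_ring A \<and> S \<subseteq> V}"
    using carrier_is_submodule assms by simp
  show ?thesis unfolding lin_span_def
    by (rule submodule_complexI) (use 1 submodule_complexD in \<open>auto 4 4\<close>)
qed

lemma lin_span_subset: "S \<subseteq> lin_span A S"
  by (auto simp: lin_span_def)

lemma lin_span_minimal: "\<lbrakk>submodule V complex_ring A; S \<subseteq> V\<rbrakk> \<Longrightarrow> lin_span A S \<subseteq> V"
  by (auto simp: lin_span_def)

lemma closed_subspace_closed_span:
  "S \<subseteq> carrier A \<Longrightarrow> closed_subspace A (closed_span A S)"
  unfolding closed_span_def by (intro closed_subspace_closure submodule_lin_span)

lemma closed_span_subset:
  assumes "S \<subseteq> carrier A" shows "S \<subseteq> closed_span A S"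
proof -
  have "lin_span A S \<subseteq> carrier A"
    using submodule_complexD(1)[OF submodule_lin_span[OF assms]] .
  then show ?thesis
    using lin_span_subset[of S] closure_of_subset[of "lin_span A S" "norm_topology A"]
    by (auto simp: closed_span_def norm_topology_def)
qed

text \<open>Serves as the induction principle for closed spans: a property that defines a closed
  subspace need only be checked on the generators. Such subspaces are mostly preimages and
  equalizers of bounded maps.\<close>

lemma closed_span_minimal:
  "\<lbrakk>closed_subspace A V; S \<subseteq> V\<rbrakk> \<Longrightarrow> closed_span A S \<subseteq> V"
  unfolding closed_span_def closed_subspace_def
  by (intro closure_of_minimal lin_span_minimal) auto

lemma closed_span_approx:
  assumes "S \<subseteq> carrier A" "x \<in> closed_span A S" "e > 0"
  shows "\<exists>y\<in>lin_span A S. cnorm A (x \<ominus> y) < e"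
  using in_closure_of_iff[of "lin_span A S" x] assms
    submodule_complexD(1)[OF submodule_lin_span[OF assms(1)]]
  by (auto simp: closed_span_def)

end

lemma bounded_semilinear_minus:
  assumes "cstar_algebra A" "cstar_algebra B" "bounded_semilinear A B T"
    and "x \<in> carrier A" "y \<in> carrier A"
  shows "T (x \<ominus>\<^bsub>A\<^esub> y) = T x \<ominus>\<^bsub>B\<^esub> T y"
proof -
  interpret A: cstar_algebra A by fact
  interpret B: cstar_algebra B by fact
  have T: "T \<in> carrier A \<rightarrow> carrier B" 
    "\<And>x y. x \<in> carrier A \<Longrightarrow> y \<in> carrier A \<Longrightarrow> T (x \<oplus>\<^bsub>A\<^esub> y) = T x \<oplus>\<^bsub>B\<^esub> T y"
    using assms(3) by (auto simp: bounded_semilinear_def)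
  have "T (x \<ominus>\<^bsub>A\<^esub> y) \<oplus>\<^bsub>B\<^esub> T y = T (x \<ominus>\<^bsub>A\<^esub> y \<oplus>\<^bsub>A\<^esub> y)"
    using T assms by simp
  also have "x \<ominus>\<^bsub>A\<^esub> y \<oplus>\<^bsub>A\<^esub> y = x"
    using assms by (simp add: a_minus_def A.M.a_assoc A.M.l_neg)
  finally have "T x = T (x \<ominus>\<^bsub>A\<^esub> y) \<oplus>\<^bsub>B\<^esub> T y" by simp
  moreover have "T (x \<ominus>\<^bsub>A\<^esub> y) \<in> carrier B" "T y \<in> carrier B" using T(1) assms by auto
  ultimately show ?thesis by (simp add: a_minus_def B.M.a_assoc B.M.r_neg)
qed

lemma closed_subspace_vimage:
  assumes "cstar_algebra A" "cstar_algebra B" "bounded_semilinear A B T" "closed_subspace B V"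
  shows "closed_subspace A {x \<in> carrier A. T x \<in> V}"
proof -
  interpret A: cstar_algebra A by fact
  interpret B: cstar_algebra B by fact
  note V = B.closed_subspaceD[OF assms(4)]
  have T: "T \<in> carrier A \<rightarrow> carrier B" 
    "\<And>x y. x \<in> carrier A \<Longrightarrow> y \<in> carrier A \<Longrightarrow> T (x \<oplus>\<^bsub>A\<^esub> y) = T x \<oplus>\<^bsub>B\<^esub> T y"
    using assms(3) by (auto simp: bounded_semilinear_def)
  obtain \<sigma> where \<sigma>: "\<And>c x. x \<in> carrier A \<Longrightarrow> T (c \<odot>\<^bsub>A\<^esub> x) = \<sigma> c \<odot>\<^bsub>B\<^esub> T x"
    using assms(3) by (auto simp: bounded_semilinear_def)
  obtain C where C: "\<And>x. x \<in> carrier A \<Longrightarrow> cnorm B (T x) \<le> C * cnorm A x"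
    using assms(3) unfolding bounded_semilinear_def by blast
  have "T \<zero>\<^bsub>A\<^esub> \<ominus>\<^bsub>B\<^esub> T \<zero>\<^bsub>A\<^esub> = \<zero>\<^bsub>B\<^esub>"
    using T(1) A.M.zero_closed by (simp add: Pi_iff del: A.M.zero_closed)
  then have T0: "T \<zero>\<^bsub>A\<^esub> = \<zero>\<^bsub>B\<^esub>"
    using bounded_semilinear_minus[OF assms(1-3), of "\<zero>\<^bsub>A\<^esub>" "\<zero>\<^bsub>A\<^esub>"]
    by (metis A.M.zero_closed A.minus_eq_zero_iff)
  show ?thesis
  proof (rule A.closed_subspaceI)
    fix x assume x: "x \<in> carrier A"
      and a: "\<And>e. e > 0 \<Longrightarrow> \<exists>y\<in>{x \<in> carrier A. T x \<in> V}. cnorm A (x \<ominus>\<^bsub>A\<^esub> y) < e"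
    have "T x \<in> V"
    proof (rule V(6))
      fix e :: real assume "e > 0"
      then have "e / (\<bar>C\<bar> + 1) > 0" by (simp add: add_nonneg_pos)
      from a[OF this] obtain y where y: "y \<in> carrier A" "T y \<in> V"
        "cnorm A (x \<ominus>\<^bsub>A\<^esub> y) < e / (\<bar>C\<bar> + 1)" by auto
      have "cnorm B (T x \<ominus>\<^bsub>B\<^esub> T y) = cnorm B (T (x \<ominus>\<^bsub>A\<^esub> y))"
        using bounded_semilinear_minus[OF assms(1-3)] x y by simp
      also have "\<dots> \<le> C * cnorm A (x \<ominus>\<^bsub>A\<^esub> y)" using C x y by simp
      also have "\<dots> \<le> (\<bar>C\<bar> + 1) * cnorm A (x \<ominus>\<^bsub>A\<^esub> y)"
        using x y by (intro mult_right_mono A.cnorm_nonneg) auto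
      also have "\<dots> < e" using y(3) by (simp add: field_simps add_nonneg_pos)
      finally show "\<exists>y\<in>V. cnorm B (T x \<ominus>\<^bsub>B\<^esub> y) < e" using y by blast
    qed (use T x in auto)
    then show "x \<in> {x \<in> carrier A. T x \<in> V}" using x by simp
  qed (use V T T0 \<sigma> in auto)
qed

text \<open>The equalizer is the kernel of the difference of the two maps. Homogeneity is assumed
  separately because two semilinear maps could transform scalars differently, and their difference
  would then not be semilinear.\<close>

lemma closed_subspace_equalizer:
  assumes A: "cstar_algebra A" and B: "cstar_algebra B"
    and T: "bounded_semilinear A B T" and T': "bounded_semilinear A B T'"
    and h: "\<And>c x. x \<in> carrier A \<Longrightarrow> T (c \<odot>\<^bsub>A\<^esub> x) = c \<odot>\<^bsub>B\<^esub> T x"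
    and h': "\<And>c x. x \<in> carrier A \<Longrightarrow> T' (c \<odot>\<^bsub>A\<^esub> x) = c \<odot>\<^bsub>B\<^esub> T' x"
  shows "closed_subspace A {x \<in> carrier A. T x = T' x}"
proof -
  interpret A: cstar_algebra A by fact
  interpret B: cstar_algebra B by fact
  have TT: "T \<in> carrier A \<rightarrow> carrier B" "T' \<in> carrier A \<rightarrow> carrier B"
    "\<And>x y. x \<in> carrier A \<Longrightarrow> y \<in> carrier A \<Longrightarrow> T (x \<oplus>\<^bsub>A\<^esub> y) = T x \<oplus>\<^bsub>B\<^esub> T y"
    "\<And>x y. x \<in> carrier A \<Longrightarrow> y \<in> carrier A \<Longrightarrow> T' (x \<oplus>\<^bsub>A\<^esub> y) = T' x \<oplus>\<^bsub>B\<^esub> T' y"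
    using T T' by (auto simp: bounded_semilinear_def)
  obtain C where C: "\<And>x. x \<in> carrier A \<Longrightarrow> cnorm B (T x) \<le> C * cnorm A x"
    using T unfolding bounded_semilinear_def by blast
  obtain C' where C': "\<And>x. x \<in> carrier A \<Longrightarrow> cnorm B (T' x) \<le> C' * cnorm A x"
    using T' unfolding bounded_semilinear_def by blast
  let ?D = "\<lambda>x. T x \<ominus>\<^bsub>B\<^esub> T' x"
  have "cnorm B (?D x) \<le> (C + C') * cnorm A x" if "x \<in> carrier A" for x
  proof -
    have "cnorm B (?D x) \<le> cnorm B (T x) + cnorm B (\<ominus>\<^bsub>B\<^esub> T' x)"
      unfolding a_minus_def using TT that by (intro B.cnorm_triangle) auto
    also have "cnorm B (\<ominus>\<^bsub>B\<^esub> T' x) = cnorm B (T' x)" 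
      using TT that by (intro B.cnorm_uminus) auto
    finally show ?thesis using C[OF that] C'[OF that] by (simp add: algebra_simps)
  qed
  moreover have "?D (x \<oplus>\<^bsub>A\<^esub> y) = ?D x \<oplus>\<^bsub>B\<^esub> ?D y" if "x \<in> carrier A" "y \<in> carrier A" for x y
    using TT that by (simp add: B.add_minus_add Pi_iff)
  moreover have "?D (c \<odot>\<^bsub>A\<^esub> x) = c \<odot>\<^bsub>B\<^esub> ?D x" if "x \<in> carrier A" for c x
    using TT that by (simp add: h h' B.csmult_minus Pi_iff)
  ultimately have "bounded_semilinear A B ?D"
    unfolding bounded_semilinear_def using TT by (auto intro!: exI[of _ "\<lambda>c. c"])
  then have "closed_subspace A {x \<in> carrier A. ?D x \<in> {\<zero>\<^bsub>B\<^esub>}}"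
    using closed_subspace_vimage[OF A B] B.closed_subspace_zero by blast
  also have "{x \<in> carrier A. ?D x \<in> {\<zero>\<^bsub>B\<^esub>}} = {x \<in> carrier A. T x = T' x}"
    using TT by (auto simp: Pi_iff)
  finally show ?thesis .
qed

section \<open>Contractivity of star homomorphisms and boundedness of characters\<close>

text \<open>The estimate is only asked for \<open>e\<close> up to 1 because the bounds for products
  use approximants whose norms exceed the original ones by at most 1. The contradiction comes from
  an \<open>e\<close> so small that K * e is at most a / 2.\<close>

lemma le_zero_eps:
  fixes a K :: real
  assumes "\<And>e. \<lbrakk>0 < e; e \<le> 1\<rbrakk> \<Longrightarrow> a \<le> K * e"
  shows "a \<le> 0"
proof (rule ccontr)
  assume "\<not> a \<le> 0"
  define e where "e = min 1 (a / (2 * (\<bar>K\<bar> + 1)))"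
  have pos: "0 < a / (2 * (\<bar>K\<bar> + 1))" using \<open>\<not> a \<le> 0\<close> by (simp add: add_nonneg_pos)
  then have e: "0 < e" "e \<le> 1" "e \<le> a / (2 * (\<bar>K\<bar> + 1))" by (auto simp: e_def)
  have "a \<le> K * e" using assms e by blast
  also have "\<dots> \<le> (\<bar>K\<bar> + 1) * e" using e by (intro mult_right_mono) auto
  also have "\<dots> \<le> (\<bar>K\<bar> + 1) * (a / (2 * (\<bar>K\<bar> + 1)))" using e by (intro mult_left_mono) auto
  also have "\<dots> = a / 2" by (simp add: field_simps)
  finally show False using \<open>\<not> a \<le> 0\<close> by simp
qed

lemma star_homD:
  assumes "\<phi> \<in> star_hom A B"
  shows "x \<in> carrier A \<Longrightarrow> \<phi> x \<in> carrier B"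
    and "\<lbrakk>x \<in> carrier A; y \<in> carrier A\<rbrakk> \<Longrightarrow> \<phi> (x \<oplus>\<^bsub>A\<^esub> y) = \<phi> x \<oplus>\<^bsub>B\<^esub> \<phi> y"
    and "\<lbrakk>x \<in> carrier A; y \<in> carrier A\<rbrakk> \<Longrightarrow> \<phi> (x \<otimes>\<^bsub>A\<^esub> y) = \<phi> x \<otimes>\<^bsub>B\<^esub> \<phi> y"
    and "x \<in> carrier A \<Longrightarrow> \<phi> (c \<odot>\<^bsub>A\<^esub> x) = c \<odot>\<^bsub>B\<^esub> \<phi> x"
    and "x \<in> carrier A \<Longrightarrow> \<phi> (star A x) = star B (\<phi> x)"
  using assms by (auto simp: star_hom_def)

lemma unital_cstar_algebra_one:
  assumes "unital_cstar_algebra A"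
  shows "\<one>\<^bsub>A\<^esub> \<in> carrier A" "x \<in> carrier A \<Longrightarrow> \<one>\<^bsub>A\<^esub> \<otimes>\<^bsub>A\<^esub> x = x"
    and "x \<in> carrier A \<Longrightarrow> x \<otimes>\<^bsub>A\<^esub> \<one>\<^bsub>A\<^esub> = x"
proof -
  interpret ring A using assms by (simp add: unital_cstar_algebra_def)
  show "\<one>\<^bsub>A\<^esub> \<in> carrier A" "x \<in> carrier A \<Longrightarrow> \<one>\<^bsub>A\<^esub> \<otimes>\<^bsub>A\<^esub> x = x"
    "x \<in> carrier A \<Longrightarrow> x \<otimes>\<^bsub>A\<^esub> \<one>\<^bsub>A\<^esub> = x" by auto
qed

lemma star_homI:
  assumes "\<And>x. x \<in> carrier A \<Longrightarrow> \<phi> x \<in> carrier B"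
    and "\<And>x y. \<lbrakk>x \<in> carrier A; y \<in> carrier A\<rbrakk> \<Longrightarrow> \<phi> (x \<oplus>\<^bsub>A\<^esub> y) = \<phi> x \<oplus>\<^bsub>B\<^esub> \<phi> y"
    and "\<And>x y. \<lbrakk>x \<in> carrier A; y \<in> carrier A\<rbrakk> \<Longrightarrow> \<phi> (x \<otimes>\<^bsub>A\<^esub> y) = \<phi> x \<otimes>\<^bsub>B\<^esub> \<phi> y"
    and "\<And>c x. x \<in> carrier A \<Longrightarrow> \<phi> (c \<odot>\<^bsub>A\<^esub> x) = c \<odot>\<^bsub>B\<^esub> \<phi> x"
    and "\<And>x. x \<in> carrier A \<Longrightarrow> \<phi> (star A x) = star B (\<phi> x)"
  shows "\<phi> \<in> star_hom A B"
  using assms by (auto simp: star_hom_def)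

text \<open>Spelling completeness out in distances makes it transferable. The \<open>cdist\<close>
  of a subalgebra agrees with that of the ambient algebra only on the smaller carrier, so the two
  are not equal as functions.\<close>

lemma Metric_space_mcomplete_iff:
  assumes "Metric_space M d"
  shows "Metric_space.mcomplete M d \<longleftrightarrow>
    (\<forall>\<sigma>. (\<forall>n. \<sigma> n \<in> M) \<longrightarrow> (\<forall>e>0. \<exists>N. \<forall>n n'. N \<le> n \<longrightarrow> N \<le> n' \<longrightarrow> d (\<sigma> n) (\<sigma> n') < e) \<longrightarrow>
      (\<exists>l\<in>M. \<forall>e>0. \<exists>N::nat. \<forall>n\<ge>N. d (\<sigma> n) l < e))"
proof -
  interpret Metric_space M d by fact
  have "(\<exists>x. limitin mtopology \<sigma> x sequentially) \<longleftrightarrow>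
      (\<exists>l\<in>M. \<forall>e>0. \<exists>N::nat. \<forall>n\<ge>N. d (\<sigma> n) l < e)" if "\<forall>n. \<sigma> n \<in> M" for \<sigma>
    using that unfolding limit_metric_sequentially by auto
  then show ?thesis unfolding mcomplete_def MCauchy_def by (auto simp: image_subset_iff)
qed

text \<open>Closedness is left out because the union of the stages has to qualify, and it need not
  be closed.\<close>

definition star_subalgebra :: "'a cstar_alg \<Rightarrow> 'a set \<Rightarrow> bool"
  where "star_subalgebra A V \<longleftrightarrow> submodule V complex_ring A \<and>
    (\<forall>x\<in>V. \<forall>y\<in>V. x \<otimes>\<^bsub>A\<^esub> y \<in> V) \<and> (\<forall>x\<in>V. star A x \<in> V)"

context cstar_algebra
begin

lemma eq_by_eps:
  assumes "x \<in> carrier A" "y \<in> carrier A"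
    and "\<And>e. \<lbrakk>0 < e; e \<le> 1\<rbrakk> \<Longrightarrow> cnorm A (x \<ominus> y) \<le> K * e"
  shows "x = y"
proof -
  have "cnorm A (x \<ominus> y) \<le> 0" using assms(3) by (rule le_zero_eps)
  then have "cnorm A (x \<ominus> y) = 0" using cnorm_nonneg[of "x \<ominus> y"] assms by simp
  then show ?thesis using cnorm_minus_eq_zero assms by blast
qed

lemma contraction_fixpoint:
  assumes N: "closedin (norm_topology A) N" "N \<noteq> {}" and f: "f \<in> N \<rightarrow> N" and "k < 1"
    and con: "\<And>x y. \<lbrakk>x \<in> N; y \<in> N\<rbrakk> \<Longrightarrow> cnorm A (f x \<ominus> f y) \<le> k * cnorm A (x \<ominus> y)"
  obtains x where "x \<in> N" "f x = x"
proof -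
  have NA: "N \<subseteq> carrier A" using N(1) closedin_norm_iff by blast
  interpret S: Submetric "carrier A" "cdist A" N
    using NA by unfold_locales
  have "S.sub.mcomplete"
    using S.closedin_mcomplete_imp_mcomplete N(1) norm_complete by (simp add: norm_topology_def)
  moreover have "cdist A (f x) (f y) \<le> k * cdist A x y" if "x \<in> N" "y \<in> N" for x y
  proof -
    have "f x \<in> N" "f y \<in> N" using f that by auto
    then show ?thesis using con[OF that] that NA by (simp add: cdist_eq subset_iff)
  qed
  ultimately show thesis
    using S.sub.Banach_fixedpoint_thm[of f k] N(2) f \<open>k < 1\<close> that by blast
qed

text \<open>If |f x| exceeded the norm of x, rescaling would give \<open>a\<close> of norm below 1
  with f a = 1. The equation y = a + a y then has a solution, the analogue of the Neumann series in
  the absence of a unit, and applying f yields f y = 1 + f y.\<close>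

lemma character_bound:
  assumes f: "f \<in> characters A" and x: "x \<in> carrier A"
  shows "cmod (f x) \<le> cnorm A x"
proof (rule ccontr)
  note fD = f[unfolded characters_def, simplified]
  assume "\<not> cmod (f x) \<le> cnorm A x"
  then have less: "cnorm A x < cmod (f x)" by simp
  then have ne: "f x \<noteq> 0" using cnorm_nonneg[OF x] by auto
  define a where "a = (1 / f x) \<odot> x"
  have a: "a \<in> carrier A" "f a = 1" using x ne fD by (auto simp: a_def)
  have na: "cnorm A a < 1"
    using less ne x by (simp add: a_def cnorm_smult norm_divide)
  obtain y where y: "y \<in> carrier A" "a \<oplus> a \<otimes> y = y"
  proof (rule contraction_fixpoint[of "carrier A" "\<lambda>y. a \<oplus> a \<otimes> y" "cnorm A a"])
    show "closedin (norm_topology A) (carrier A)"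
      using closed_subspace_carrier by (simp add: closed_subspace_def)
    fix u v assume uv: "u \<in> carrier A" "v \<in> carrier A"
    have "cnorm A (a \<oplus> a \<otimes> u \<ominus> (a \<oplus> a \<otimes> v)) = cnorm A (a \<otimes> (u \<ominus> v))"
      using uv a by (simp add: add_minus_add mult_minus_distrib_left)
    also have "\<dots> \<le> cnorm A a * cnorm A (u \<ominus> v)" using uv a cnorm_mult by simp
    finally show "cnorm A (a \<oplus> a \<otimes> u \<ominus> (a \<oplus> a \<otimes> v)) \<le> cnorm A a * cnorm A (u \<ominus> v)" .
  qed (use a na in auto)
  have "f y = f (a \<oplus> a \<otimes> y)" using y by simp
  also have "\<dots> = 1 + f y" using fD a y(1) by simp
  finally show False by simp
qed

text \<open>The witness is a formal \<open>1 - sqrt (1 - x\<^sup>2)\<close>.\<close>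

lemma sqrt_fixpoint:
  assumes x: "x \<in> carrier A" "star A x = x" "cnorm A x < 1"
  obtains c where "c \<in> carrier A" "star A c = c" "x \<otimes> c = c \<otimes> x"
    and "c = (1/2) \<odot> (c \<otimes> c \<oplus> x \<otimes> x)"
proof -
  define q where "q = (cnorm A x)\<^sup>2"
  have q: "0 \<le> q" "q < 1" using x cnorm_nonneg[OF x(1)] by (auto simp: q_def power_less_one_iff)
  \<comment> \<open>\<open>r\<close> is the smaller fixed point of the scalar map t -> (t^2 + q) /
    2. Hence the ball of radius \<open>r\<close> is mapped into itself, and \<open>r\<close> < 1 is
    at the same time the contraction constant.\<close>
  define r where "r = 1 - sqrt (1 - q)"
  have r: "0 \<le> r" "r < 1" using q by (auto simp: r_def)
  have "r\<^sup>2 + q = 2 * r" using q by (simp add: r_def power2_eq_square algebra_simps)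
  \<comment> \<open>Self-adjointness and commutation with x are built into the closed set, so that
    the fixed point inherits them.\<close>
  define N where "N = {c \<in> carrier A. cnorm A c \<le> r \<and> star A c = c \<and> x \<otimes> c = c \<otimes> x}"
  define f where "f = (\<lambda>c. (1/2) \<odot> (c \<otimes> c \<oplus> x \<otimes> x))"
  have "closedin (norm_topology A) N"
    unfolding closedin_norm_iff
  proof (intro conjI ballI impI)
    show "N \<subseteq> carrier A" by (auto simp: N_def)
    fix c assume c: "c \<in> carrier A" and ap: "\<forall>e>0. \<exists>y\<in>N. cnorm A (c \<ominus> y) < e"
    have "cnorm A c - r \<le> 1 * e" if e: "0 < e" for e
    proof -
      obtain y where y: "y \<in> N" "cnorm A (c \<ominus> y) < e" using ap e by blast
      then have "y \<in> carrier A" "cnorm A y \<le> r" by (auto simp: N_def)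
      moreover have "cnorm A c \<le> cnorm A (c \<ominus> y) + cnorm A (y \<ominus> \<zero>)"
        using cnorm_minus_triangle[of c y \<zero>] c calculation by (simp add: minus_conv_smult)
      moreover have "y \<ominus> \<zero> = y" using calculation by (simp add: minus_conv_smult)
      ultimately show ?thesis using y by simp
    qed
    then have "cnorm A c \<le> r" using le_zero_eps[of "cnorm A c - r" 1] by simp
    moreover have "star A c = c"
    proof (rule eq_by_eps)
      fix e :: real assume "0 < e"
      then obtain y where y: "y \<in> N" "cnorm A (c \<ominus> y) < e" using ap by blast
      then have yA: "y \<in> carrier A" "star A y = y" by (auto simp: N_def)
      have "cnorm A (star A c \<ominus> c) \<le> cnorm A (star A c \<ominus> star A y) + cnorm A (y \<ominus> c)"
        using cnorm_minus_triangle[of "star A c" "star A y" c] c yA by simp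
      also have "\<dots> = 2 * cnorm A (c \<ominus> y)"
        using cnorm_star_minus[of c y] cnorm_minus_commute[of c y] c yA by simp
      finally show "cnorm A (star A c \<ominus> c) \<le> 2 * e" using y by simp
    qed (use c in auto)
    moreover have "x \<otimes> c = c \<otimes> x"
    proof (rule eq_by_eps)
      fix e :: real assume "0 < e"
      then obtain y where y: "y \<in> N" "cnorm A (c \<ominus> y) < e" using ap by blast
      then have yA: "y \<in> carrier A" "x \<otimes> y = y \<otimes> x" by (auto simp: N_def)
      have "cnorm A (x \<otimes> c \<ominus> c \<otimes> x) \<le> cnorm A (x \<otimes> c \<ominus> x \<otimes> y) + cnorm A (y \<otimes> x \<ominus> c \<otimes> x)"
        using cnorm_minus_triangle[of "x \<otimes> c" "x \<otimes> y" "c \<otimes> x"] c yA x by simp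
      also have "\<dots> = cnorm A (x \<otimes> (c \<ominus> y)) + cnorm A ((y \<ominus> c) \<otimes> x)"
        using c yA(1) x by (simp add: mult_minus_distrib_left mult_minus_distrib_right)
      also have "\<dots> \<le> cnorm A x * cnorm A (c \<ominus> y) + cnorm A (y \<ominus> c) * cnorm A x"
        using c yA(1) x by (intro add_mono cnorm_mult) auto
      also have "\<dots> = 2 * cnorm A x * cnorm A (c \<ominus> y)"
        using cnorm_minus_commute[of c y] c yA by simp
      also have "\<dots> \<le> 2 * cnorm A x * e" using y cnorm_nonneg[OF x(1)] by (intro mult_left_mono) auto
      finally show "cnorm A (x \<otimes> c \<ominus> c \<otimes> x) \<le> 2 * cnorm A x * e" .
    qed (use c x in auto)
    ultimately show "c \<in> N" using c by (simp add: N_def)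
  qed
  moreover have "\<zero> \<in> N" using r x by (simp add: N_def)
  moreover have "f c \<in> N" if "c \<in> N" for c
  proof -
    from that have c: "c \<in> carrier A" "cnorm A c \<le> r" "star A c = c" "x \<otimes> c = c \<otimes> x"
      by (auto simp: N_def)
    have "cnorm A (f c) = (1/2) * cnorm A (c \<otimes> c \<oplus> x \<otimes> x)"
      using c x by (simp add: f_def cnorm_smult norm_divide)
    also have "\<dots> \<le> (1/2) * (cnorm A (c \<otimes> c) + cnorm A (x \<otimes> x))"
      using c x cnorm_triangle[of "c \<otimes> c" "x \<otimes> x"] by simp
    also have "\<dots> \<le> (1/2) * (r\<^sup>2 + q)"
    proof -
      have "cnorm A (c \<otimes> c) \<le> cnorm A c * cnorm A c" "cnorm A (x \<otimes> x) \<le> q"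
        using cnorm_mult[of c c] cnorm_mult[of x x] c x by (auto simp: q_def power2_eq_square)
      moreover have "cnorm A c * cnorm A c \<le> r\<^sup>2"
        using c r cnorm_nonneg[of c] by (simp add: power2_eq_square mult_mono)
      ultimately show ?thesis by simp
    qed
    also have "\<dots> = r" using \<open>r\<^sup>2 + q = 2 * r\<close> by simp
    finally have 1: "cnorm A (f c) \<le> r" .
    have 2: "star A (f c) = f c" using c x by (simp add: f_def star_smult star_add star_mult)
    have "x \<otimes> (c \<otimes> c) = (c \<otimes> c) \<otimes> x" 
      using c x by (metis cmult_assoc)
    then have 3: "x \<otimes> f c = f c \<otimes> x"
      using c x by (simp add: f_def smult_mult_left smult_mult_right l_distrib r_distrib cmult_assoc)
    show ?thesis using 1 2 3 c x by (simp add: N_def f_def)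
  qed
  moreover have "cnorm A (f c \<ominus> f d) \<le> r * cnorm A (c \<ominus> d)" if "c \<in> N" "d \<in> N" for c d
  proof -
    have cd: "c \<in> carrier A" "cnorm A c \<le> r" "d \<in> carrier A" "cnorm A d \<le> r"
      using that by (auto simp: N_def)
    have "cnorm A (f c \<ominus> f d) = (1/2) * cnorm A ((c \<otimes> c \<oplus> x \<otimes> x) \<ominus> (d \<otimes> d \<oplus> x \<otimes> x))"
      using cd x by (simp add: f_def cnorm_smult_minus norm_divide)
    also have "\<dots> \<le> (1/2) * cnorm A (c \<otimes> c \<ominus> d \<otimes> d)"
      using cnorm_add_minus_add[of "c \<otimes> c" "x \<otimes> x" "d \<otimes> d" "x \<otimes> x"] cd x
by simp
    also have "\<dots> \<le> (1/2) * (cnorm A (c \<ominus> d) * cnorm A c + cnorm A d * cnorm A (c \<ominus> d))"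
      using cnorm_mult_minus_mult[of c c d d] cd by simp
    also have "\<dots> \<le> (1/2) * (cnorm A (c \<ominus> d) * r + r * cnorm A (c \<ominus> d))"
      using cd r cnorm_nonneg[of "c \<ominus> d"]
      by (intro mult_left_mono add_mono mult_right_mono) auto
    finally show ?thesis by simp
  qed
  ultimately obtain c where c: "c \<in> N" "f c = c"
    using contraction_fixpoint[of N f r] r by blast
  then show thesis using that[of c] by (simp add: N_def f_def)
qed

text \<open>With \<open>T = y - C y\<close> the elements \<open>X y \<plusminus> i T\<close> both have modulus \<open>y\<^sup>* y\<close>: formally \<open>X \<plusminus> i (1 - C)\<close> is
  unitary, and \<open>X y\<close> is the mean of the two.\<close>

lemma unitary_decomposition_bound:
  assumes X: "X \<in> carrier A" "star A X = X" and C: "C \<in> carrier A" "star A C = C"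
    and XC: "X \<otimes> C = C \<otimes> X" and C_eq: "C = (1/2) \<odot> (C \<otimes> C \<oplus> X \<otimes> X)" and y: "y \<in> carrier A"
  shows "cnorm A (X \<otimes> y) \<le> cnorm A y"
proof -
  define P where "P = X \<otimes> y"
  define T where "T = y \<ominus> C \<otimes> y"
  have PT: "P \<in> carrier A" "T \<in> carrier A" using X C y by (auto simp: P_def T_def)
  have sP: "star A P = star A y \<otimes> X" using X y by (simp add: P_def star_mult)
  have sT: "star A T = star A y \<ominus> star A y \<otimes> C"
    using C y by (simp add: T_def minus_conv_smult star_add star_smult star_mult)
  define b where "b = star A y \<otimes> (C \<otimes> y)"
  define d where "d = star A y \<otimes> (C \<otimes> (C \<otimes> y))"
  define a where "a = star A y \<otimes> y"
  have abd: "a \<in> carrier A" "b \<in> carrier A" "d \<in> carrier A"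
    using C y by (auto simp: a_def b_def d_def)
  have "X \<otimes> (C \<otimes> y) = C \<otimes> (X \<otimes> y)" using X C y XC by (metis cmult_assoc)
  then have comm: "star A P \<otimes> T = star A T \<otimes> P"
    using X C y by (simp add: sP sT) (simp add: P_def T_def mult_minus_distrib_left
        mult_minus_distrib_right cmult_assoc)
  have "2 \<odot> C = C \<otimes> C \<oplus> X \<otimes> X"
    using C X by (subst C_eq) (simp add: csmult_csmult)
  then have "X \<otimes> X = 2 \<odot> C \<ominus> C \<otimes> C"
    using C X by (simp add: a_minus_def M.a_assoc M.a_comm M.r_neg1)
  then have "X \<otimes> (X \<otimes> y) = 2 \<odot> (C \<otimes> y) \<ominus> C \<otimes> (C \<otimes> y)"
    using X C y by (simp flip: cmult_assoc add: mult_minus_distrib_right smult_mult_left)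
  then have PP: "star A P \<otimes> P = 2 \<odot> b \<ominus> d"
    using X C y PT by (simp add: sP cmult_assoc)
      (simp add: P_def b_def d_def mult_minus_distrib_left smult_mult_right)
  have TT: "star A T \<otimes> T = (a \<ominus> b) \<ominus> (b \<ominus> d)"
    using C y by (simp add: sT) (simp add: T_def a_def b_def d_def mult_minus_distrib_left
        mult_minus_distrib_right cmult_assoc)
  \<comment> \<open>The equation for C says X^2 + (1 - C)^2 = 1 formally. With P = X y and T = (1 -
    C) y this becomes the present identity.\<close>
  have sum: "star A P \<otimes> P \<oplus> star A T \<otimes> T = a"
  proof -
    have "star A P \<otimes> P \<oplus> star A T \<otimes> T = (b \<oplus> b \<oplus> \<ominus> d) \<oplus> ((a \<oplus> \<ominus> b) \<oplus> (\<ominus> b \<oplus> d))"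
      using abd csmult_add_left[of b 1 1]
      by (simp add: PP TT a_minus_def M.minus_add M.a_assoc)
    also have "\<dots> = a \<oplus> (b \<oplus> \<ominus> b) \<oplus> (b \<oplus> \<ominus> b) \<oplus> (d \<oplus> \<ominus> d)"
      using abd by (simp add: M.a_ac)
    also have "\<dots> = a" using abd by (simp add: M.r_neg)
    finally show ?thesis .
  qed
  \<comment> \<open>The values of \<open>w\<close> in question are the imaginary unit and its
    negative. The cross terms cancel by \<open>comm\<close>, and the C*-identity turns the equality
    of moduli into one of norms.\<close>
  have norm_z: "cnorm A (P \<oplus> w \<odot> T) = cnorm A y" if w: "cnj w = - w" "w * w = -1" for w
  proof -
    define z where "z = P \<oplus> w \<odot> T"
    have z: "z \<in> carrier A" using PT by (simp add: z_def)
    have "star A z \<otimes> z = (star A P \<oplus> (- w) \<odot> star A T) \<otimes> (P \<oplus> w \<odot> T)"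
      using PT w by (simp add: z_def star_add star_smult)
    also have "\<dots> = (star A P \<otimes> P \<oplus> (- w) \<odot> (star A T \<otimes> P)) \<oplus>
        (w \<odot> (star A P \<otimes> T) \<oplus> star A T \<otimes> T)"
      using PT w by (simp add: l_distrib r_distrib smult_mult_left smult_mult_right csmult_csmult
          csmult_add_right)
    also have "\<dots> = (star A P \<otimes> P \<oplus> star A T \<otimes> T) \<oplus>
        (w \<odot> (star A T \<otimes> P) \<oplus> (- w) \<odot> (star A T \<otimes> P))"
      using PT comm by (simp add: M.a_ac)
    also have "\<dots> = a"
      using PT abd csmult_add_left[of "star A T \<otimes> P" w "- w"] by (simp add: sum)
    finally have "(cnorm A z)\<^sup>2 = (cnorm A y)\<^sup>2"
      using cstar_identity[OF z] cstar_identity[OF y] by (simp add: a_def)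
    then show ?thesis using cnorm_nonneg[OF z] cnorm_nonneg[OF y] by (simp add: z_def)
  qed
  have "2 \<odot> P = (P \<oplus> \<i> \<odot> T) \<oplus> (P \<oplus> (- \<i>) \<odot> T)"
  proof -
    have "(P \<oplus> \<i> \<odot> T) \<oplus> (P \<oplus> (- \<i>) \<odot> T) = (P \<oplus> P) \<oplus> (\<i> \<odot> T \<oplus> (- \<i>) \<odot> T)"
      using PT by (simp add: M.a_ac)
    also have "\<i> \<odot> T \<oplus> (- \<i>) \<odot> T = \<zero>"
      using PT csmult_add_left[of T \<i> "- \<i>"] by simp
    also have "P \<oplus> P = 2 \<odot> P" using PT csmult_add_left[of P 1 1] by simp
    finally show ?thesis using PT by simp
  qed
  then have "2 * cnorm A P = cnorm A ((P \<oplus> \<i> \<odot> T) \<oplus> (P \<oplus> (- \<i>) \<odot> T))"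
    using PT by (metis cnorm_smult norm_numeral)
  also have "\<dots> \<le> cnorm A y + cnorm A y"
    using cnorm_triangle[of "P \<oplus> \<i> \<odot> T" "P \<oplus> (- \<i>) \<odot> T"] PT by (simp add: norm_z)
  finally show ?thesis by (simp add: P_def)
qed

end

text \<open>Contractivity without spectral theory: the relations of \<open>sqrt_fixpoint\<close> are preserved by
  the homomorphism.\<close>

lemma star_hom_contractive:
  assumes A: "cstar_algebra A" and B: "cstar_algebra B" and \<phi>: "\<phi> \<in> star_hom A B"
    and x: "x \<in> carrier A"
  shows "cnorm B (\<phi> x) \<le> cnorm A x"
proof -
  interpret A: cstar_algebra A by fact
  interpret B: cstar_algebra B by fact
  note \<phi>D = star_homD[OF \<phi>]
  have unit: "cnorm B (\<phi> h) \<le> 1"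
    if h: "h \<in> carrier A" "star A h = h" "cnorm A h < 1" for h
  proof -
    obtain c where c: "c \<in> carrier A" "star A c = c" "h \<otimes>\<^bsub>A\<^esub> c = c \<otimes>\<^bsub>A\<^esub> h"
      "c = (1/2) \<odot>\<^bsub>A\<^esub> (c \<otimes>\<^bsub>A\<^esub> c \<oplus>\<^bsub>A\<^esub> h \<otimes>\<^bsub>A\<^esub> h)"
      using A.sqrt_fixpoint[OF h] by blast
    \<comment> \<open>Applying the bound to y = \<open>\<phi> h\<close> itself controls the square
      of its norm by the norm, and thus the norm by 1.\<close>
    have "cnorm B (\<phi> h \<otimes>\<^bsub>B\<^esub> \<phi> h) \<le> cnorm B (\<phi> h)"
    proof (rule B.unitary_decomposition_bound[where C = "\<phi> c"])
      show "\<phi> c = (1/2) \<odot>\<^bsub>B\<^esub> (\<phi> c \<otimes>\<^bsub>B\<^esub> \<phi> c \<oplus>\<^bsub>B\<^esub> \<phi> h \<otimes>\<^bsub>B\<^esub> \<phi> h)"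
        using arg_cong[OF c(4), of \<phi>] c(1) h(1) \<phi>D by simp
      show "star B (\<phi> h) = \<phi> h" "star B (\<phi> c) = \<phi> c"
        using \<phi>D(5)[of h] \<phi>D(5)[of c] h c by auto
      show "\<phi> h \<otimes>\<^bsub>B\<^esub> \<phi> c = \<phi> c \<otimes>\<^bsub>B\<^esub> \<phi> h"
        using \<phi>D(3)[of h c] \<phi>D(3)[of c h] h c by simp
    qed (use \<phi>D h c in auto)
    moreover have "star B (\<phi> h) = \<phi> h" using \<phi>D(5)[of h] h by auto
    ultimately have "(cnorm B (\<phi> h))\<^sup>2 \<le> cnorm B (\<phi> h)"
      using B.cstar_identity[of "\<phi> h"] \<phi>D(1)[of h] h by simp
    then show ?thesis 
      by (metis B.cnorm_nonneg \<phi>D(1) h(1) less_eq_real_def linorder_not_le mult_cancel_right1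
          mult_le_cancel_right2 not_one_le_zero power2_eq_square)
  qed
  have sa: "cnorm B (\<phi> h) \<le> cnorm A h" if h: "h \<in> carrier A" "star A h = h" for h
  proof (rule dense_ge)
    fix t assume t: "cnorm A h < t"
    then have t0: "t > 0" using A.cnorm_nonneg[OF h(1)] by simp
    have "cnorm B (\<phi> (complex_of_real (1/t) \<odot>\<^bsub>A\<^esub> h)) \<le> 1"
      using h t t0 by (intro unit) (auto simp: A.star_smult A.cnorm_smult norm_divide)
    then show "cnorm B (\<phi> h) \<le> t"
      using h t0 by (simp add: \<phi>D B.cnorm_smult norm_divide divide_le_eq)
  qed
  have "(cnorm B (\<phi> x))\<^sup>2 = cnorm B (\<phi> (star A x \<otimes>\<^bsub>A\<^esub> x))"
    using x by (simp add: \<phi>D B.cstar_identity)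
  also have "\<dots> \<le> cnorm A (star A x \<otimes>\<^bsub>A\<^esub> x)"
    using x by (intro sa) (auto simp: A.star_mult A.star_star)
  also have "\<dots> = (cnorm A x)\<^sup>2" using x by (simp add: A.cstar_identity)
  finally show ?thesis using A.cnorm_nonneg[OF x] by (rule power2_le_imp_le)
qed

lemma star_hom_bounded_semilinear:
  assumes "cstar_algebra A" "cstar_algebra B" "\<phi> \<in> star_hom A B"
  shows "bounded_semilinear A B \<phi>"
  unfolding bounded_semilinear_def
  using star_homD[OF assms(3)] star_hom_contractive[OF assms]
  by (auto intro!: exI[of _ "\<lambda>c. c"] exI[of _ "1::real"])

section \<open>Closed star subalgebras and extension of homomorphisms\<close>

context cstar_algebra
begin

lemma bounded_semilinear_mult_left:
  "x \<in> carrier A \<Longrightarrow> bounded_semilinear A A (\<lambda>y. x \<otimes> y)"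
  unfolding bounded_semilinear_def
  by (auto simp: r_distrib smult_mult_right cnorm_mult intro!: exI[of _ "\<lambda>c. c"]
      exI[of _ "cnorm A x"])

lemma bounded_semilinear_mult_right:
  "x \<in> carrier A \<Longrightarrow> bounded_semilinear A A (\<lambda>y. y \<otimes> x)"
  unfolding bounded_semilinear_def
  by (auto simp: l_distrib smult_mult_left cnorm_mult mult.commute[of "cnorm A x"]
      intro!: exI[of _ "\<lambda>c. c"] exI[of _ "cnorm A x"])

lemma bounded_semilinear_star: "bounded_semilinear A A (star A)"
  unfolding bounded_semilinear_def
  by (auto simp: star_add star_smult intro!: exI[of _ "cnj"] exI[of _ "1::real"])

text \<open>Products are handled one factor at a time: for a fixed generator on the right, the
  admissible left factors form a closed subspace containing the generators; then the left factor is
  fixed anywhere in the closure and the argument repeated on the right.\<close>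

lemma star_subalgebra_closed_span:
  assumes S: "S \<subseteq> carrier A"
    and mult: "\<And>x y. \<lbrakk>x \<in> S; y \<in> S\<rbrakk> \<Longrightarrow> x \<otimes> y \<in> S"
    and star: "\<And>x. x \<in> S \<Longrightarrow> star A x \<in> S"
  shows "star_subalgebra A (closed_span A S)"
proof -
  let ?K = "closed_span A S"
  have K: "closed_subspace A ?K" using S by (rule closed_subspace_closed_span)
  note vimage = closed_subspace_vimage[OF cstar_algebra_axioms cstar_algebra_axioms _ K]
  note SK = closed_span_subset[OF S] and KA = closed_subspaceD(1)[OF K]
  have 1: "x \<otimes> y \<in> ?K" if "x \<in> ?K" "y \<in> S" for x y
  proof -
    have "?K \<subseteq> {x \<in> carrier A. x \<otimes> y \<in> ?K}"
      using that S SK mult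
      by (intro closed_span_minimal vimage bounded_semilinear_mult_right) auto
    then show ?thesis using that by auto
  qed
  have 2: "x \<otimes> y \<in> ?K" if "x \<in> ?K" "y \<in> ?K" for x y
  proof -
    have "?K \<subseteq> {y \<in> carrier A. x \<otimes> y \<in> ?K}"
      using that S SK KA 1
      by (intro closed_span_minimal vimage bounded_semilinear_mult_left) auto
    then show ?thesis using that by auto
  qed
  have 3: "star A x \<in> ?K" if "x \<in> ?K" for x
  proof -
    have "?K \<subseteq> {x \<in> carrier A. star A x \<in> ?K}"
      using S SK star by (intro closed_span_minimal vimage bounded_semilinear_star) auto
    then show ?thesis using that by auto
  qed
  show ?thesis using K 2 3 by (auto simp: star_subalgebra_def closed_subspace_def)
qed

text \<open>Additive inverses are defined by a description over the carrier, so it has to be shown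
  that shrinking the carrier does not change them.\<close>

lemma minus_subalgebra:
  assumes V: "submodule V complex_ring A" and xy: "x \<in> V" "y \<in> V"
  shows "x \<ominus>\<^bsub>A\<lparr>carrier := V\<rparr>\<^esub> y = x \<ominus> y"
proof -
  interpret V: Module.module complex_ring "A\<lparr>carrier := V\<rparr>"
    using submodule.submodule_is_module[OF V] module_axioms by blast
  note VD = submodule_complexD[OF V]
  have "\<ominus> y \<in> V" using VD xy by (simp add: a_inv_conv_smult subset_iff)
  then have "\<ominus>\<^bsub>A\<lparr>carrier := V\<rparr>\<^esub> y = \<ominus> y"
    using V.M.minus_equality[of "\<ominus> y" y] xy VD by (simp add: subset_iff M.l_neg)
  then show ?thesis by (simp add: a_minus_def)
qed

lemma cstar_algebra_subalgebra:
  assumes V: "star_subalgebra A V" and closed: "closedin (norm_topology A) V"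
  shows "cstar_algebra (A\<lparr>carrier := V\<rparr>)"
proof -
  have sub: "submodule V complex_ring A" using V by (simp add: star_subalgebra_def)
  note VD = submodule_complexD[OF sub]
  have VA: "x \<in> carrier A" if "x \<in> V" for x using VD(1) that by auto
  have mod: "Module.module complex_ring (A\<lparr>carrier := V\<rparr>)"
    using submodule.submodule_is_module[OF sub] module_axioms by blast
  let ?d = "cdist (A\<lparr>carrier := V\<rparr>)"
  have cd: "?d x y = cdist A x y" if "x \<in> V" "y \<in> V" for x y
    using that VA minus_subalgebra[OF sub] by (simp add: cdist_def)
  have ms: "Metric_space V ?d"
  proof
    show "0 \<le> ?d x y" for x y
      by (cases "x \<in> V \<and> y \<in> V") (use cd in auto, auto simp: cdist_def)
    show "?d x y = ?d y x" for x y
      by (cases "x \<in> V \<and> y \<in> V") (use cd met.commute in auto, auto simp: cdist_def)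
  qed (use cd VA met.triangle in auto)
  interpret S: Submetric "carrier A" "cdist A" V
    using VA by unfold_locales auto
  have S_complete: "S.sub.mcomplete"
    using S.closedin_mcomplete_imp_mcomplete closed norm_complete by (simp add: norm_topology_def)
  have complete: "Metric_space.mcomplete V ?d"
    unfolding Metric_space_mcomplete_iff[OF ms]
  proof (intro allI impI)
    fix \<sigma> assume \<sigma>: "\<forall>n::nat. \<sigma> n \<in> V"
      and "\<forall>e>0. \<exists>N. \<forall>n n'. N \<le> n \<longrightarrow> N \<le> n' \<longrightarrow> ?d (\<sigma> n) (\<sigma> n') < e"
    then have "\<forall>e>0. \<exists>N. \<forall>n n'. N \<le> n \<longrightarrow> N \<le> n' \<longrightarrow> cdist A (\<sigma> n) (\<sigma> n') < e"
      using cd by simp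
    then obtain l where "l \<in> V" "\<forall>e>0. \<exists>N. \<forall>n\<ge>N. cdist A (\<sigma> n) l < e"
      using S_complete[unfolded Metric_space_mcomplete_iff[OF S.sub.Metric_space_axioms]] \<sigma>
      by blast
    then show "\<exists>l\<in>V. \<forall>e>0. \<exists>N. \<forall>n\<ge>N. ?d (\<sigma> n) l < e"
      using cd \<sigma> by auto
  qed
  show ?thesis
  proof (intro cstar_algebra.intro mod cstar_algebra_axioms.intro)
    show "Metric_space.mcomplete (carrier (A\<lparr>carrier := V\<rparr>)) ?d" using complete by simp
  qed (use V VA in \<open>auto simp: star_subalgebra_def cmult_assoc l_distrib r_distrib smult_mult_left
      smult_mult_right star_star star_add star_smult star_mult cnorm_nonneg cnorm_eq_zero
      cnorm_triangle cnorm_smult cnorm_mult cstar_identity\<close>)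
qed

end

section \<open>Extension by continuity\<close>

lemma star_hom_unique_extension:
  assumes A: "cstar_algebra A" and B: "cstar_algebra B"
    and D: "submodule D complex_ring A" and L: "star_subalgebra A L" "closedin (norm_topology A) L"
    and dense: "\<And>x e. \<lbrakk>x \<in> L; 0 < e\<rbrakk> \<Longrightarrow> \<exists>y\<in>D \<inter> L. cnorm A (x \<ominus>\<^bsub>A\<^esub> y) < e"
    and f: "f \<in> star_hom (A\<lparr>carrier := L\<rparr>) B" and g: "g \<in> star_hom (A\<lparr>carrier := L\<rparr>) B"
    and eq: "\<And>x. x \<in> D \<inter> L \<Longrightarrow> f x = g x" and x: "x \<in> L"
  shows "f x = g x"
proof -
  interpret A: cstar_algebra A by fact
  interpret B: cstar_algebra B by fact
  have sub: "submodule L complex_ring A" using L by (simp add: star_subalgebra_def)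
  interpret L: cstar_algebra "A\<lparr>carrier := L\<rparr>" using A.cstar_algebra_subalgebra L by blast
  note fD = star_homD[OF f, simplified] and gD = star_homD[OF g, simplified]
  have bl: "bounded_semilinear (A\<lparr>carrier := L\<rparr>) B f" "bounded_semilinear (A\<lparr>carrier := L\<rparr>) B g"
    using star_hom_bounded_semilinear L.cstar_algebra_axioms B f g by blast+
  have "closed_subspace (A\<lparr>carrier := L\<rparr>) {x \<in> carrier (A\<lparr>carrier := L\<rparr>). f x = g x}"
    by (rule closed_subspace_equalizer[OF L.cstar_algebra_axioms B bl]) (use fD gD in auto)
  then have "x \<in> {x \<in> carrier (A\<lparr>carrier := L\<rparr>). f x = g x}"
  proof (rule L.closed_subspaceD(6))
    fix e :: real assume "e > 0"
    then obtain y where y: "y \<in> D \<inter> L" "cnorm A (x \<ominus>\<^bsub>A\<^esub> y) < e" using dense x by blast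
    then show "\<exists>y\<in>{x \<in> carrier (A\<lparr>carrier := L\<rparr>). f x = g x}.
        cnorm (A\<lparr>carrier := L\<rparr>) (x \<ominus>\<^bsub>A\<lparr>carrier := L\<rparr>\<^esub> y) < e"
      using A.minus_subalgebra[OF sub x, of y] eq by (intro bexI[of _ y]) auto
  qed (use x in simp)
  then show ?thesis by simp
qed

text \<open>The value at x is not tied to a chosen sequence. It is selected by the inequality |h x -
  f z| <= |x - z| for all z in D, which has a solution by completeness of B and pins h x down by
  density of D.\<close>

lemma star_hom_extend:
  assumes A: "cstar_algebra A" and B: "cstar_algebra B"
    and D: "star_subalgebra A D" and L: "star_subalgebra A L" and DL: "D \<subseteq> L"
    and dense: "\<And>x e. \<lbrakk>x \<in> L; 0 < e\<rbrakk> \<Longrightarrow> \<exists>y\<in>D. cnorm A (x \<ominus>\<^bsub>A\<^esub> y) < e"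
    and f: "f \<in> star_hom (A\<lparr>carrier := D\<rparr>) B"
    and contr: "\<And>x. x \<in> D \<Longrightarrow> cnorm B (f x) \<le> cnorm A x"
  obtains h where "h \<in> star_hom (A\<lparr>carrier := L\<rparr>) B" "h \<in> extensional L"
    and "\<And>x. x \<in> D \<Longrightarrow> h x = f x"
proof -
  interpret A: cstar_algebra A by fact
  interpret B: cstar_algebra B by fact
  note fD = star_homD[OF f, simplified]
  have subD: "submodule D complex_ring A" and subL: "submodule L complex_ring A"
    using D L by (auto simp: star_subalgebra_def)
  note DD = A.submodule_complexD[OF subD] and LD = A.submodule_complexD[OF subL]
  have D2: "x \<otimes>\<^bsub>A\<^esub> y \<in> D" "star A x \<in> D" if "x \<in> D" "y \<in> D" for x y
    using D that by (auto simp: star_subalgebra_def)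
  have L2: "x \<otimes>\<^bsub>A\<^esub> y \<in> L" "star A x \<in> L" if "x \<in> L" "y \<in> L" for x y
    using L that by (auto simp: star_subalgebra_def)
  have DA: "x \<in> carrier A" if "x \<in> D" for x using DD(1) that by auto
  have LA: "x \<in> carrier A" if "x \<in> L" for x using LD(1) that by auto
  have f_minus: "f x \<ominus>\<^bsub>B\<^esub> f y = f (x \<ominus>\<^bsub>A\<^esub> y)" if "x \<in> D" "y \<in> D" for x y
    using that fD DD by (simp add: A.minus_conv_smult B.minus_conv_smult DA)
  have f_dist: "cnorm B (f x \<ominus>\<^bsub>B\<^esub> f y) \<le> cnorm A (x \<ominus>\<^bsub>A\<^esub> y)" if "x \<in> D" "y \<in> D" for x y
    using f_minus[OF that] contr DD(5)[OF that] by simp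
  have "\<exists>l\<in>carrier B. \<forall>z\<in>D. cnorm B (l \<ominus>\<^bsub>B\<^esub> f z) \<le> cnorm A (x \<ominus>\<^bsub>A\<^esub> z)" if x: "x \<in> L" for x
  proof -
    have "\<forall>n. \<exists>y\<in>D. cnorm A (x \<ominus>\<^bsub>A\<^esub> y) < inverse (real (Suc n))"
      using dense[OF x] by simp
    then obtain y where y: "\<And>n. y n \<in> D" "\<And>n. cnorm A (x \<ominus>\<^bsub>A\<^esub> y n) < inverse (real (Suc n))"
      by metis
    have y_le: "cnorm A (x \<ominus>\<^bsub>A\<^esub> y n) < inverse (real (Suc N))" if "N \<le> n" for n N
    proof -
      have "inverse (real (Suc n)) \<le> inverse (real (Suc N))" 
        using that by (intro le_imp_inverse_le) auto
      then show ?thesis using y(2)[of n] by linarith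
    qed
    have fy: "f (y n) \<in> carrier B" for n using fD y by simp
    have cau: "\<exists>N. \<forall>n n'. N \<le> n \<longrightarrow> N \<le> n' \<longrightarrow> cdist B (f (y n)) (f (y n')) < e" if e: "e > 0" for e
    proof -
      obtain N where N: "inverse (real (Suc N)) < e / 2"
        using reals_Archimedean[OF half_gt_zero[OF e]] by auto
      have "cdist B (f (y n)) (f (y n')) < e" if "N \<le> n" "N \<le> n'" for n n'
      proof -
        have "cdist B (f (y n)) (f (y n')) \<le> cnorm A (y n \<ominus>\<^bsub>A\<^esub> y n')"
          using fy f_dist y by (simp add: B.cdist_eq)
        also have "\<dots> \<le> cnorm A (y n \<ominus>\<^bsub>A\<^esub> x) + cnorm A (x \<ominus>\<^bsub>A\<^esub> y n')"
          using y x DA LA by (intro A.cnorm_minus_triangle) auto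
        also have "\<dots> < e"
          using y_le[OF that(1)] y_le[OF that(2)] N A.cnorm_minus_commute[of x "y n"] y x DA LA
          by simp
        finally show ?thesis .
      qed
      then show ?thesis by blast
    qed
    obtain l where l: "l \<in> carrier B" "\<forall>e>0. \<exists>N. \<forall>n\<ge>N. cdist B (f (y n)) l < e"
      using B.norm_complete[unfolded Metric_space_mcomplete_iff[OF B.met.Metric_space_axioms],
          THEN spec, of "\<lambda>n. f (y n)"] fy cau by blast
    have "cnorm B (l \<ominus>\<^bsub>B\<^esub> f z) \<le> cnorm A (x \<ominus>\<^bsub>A\<^esub> z)" if z: "z \<in> D" for z
    proof -
      have "cnorm B (l \<ominus>\<^bsub>B\<^esub> f z) - cnorm A (x \<ominus>\<^bsub>A\<^esub> z) \<le> 2 * e" if e: "e > 0" for e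
      proof -
        obtain N where N: "\<And>n. n \<ge> N \<Longrightarrow> cdist B (f (y n)) l < e" using l e by blast
        obtain N' where N': "inverse (real (Suc N')) < e" using reals_Archimedean e by blast
        define n where "n = max N N'"
        have c: "x \<in> carrier A" "z \<in> carrier A" "y n \<in> carrier A" "f z \<in> carrier B" 
          using LA DA x z y fD by auto
        have "cnorm B (l \<ominus>\<^bsub>B\<^esub> f z) \<le> cnorm B (l \<ominus>\<^bsub>B\<^esub> f (y n)) + cnorm B (f (y n) \<ominus>\<^bsub>B\<^esub> f z)"
          using l fy c by (intro B.cnorm_minus_triangle) auto
        also have "cnorm B (l \<ominus>\<^bsub>B\<^esub> f (y n)) < e"
          using N[of n] fy l B.cnorm_minus_commute[of l "f (y n)"] by (simp add: n_def B.cdist_eq)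
        also have "cnorm B (f (y n) \<ominus>\<^bsub>B\<^esub> f z) \<le> cnorm A (y n \<ominus>\<^bsub>A\<^esub> z)" using f_dist y z by simp
        also have "\<dots> \<le> cnorm A (y n \<ominus>\<^bsub>A\<^esub> x) + cnorm A (x \<ominus>\<^bsub>A\<^esub> z)"
          using c by (intro A.cnorm_minus_triangle) auto
        also have "cnorm A (y n \<ominus>\<^bsub>A\<^esub> x) < e"
          using y_le[of N' n] N' A.cnorm_minus_commute[of x "y n"] c by (simp add: n_def)
        finally show ?thesis by simp
      qed
      then show ?thesis using le_zero_eps[of "cnorm B (l \<ominus>\<^bsub>B\<^esub> f z) - cnorm A (x \<ominus>\<^bsub>A\<^esub> z)" 2] by simp
    qed
    then show ?thesis using l by blast
  qed
  then have "\<forall>x\<in>L. \<exists>l. l \<in> carrier B \<and> (\<forall>z\<in>D. cnorm B (l \<ominus>\<^bsub>B\<^esub> f z) \<le> cnorm A (x \<ominus>\<^bsub>A\<^esub> z))" 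
    by blast
  from bchoice[OF this] obtain h0 where h0: "\<And>x. x \<in> L \<Longrightarrow> h0 x \<in> carrier B"
    "\<And>x z. \<lbrakk>x \<in> L; z \<in> D\<rbrakk> \<Longrightarrow> cnorm B (h0 x \<ominus>\<^bsub>B\<^esub> f z) \<le> cnorm A (x \<ominus>\<^bsub>A\<^esub> z)"
    by blast
  define h where "h = restrict h0 L"
  have hB: "h x \<in> carrier B" if "x \<in> L" for x using h0 that by (simp add: h_def)
  have h_dist: "cnorm B (h x \<ominus>\<^bsub>B\<^esub> f z) \<le> cnorm A (x \<ominus>\<^bsub>A\<^esub> z)" if "x \<in> L" "z \<in> D" for x z
    using h0 that by (simp add: h_def)
  have h_dist': "cnorm B (f z \<ominus>\<^bsub>B\<^esub> h x) \<le> cnorm A (x \<ominus>\<^bsub>A\<^esub> z)" if "x \<in> L" "z \<in> D" for x z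
    using h_dist[OF that] B.cnorm_minus_commute[of "f z" "h x"] fD hB that by simp
  \<comment> \<open>To identify h x with b it suffices to find points of D close to x whose images
    are close to b. Each algebraic law below is proved by exhibiting such points.\<close>
  have h_char: "h x = b"
    if x: "x \<in> L" and b: "b \<in> carrier B"
      and ap: "\<And>e. \<lbrakk>0 < e; e \<le> 1\<rbrakk> \<Longrightarrow>
        \<exists>z\<in>D. cnorm A (x \<ominus>\<^bsub>A\<^esub> z) \<le> K * e \<and> cnorm B (f z \<ominus>\<^bsub>B\<^esub> b) \<le> K * e" for x b K
  proof (rule B.eq_by_eps[where K = "2 * K"])
    fix e :: real assume "0 < e" "e \<le> 1"
    then obtain z where z: "z \<in> D" "cnorm A (x \<ominus>\<^bsub>A\<^esub> z) \<le> K * e" "cnorm B (f z \<ominus>\<^bsub>B\<^esub> b) \<le> K * e"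
      using ap by blast
    have "cnorm B (h x \<ominus>\<^bsub>B\<^esub> b) \<le> cnorm B (h x \<ominus>\<^bsub>B\<^esub> f z) + cnorm B (f z \<ominus>\<^bsub>B\<^esub> b)"
      using hB x fD z b by (intro B.cnorm_minus_triangle) auto
    then show "cnorm B (h x \<ominus>\<^bsub>B\<^esub> b) \<le> 2 * K * e" using h_dist[OF x z(1)] z by linarith
  qed (use hB x b in auto)
  have add: "h (x \<oplus>\<^bsub>A\<^esub> y) = h x \<oplus>\<^bsub>B\<^esub> h y" if xy: "x \<in> L" "y \<in> L" for x y
  proof (rule h_char[of _ _ 2])
    fix e :: real assume e: "0 < e"
    obtain z where z: "z \<in> D" "cnorm A (x \<ominus>\<^bsub>A\<^esub> z) < e" using dense[OF xy(1) e] by blast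
    obtain w where w: "w \<in> D" "cnorm A (y \<ominus>\<^bsub>A\<^esub> w) < e" using dense[OF xy(2) e] by blast
    have "cnorm A (x \<oplus>\<^bsub>A\<^esub> y \<ominus>\<^bsub>A\<^esub> (z \<oplus>\<^bsub>A\<^esub> w)) \<le> cnorm A (x \<ominus>\<^bsub>A\<^esub> z) + cnorm A (y \<ominus>\<^bsub>A\<^esub> w)"
      using xy z w DA LA by (intro A.cnorm_add_minus_add) auto
    moreover have "cnorm B (f z \<oplus>\<^bsub>B\<^esub> f w \<ominus>\<^bsub>B\<^esub> (h x \<oplus>\<^bsub>B\<^esub> h y)) \<le>
        cnorm B (f z \<ominus>\<^bsub>B\<^esub> h x) + cnorm B (f w \<ominus>\<^bsub>B\<^esub> h y)"
      using xy z w fD hB by (intro B.cnorm_add_minus_add) auto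
    ultimately show "\<exists>v\<in>D. cnorm A (x \<oplus>\<^bsub>A\<^esub> y \<ominus>\<^bsub>A\<^esub> v) \<le> 2 * e \<and>
        cnorm B (f v \<ominus>\<^bsub>B\<^esub> (h x \<oplus>\<^bsub>B\<^esub> h y)) \<le> 2 * e"
      using z w h_dist'[of x z] h_dist'[of y w] xy DD fD
      by (intro bexI[of _ "z \<oplus>\<^bsub>A\<^esub> w"]) auto
  qed (use xy LD hB in auto)
  have smult: "h (c \<odot>\<^bsub>A\<^esub> x) = c \<odot>\<^bsub>B\<^esub> h x" if x: "x \<in> L" for c x
  proof (rule h_char[of _ _ "cmod c"])
    fix e :: real assume "0 < e"
    then obtain z where z: "z \<in> D" "cnorm A (x \<ominus>\<^bsub>A\<^esub> z) < e" using dense[OF x] by blast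
    then have "cnorm B (f z \<ominus>\<^bsub>B\<^esub> h x) \<le> e" using h_dist'[OF x z(1)] by simp
    then show "\<exists>v\<in>D. cnorm A (c \<odot>\<^bsub>A\<^esub> x \<ominus>\<^bsub>A\<^esub> v) \<le> cmod c * e \<and>
        cnorm B (f v \<ominus>\<^bsub>B\<^esub> (c \<odot>\<^bsub>B\<^esub> h x)) \<le> cmod c * e"
      using z x DD(4) fD hB DA LA
      by (intro bexI[of _ "c \<odot>\<^bsub>A\<^esub> z"])
        (auto simp: A.cnorm_smult_minus B.cnorm_smult_minus mult_left_mono)
  qed (use x LD hB in auto)
  have star: "h (star A x) = star B (h x)" if x: "x \<in> L" for x
  proof (rule h_char[of _ _ 1])
    fix e :: real assume "0 < e"
    then obtain z where z: "z \<in> D" "cnorm A (x \<ominus>\<^bsub>A\<^esub> z) < e" using dense[OF x] by blast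
    then have "cnorm B (f z \<ominus>\<^bsub>B\<^esub> h x) \<le> e" using h_dist'[OF x z(1)] by simp
    then show "\<exists>v\<in>D. cnorm A (star A x \<ominus>\<^bsub>A\<^esub> v) \<le> 1 * e \<and> cnorm B (f v \<ominus>\<^bsub>B\<^esub> star B (h x)) \<le> 1 * e"
      using z x D2 fD hB DA LA
      by (intro bexI[of _ "star A z"]) (auto simp: A.cnorm_star_minus B.cnorm_star_minus)
  qed (use x L2 hB in auto)
  have mult: "h (x \<otimes>\<^bsub>A\<^esub> y) = h x \<otimes>\<^bsub>B\<^esub> h y" if xy: "x \<in> L" "y \<in> L" for x y
  \<comment> \<open>A crude constant covering both product estimates. The two summands 1 allow for
    approximants of x and y whose norms are larger by at most 1.\<close>
  proof (rule h_char[of _ _ "cnorm A x + 1 + cnorm A y + cnorm B (h x) + 1"])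
    let ?K = "cnorm A x + 1 + cnorm A y + cnorm B (h x) + 1"
    have nn: "0 \<le> cnorm A x" "0 \<le> cnorm A y" "0 \<le> cnorm B (h x)"
      using xy LA hB A.cnorm_nonneg B.cnorm_nonneg by auto
    fix e :: real assume e: "0 < e" "e \<le> 1"
    obtain z where z: "z \<in> D" "cnorm A (x \<ominus>\<^bsub>A\<^esub> z) < e" using dense[OF xy(1) e(1)] by blast
    obtain w where w: "w \<in> D" "cnorm A (y \<ominus>\<^bsub>A\<^esub> w) < e" using dense[OF xy(2) e(1)] by blast
    have c: "x \<in> carrier A" "y \<in> carrier A" "z \<in> carrier A" "w \<in> carrier A"
      "f z \<in> carrier B" "f w \<in> carrier B" "h x \<in> carrier B" "h y \<in> carrier B"
      using xy z w fD hB LA DA by auto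
    have small: "cnorm A v \<le> cnorm A u + 1"
      if "u \<in> carrier A" "v \<in> carrier A" "cnorm A (u \<ominus>\<^bsub>A\<^esub> v) < e" for u v
    proof -
      have "cnorm A (v \<ominus>\<^bsub>A\<^esub> \<zero>\<^bsub>A\<^esub>) \<le> cnorm A (v \<ominus>\<^bsub>A\<^esub> u) + cnorm A (u \<ominus>\<^bsub>A\<^esub> \<zero>\<^bsub>A\<^esub>)"
        using that by (intro A.cnorm_minus_triangle) auto
      then show ?thesis
        using that e A.cnorm_minus_commute[of u v] by (simp add: A.minus_conv_smult)
    qed
    have "cnorm A (x \<otimes>\<^bsub>A\<^esub> y \<ominus>\<^bsub>A\<^esub> (z \<otimes>\<^bsub>A\<^esub> w)) \<le>
        cnorm A (x \<ominus>\<^bsub>A\<^esub> z) * cnorm A y + cnorm A z * cnorm A (y \<ominus>\<^bsub>A\<^esub> w)"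
      using c by (intro A.cnorm_mult_minus_mult) auto
    also have "\<dots> \<le> e * cnorm A y + (cnorm A x + 1) * e"
      using z w nn c e small[of x z] A.cnorm_nonneg
      by (intro add_mono mult_mono) (auto intro: order.strict_implies_order)
    also have "\<dots> \<le> ?K * e" using nn e by (simp add: algebra_simps)
    finally have 1: "cnorm A (x \<otimes>\<^bsub>A\<^esub> y \<ominus>\<^bsub>A\<^esub> (z \<otimes>\<^bsub>A\<^esub> w)) \<le> ?K * e" .
    have "cnorm B (f z \<otimes>\<^bsub>B\<^esub> f w \<ominus>\<^bsub>B\<^esub> (h x \<otimes>\<^bsub>B\<^esub> h y)) \<le>
        cnorm B (f z \<ominus>\<^bsub>B\<^esub> h x) * cnorm B (f w) + cnorm B (h x) * cnorm B (f w \<ominus>\<^bsub>B\<^esub> h y)"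
      using c by (intro B.cnorm_mult_minus_mult) auto
    also have "\<dots> \<le> e * (cnorm A y + 1) + cnorm B (h x) * e"
    proof -
      have "cnorm B (f w) \<le> cnorm A y + 1" using contr[OF w(1)] small[of y w] c w by simp
      moreover have "cnorm B (f z \<ominus>\<^bsub>B\<^esub> h x) \<le> e" using h_dist'[OF xy(1) z(1)] z by simp
      moreover have "cnorm B (f w \<ominus>\<^bsub>B\<^esub> h y) \<le> e" using h_dist'[OF xy(2) w(1)] w by simp
      ultimately show ?thesis
        using nn c e B.cnorm_nonneg by (intro add_mono mult_mono) auto
    qed
    also have "\<dots> \<le> ?K * e" using nn e by (simp add: algebra_simps)
    finally have 2: "cnorm B (f (z \<otimes>\<^bsub>A\<^esub> w) \<ominus>\<^bsub>B\<^esub> (h x \<otimes>\<^bsub>B\<^esub> h y)) \<le> ?K * e"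
      using fD z w by simp
    show "\<exists>v\<in>D. cnorm A (x \<otimes>\<^bsub>A\<^esub> y \<ominus>\<^bsub>A\<^esub> v) \<le> ?K * e \<and> cnorm B (f v \<ominus>\<^bsub>B\<^esub> (h x \<otimes>\<^bsub>B\<^esub> h y)) \<le> ?K * e"
      using 1 2 D2 z w by blast
  qed (use xy L2 hB in auto)
  have "h \<in> star_hom (A\<lparr>carrier := L\<rparr>) B"
    using add mult smult star hB by (auto simp: star_hom_def)
  moreover have "h \<in> extensional L" by (simp add: h_def)
  moreover have "h x = f x" if "x \<in> D" for x
    by (rule h_char[of _ _ 1])
      (use that DL fD DA in \<open>auto intro!: bexI[of _ x]\<close>)
  ultimately show thesis using that by blast
qed

section \<open>The gauge action and its fixed point algebra\<close>

definition path_factor :: "('k::finite \<Rightarrow> int) \<Rightarrow> 'k path \<Rightarrow> int"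
  where "path_factor m \<mu> = (\<Prod>i\<in>UNIV. m i ^ count \<mu> i)"

lemma restriction_eq: "restriction m l \<mu> = l * path_factor m \<mu>"
  by (simp add: restriction_def path_factor_def degree_def)

lemma path_factor_add: "path_factor m (\<mu> + \<nu>) = path_factor m \<mu> * path_factor m \<nu>"
  by (simp add: path_factor_def power_add prod.distrib)

lemma path_factor_empty [simp]: "path_factor m {#} = 1"
  by (simp add: path_factor_def)

lemma count_all_edges [simp]: "count (all_edges :: 'k::finite path) i = 1"
  by (simp add: all_edges_def edge_def count_sum)

lemma path_factor_all_edges: "path_factor m all_edges = (\<Prod>i\<in>UNIV. m i)"
  by (simp add: path_factor_def)

lemma path_factor_repeat: "path_factor m (repeat_mset n all_edges) = (\<Prod>i\<in>UNIV. m i) ^ n"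
  by (simp add: path_factor_def prod_power_distrib)

text \<open>The diagonal degrees are cofinal: no colour occurs in \<open>\<mu>\<close> more often
  than the length of \<open>\<mu>\<close>, so that length serves as n. This is how a word of degree
  zero reaches some stage.\<close>

lemma ex_path_complement:
  fixes \<mu> :: "'k::finite path"
  obtains n \<kappa> where "\<mu> + \<kappa> = repeat_mset n all_edges"
proof -
  have "\<mu> \<subseteq># repeat_mset (size \<mu>) all_edges"
    by (simp add: subseteq_mset_def count_le_size)
  then show thesis using that[of "repeat_mset (size \<mu>) all_edges - \<mu>" "size \<mu>"] by simp
qed

definition gauge_weight :: "('k::finite \<Rightarrow> complex) \<Rightarrow> 'k path \<Rightarrow> 'k path \<Rightarrow> complex"
  where "gauge_weight t \<mu> \<nu> = (\<Prod>i\<in>UNIV. t i powi (int (degree \<mu> i) - int (degree \<nu> i)))"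

lemma gauge_weight_same [simp]: "gauge_weight t \<mu> \<mu> = 1"
  by (simp add: gauge_weight_def)

lemma torus_nonzero: "t \<in> torus \<Longrightarrow> t i \<noteq> 0"
  by (auto simp: torus_def dest: spec[of _ i])

lemma torus_cnj: "t \<in> torus \<Longrightarrow> t i * cnj (t i) = 1"
  by (subst complex_norm_square[symmetric]) (simp add: torus_def)

text \<open>Separates a factor for \<open>\<mu>\<close> from a conjugate factor for
  \<open>\<nu>\<close>, the form in which the weight arises when every \<open>s \<mu>\<close> is
  rescaled.\<close>

lemma gauge_weight_eq:
  assumes "t \<in> torus"
  shows "gauge_weight t \<mu> \<nu> = (\<Prod>i\<in>UNIV. t i ^ count \<mu> i) * cnj (\<Prod>i\<in>UNIV. t i ^ count \<nu> i)"
proof -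
  have "t i powi (int (count \<mu> i) - int (count \<nu> i)) = t i ^ count \<mu> i * cnj (t i) ^ count \<nu> i" for i
  proof -
    have "cnj (t i) = inverse (t i)"
      using torus_cnj[OF assms] torus_nonzero[OF assms] by (metis inverse_unique)
    then show ?thesis
      using torus_nonzero[OF assms, of i]
      by (simp add: power_int_diff divide_inverse power_inverse)
  qed
  then show ?thesis by (simp add: gauge_weight_def degree_def prod.distrib)
qed

lemma ex_gauge_weight_minus_one:
  fixes \<mu> \<nu> :: "'k::finite path"
  assumes "\<mu> \<noteq> \<nu>"
  obtains t where "t \<in> torus" "gauge_weight t \<mu> \<nu> = -1"
proof -
  obtain j where j: "count \<mu> j \<noteq> count \<nu> j" using assms by (metis multiset_eqI)
  define d where "d = int (count \<mu> j) - int (count \<nu> j)"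
  \<comment> \<open>Only colour j is rotated, by an angle whose d-th multiple is a half turn; d may
    be negative.\<close>
  define t where "t = (\<lambda>i. if i = j then cis (pi / of_int d) else 1)"
  have d: "d \<noteq> 0" using j by (simp add: d_def)
  have "gauge_weight t \<mu> \<nu> = (\<Prod>i\<in>UNIV. if i = j then cis (pi / of_int d) powi d else 1)"
    unfolding gauge_weight_def degree_def by (rule prod.cong) (auto simp: t_def d_def)
  also have "\<dots> = cis (pi / of_int d) powi d" by simp
  also have "\<dots> = -1" using d by (simp add: cis_power_int)
  finally show thesis using that[of t] by (auto simp: t_def torus_def)
qed

section \<open>Calculus of words in the universal algebra\<close>

locale graph_algebra = unital_cstar_algebra A for A :: "'a cstar_alg" (structure) +
  fixes m :: "'k::finite \<Rightarrow> int" and u :: "int \<Rightarrow> 'a" and s :: "'k path \<Rightarrow> 'a"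
  assumes universal: "universal_graph_algebra m A u s"
begin

lemma one_closed' [simp]: "\<one> \<in> carrier A"
  and one_left [simp]: "x \<in> carrier A \<Longrightarrow> \<one> \<otimes> x = x"
  and one_right [simp]: "x \<in> carrier A \<Longrightarrow> x \<otimes> \<one> = x"
  using unital_cstar_algebra_one[OF unital_cstar_algebra_axioms] by auto

lemma star_one [simp]: "star A \<one> = \<one>"
  by (metis one_closed' one_left one_right star_closed star_mult star_star)

lemma family: "graph_family m A u s"
  using universal by (simp add: universal_graph_algebra_def)

lemma universal_hom:
  fixes B :: "'a cstar_alg"
  assumes "unital_cstar_algebra B" "graph_family m B U S"
  shows "\<exists>\<phi>\<in>unital_star_hom A B. (\<forall>g. \<phi> (u g) = U g) \<and> (\<forall>\<mu>. \<phi> (s \<mu>) = S \<mu>)"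
  using universal assms by (simp add: universal_graph_algebra_def)

lemma u_closed [simp]: "u g \<in> carrier A" and s_closed [simp]: "s \<mu> \<in> carrier A"
  using family by (auto simp: graph_family_def is_unitary_def is_isometry_def)

lemma u_star_u: "star A (u g) \<otimes> u g = \<one>" and u_u_star: "u g \<otimes> star A (u g) = \<one>"
  and s_star_s [simp]: "star A (s \<mu>) \<otimes> s \<mu> = \<one>" and s_s_star [simp]: "s \<mu> \<otimes> star A (s \<mu>) = \<one>"
  and u_add: "u (g + h) = u g \<otimes> u h"
  and s_add: "s (\<mu> + \<nu>) = s \<mu> \<otimes> s \<nu>"
  and u_s: "u g \<otimes> s \<mu> = s \<mu> \<otimes> u (g * path_factor m \<mu>)"
  using family by (auto simp: graph_family_def is_unitary_def is_isometry_def restriction_eq)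

lemma s_star_s' [simp]: "x \<in> carrier A \<Longrightarrow> star A (s \<mu>) \<otimes> (s \<mu> \<otimes> x) = x"
  and s_s_star' [simp]: "x \<in> carrier A \<Longrightarrow> s \<mu> \<otimes> (star A (s \<mu>) \<otimes> x) = x"
  by (simp_all flip: cmult_assoc)

lemma u_zero [simp]: "u 0 = \<one>"
proof -
  have "u 0 = star A (u 0) \<otimes> (u 0 \<otimes> u 0)"
    using u_star_u[of 0] by (simp flip: cmult_assoc)
  also have "u 0 \<otimes> u 0 = u 0" using u_add[of 0 0] by simp
  finally show ?thesis by (simp add: u_star_u)
qed

lemma s_zero [simp]: "s {#} = \<one>"
proof -
  have "s {#} = star A (s {#}) \<otimes> (s {#} \<otimes> s {#})" by simp
  also have "s {#} \<otimes> s {#} = s {#}" using s_add[of "{#}" "{#}"] by simp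
  finally show ?thesis by simp
qed

lemma star_u: "star A (u g) = u (- g)"
proof -
  have "star A (u g) = star A (u g) \<otimes> (u g \<otimes> u (- g))"
    by (simp flip: u_add)
  also have "\<dots> = u (- g)" using u_star_u[of g] by (simp flip: cmult_assoc)
  finally show ?thesis .
qed

definition word :: "'k path \<Rightarrow> int \<Rightarrow> 'k path \<Rightarrow> 'a"
  where "word \<mu> g \<nu> = s \<mu> \<otimes> u g \<otimes> star A (s \<nu>)"

lemma word_closed [simp]: "word \<mu> g \<nu> \<in> carrier A"
  by (simp add: word_def)

lemma star_word: "star A (word \<mu> g \<nu>) = word \<nu> (- g) \<mu>"
  by (simp add: word_def star_mult star_star star_u cmult_assoc)

text \<open>Paths commute, so \<open>s \<nu>\<close> and \<open>s \<alpha>\<close> do; multiplying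
  by the adjoint of \<open>s \<nu>\<close> on both sides moves the relation to that adjoint, since
  \<open>s \<nu>\<close> is unitary.\<close>

lemma s_star_comm: "star A (s \<nu>) \<otimes> s \<alpha> = s \<alpha> \<otimes> star A (s \<nu>)"
proof -
  have "s \<nu> \<otimes> s \<alpha> = s \<alpha> \<otimes> s \<nu>" using s_add by (metis add.commute)
  then have "star A (s \<nu>) \<otimes> (s \<nu> \<otimes> s \<alpha>) \<otimes> star A (s \<nu>) =
      star A (s \<nu>) \<otimes> (s \<alpha> \<otimes> s \<nu>) \<otimes> star A (s \<nu>)" by simp
  then show ?thesis by (simp add: cmult_assoc)
qed

lemma s_star_u: "star A (s \<nu>) \<otimes> u h = u (h * path_factor m \<nu>) \<otimes> star A (s \<nu>)"
proof -
  have "star A (s \<nu>) \<otimes> (u h \<otimes> s \<nu>) \<otimes> star A (s \<nu>) =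
      star A (s \<nu>) \<otimes> (s \<nu> \<otimes> u (h * path_factor m \<nu>)) \<otimes> star A (s \<nu>)" by (simp add: u_s)
  then show ?thesis by (simp add: cmult_assoc)
qed

lemma star_s_add: "star A (s (\<mu> + \<nu>)) = star A (s \<mu>) \<otimes> star A (s \<nu>)"
  by (subst add.commute) (simp add: s_add star_mult)

text \<open>The adjoint of \<open>s \<nu>\<close> is moved past \<open>s \<alpha>\<close>, then both
  group elements are collected in the middle. Each picks up the path factor of the path it crosses,
  so the words are closed under products.\<close>

lemma word_mult:
  "word \<mu> g \<nu> \<otimes> word \<alpha> h \<beta> =
    word (\<mu> + \<alpha>) (g * path_factor m \<alpha> + h * path_factor m \<nu>) (\<nu> + \<beta>)"
proof -
  have "word \<mu> g \<nu> \<otimes> word \<alpha> h \<beta> =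
      s \<mu> \<otimes> (u g \<otimes> ((star A (s \<nu>) \<otimes> s \<alpha>) \<otimes> (u h \<otimes> star A (s \<beta>))))"
    by (simp add: word_def cmult_assoc)
  also have "\<dots> = s \<mu> \<otimes> ((u g \<otimes> s \<alpha>) \<otimes> ((star A (s \<nu>) \<otimes> u h) \<otimes> star A (s \<beta>)))"
    by (simp only: s_star_comm) (simp add: cmult_assoc)
  also have "\<dots> = word (\<mu> + \<alpha>) (g * path_factor m \<alpha> + h * path_factor m \<nu>) (\<nu> + \<beta>)"
    by (simp only: u_s s_star_u) (simp add: word_def s_add[of \<mu> \<alpha>] u_add star_s_add cmult_assoc)
  finally show ?thesis .
qed

text \<open>Inserting 1 as \<open>s \<kappa>\<close> times its adjoint just before the adjoint of
  \<open>s \<nu>\<close> and commuting \<open>s \<kappa>\<close> to the left through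
  \<open>u g\<close> lengthens both paths. This one identity gives the stage inclusions, the
  multiplication inside a stage and the passage from degree zero words to stages.\<close>

lemma word_shift: "word (\<mu> + \<kappa>) (g * path_factor m \<kappa>) (\<nu> + \<kappa>) = word \<mu> g \<nu>"
proof -
  have "word (\<mu> + \<kappa>) (g * path_factor m \<kappa>) (\<nu> + \<kappa>) =
      s \<mu> \<otimes> ((s \<kappa> \<otimes> u (g * path_factor m \<kappa>)) \<otimes> (star A (s \<kappa>) \<otimes> star A (s \<nu>)))"
    by (simp add: word_def s_add star_mult cmult_assoc)
  also have "\<dots> = word \<mu> g \<nu>"
    by (simp only: flip: u_s) (simp add: word_def cmult_assoc)
  finally show ?thesis .
qed

abbreviation words :: "'a set"
  where "words \<equiv> {word \<mu> g \<nu> | \<mu> g \<nu>. True}"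

text \<open>The words contain all \<open>u g\<close> and \<open>s \<mu>\<close>, and their closed
  span is a unital C*-subalgebra; the generation clause of universality leaves no room for a proper
  one.\<close>

lemma closed_span_words: "closed_span A words = carrier A"
proof -
  have W: "words \<subseteq> carrier A" by auto
  have sub: "star_subalgebra A (closed_span A words)"
    by (rule star_subalgebra_closed_span) (auto simp: word_mult star_word, blast+)
  have "word \<mu> g \<nu> \<in> closed_span A words" for \<mu> g \<nu>
    using closed_span_subset[OF W] by auto
  from this[of "{#}" _ "{#}"] this[of _ 0 "{#}"] this[of "{#}" 0 "{#}"]
  have "u g \<in> closed_span A words" "s \<mu> \<in> closed_span A words" "\<one> \<in> closed_span A words" for g \<mu>
    by (simp_all add: word_def)
  then have "unital_cstar_subalgebra (closed_span A words) A"
    using sub closed_subspace_closed_span[OF W]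
    by (auto simp: unital_cstar_subalgebra_def star_subalgebra_def closed_subspace_def)
  then show ?thesis
    using universal \<open>\<And>g. u g \<in> _\<close> \<open>\<And>\<mu>. s \<mu> \<in> _\<close>
    unfolding universal_graph_algebra_def by blast
qed

lemma eq_on_words:
  assumes B: "cstar_algebra B" and T: "bounded_semilinear A B T" "bounded_semilinear A B T'"
    and "\<And>c x. x \<in> carrier A \<Longrightarrow> T (c \<odot> x) = c \<odot>\<^bsub>B\<^esub> T x"
    and "\<And>c x. x \<in> carrier A \<Longrightarrow> T' (c \<odot> x) = c \<odot>\<^bsub>B\<^esub> T' x"
    and "\<And>\<mu> g \<nu>. T (word \<mu> g \<nu>) = T' (word \<mu> g \<nu>)" and "x \<in> carrier A"
  shows "T x = T' x"
proof -
  have "closed_subspace A {x \<in> carrier A. T x = T' x}"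
    by (rule closed_subspace_equalizer) (use assms cstar_algebra_axioms in auto)
  then have "closed_span A words \<subseteq> {x \<in> carrier A. T x = T' x}"
    by (rule closed_span_minimal) (use assms in auto)
  then show ?thesis using assms closed_span_words by auto
qed

text \<open>Multiplying each \<open>s \<mu>\<close> by a unimodular scalar that is multiplicative in
  \<open>\<mu>\<close> gives another family in the same algebra, so universality applies with
  \<open>A\<close> as its own target.\<close>

lemma ex_gauge_hom:
  assumes t: "t \<in> torus"
  shows "\<exists>\<phi>\<in>unital_star_hom A A. \<forall>\<mu> g \<nu>. \<phi> (word \<mu> g \<nu>) = gauge_weight t \<mu> \<nu> \<odot> word \<mu> g \<nu>"
proof -
  define w where "w \<mu> = (\<Prod>i\<in>UNIV. t i ^ count \<mu> i)" for \<mu>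
  have w1: "cnj (w \<mu>) * w \<mu> = 1" "w \<mu> * cnj (w \<mu>) = 1" for \<mu>
    using gauge_weight_eq[OF t, of \<mu> \<mu>] by (simp_all add: w_def mult.commute)
  have w_add: "w (\<mu> + \<nu>) = w \<nu> * w \<mu>" for \<mu> \<nu>
    by (simp add: w_def power_add prod.distrib)
  have "graph_family m A u (\<lambda>\<mu>. w \<mu> \<odot> s \<mu>)"
    using family unfolding graph_family_def is_unitary_def is_isometry_def
    by (auto simp: star_smult smult_mult_left smult_mult_right csmult_csmult w1 w_add)
  from universal_hom[OF unital_cstar_algebra_axioms this]
  obtain \<phi> where \<phi>: "\<phi> \<in> unital_star_hom A A" "\<forall>g. \<phi> (u g) = u g" "\<forall>\<mu>. \<phi> (s \<mu>) = w \<mu> \<odot> s \<mu>"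
    by blast
  have "\<phi> \<in> star_hom A A" using \<phi> by (simp add: unital_star_hom_def)
  note D = star_homD[OF this]
  have "\<phi> (word \<mu> g \<nu>) = gauge_weight t \<mu> \<nu> \<odot> word \<mu> g \<nu>" for \<mu> g \<nu>
    using \<phi> by (simp add: word_def D star_smult smult_mult_left smult_mult_right csmult_csmult
        gauge_weight_eq[OF t] w_def mult.commute)
  then show ?thesis using \<phi> by blast
qed

lemma gauge_weight_cnj:
  "t \<in> torus \<Longrightarrow> gauge_weight (\<lambda>i. cnj (t i)) \<mu> \<nu> * gauge_weight t \<mu> \<nu> = 1"
  using torus_cnj[of t]
  by (simp add: gauge_weight_def mult.commute[of "cnj c" c for c]
      flip: prod.distrib power_int_mult_distrib)

text \<open>\<open>gauge_action\<close> is a definite description, so nothing is known about it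
  before existence and uniqueness are settled. The inverse is the homomorphism for the conjugate
  parameters, and uniqueness holds because bounded linear maps are determined by the words.\<close>

lemma gauge_action:
  assumes t: "t \<in> torus"
  shows "gauge_action A u s t \<in> unital_star_hom A A"
    and "gauge_action A u s t (word \<mu> g \<nu>) = gauge_weight t \<mu> \<nu> \<odot> word \<mu> g \<nu>"
proof -
  let ?P = "\<lambda>\<gamma>. \<gamma> \<in> extensional (carrier A) \<and> star_automorphism A \<gamma> \<and>
    (\<forall>\<mu> g \<nu>. \<gamma> (s \<mu> \<otimes> u g \<otimes> star A (s \<nu>)) =
      (\<Prod>i\<in>UNIV. t i powi (int (degree \<mu> i) - int (degree \<nu> i))) \<odot> (s \<mu> \<otimes> u g \<otimes> star A (s \<nu>)))"
  let ?t = "\<lambda>i. cnj (t i)"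
  have t': "?t \<in> torus" using t by (simp add: torus_def)
  obtain \<phi> where \<phi>: "\<phi> \<in> unital_star_hom A A"
    "\<And>\<mu> g \<nu>. \<phi> (word \<mu> g \<nu>) = gauge_weight t \<mu> \<nu> \<odot> word \<mu> g \<nu>"
    using ex_gauge_hom[OF t] by blast
  obtain \<psi> where \<psi>: "\<psi> \<in> unital_star_hom A A"
    "\<And>\<mu> g \<nu>. \<psi> (word \<mu> g \<nu>) = gauge_weight ?t \<mu> \<nu> \<odot> word \<mu> g \<nu>"
    using ex_gauge_hom[OF t'] by blast
  have h: "\<phi> \<in> star_hom A A" "\<psi> \<in> star_hom A A" using \<phi> \<psi> by (auto simp: unital_star_hom_def)
  note D = star_homD[OF h(1)] star_homD[OF h(2)]
  have id: "(\<lambda>x. x) \<in> star_hom A A" by (auto simp: star_hom_def)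
  have comp: "(\<lambda>x. \<phi> (\<psi> x)) \<in> star_hom A A" "(\<lambda>x. \<psi> (\<phi> x)) \<in> star_hom A A"
    using D by (auto simp: star_hom_def)
  note bl = star_hom_bounded_semilinear[OF cstar_algebra_axioms cstar_algebra_axioms]
  have inv: "\<phi> (\<psi> x) = x" "\<psi> (\<phi> x) = x" if x: "x \<in> carrier A" for x
    using eq_on_words[OF cstar_algebra_axioms bl[OF comp(1)] bl[OF id] _ _ _ x]
      eq_on_words[OF cstar_algebra_axioms bl[OF comp(2)] bl[OF id] _ _ _ x]
      gauge_weight_cnj[OF t]
    by (auto simp: D \<phi> \<psi> csmult_csmult mult.commute)
  define \<gamma> where "\<gamma> = restrict \<phi> (carrier A)"
  have \<gamma>_hom: "\<gamma> \<in> unital_star_hom A A"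
    using \<phi>(1) h(1) by (auto simp: \<gamma>_def unital_star_hom_def star_hom_def)
  moreover have "bij_betw \<gamma> (carrier A) (carrier A)"
    by (rule bij_betw_byWitness[where f' = \<psi>]) (use inv D in \<open>auto simp: \<gamma>_def\<close>)
  ultimately have P: "?P \<gamma>"
    using \<phi>(2) by (auto simp: star_automorphism_def \<gamma>_def word_def gauge_weight_def)
  have uniq: "\<gamma>' = \<gamma>" if P': "?P \<gamma>'" for \<gamma>'
  proof (rule extensionalityI[of _ "carrier A"])
    fix x assume x: "x \<in> carrier A"
    have hh: "\<gamma>' \<in> star_hom A A" "\<gamma> \<in> star_hom A A"
      using P P' by (auto simp: star_automorphism_def unital_star_hom_def)
    show "\<gamma>' x = \<gamma> x"
      by (rule eq_on_words[OF cstar_algebra_axioms bl[OF hh(1)] bl[OF hh(2)] _ _ _ x])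
        (use P P' star_homD[OF hh(1)] star_homD[OF hh(2)] in \<open>simp_all add: word_def\<close>)
  qed (use P P' in auto)
  have "gauge_action A u s t = \<gamma>"
    unfolding gauge_action_def
  proof (rule the_equality)
    show "?P \<gamma>" by (rule P)
    show "\<gamma>' = \<gamma>" if "?P \<gamma>'" for \<gamma>' using that by (rule uniq)
  qed
  then show "gauge_action A u s t \<in> unital_star_hom A A"
    and "gauge_action A u s t (word \<mu> g \<nu>) = gauge_weight t \<mu> \<nu> \<odot> word \<mu> g \<nu>"
    using P by (auto simp: star_automorphism_def word_def gauge_weight_def)
qed

abbreviation \<gamma> where "\<gamma> \<equiv> gauge_action A u s"

lemma gauge_hom: "t \<in> torus \<Longrightarrow> \<gamma> t \<in> star_hom A A"
  using gauge_action(1) by (simp add: unital_star_hom_def)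

definition fixed :: "'a set"
  where "fixed = {x \<in> carrier A. \<forall>t\<in>torus. \<gamma> t x = x}"

lemma gauge_fixed_algebra_eq: "gauge_fixed_algebra A u s = A\<lparr>carrier := fixed\<rparr>"
  by (simp add: gauge_fixed_algebra_def fixed_def)

lemma const_one_torus: "(\<lambda>_. 1) \<in> torus"
  by (simp add: torus_def)

lemma closed_subspace_fixed: "closed_subspace A fixed"
proof -
  have id: "(\<lambda>x. x) \<in> star_hom A A" by (auto simp: star_hom_def)
  note bl = star_hom_bounded_semilinear[OF cstar_algebra_axioms cstar_algebra_axioms]
  have cl: "closed_subspace A {x \<in> carrier A. \<gamma> t x = x}" if t: "t \<in> torus" for t
    by (rule closed_subspace_equalizer[OF cstar_algebra_axioms cstar_algebra_axioms
          bl[OF gauge_hom[OF t]] bl[OF id]]) (auto simp: star_homD[OF gauge_hom[OF t]])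
  note D = closed_subspaceD[OF cl]
  show ?thesis
  proof (rule closed_subspaceI)
    fix x assume x: "x \<in> carrier A" and ap: "\<And>e. e > 0 \<Longrightarrow> \<exists>y\<in>fixed. cnorm A (x \<ominus> y) < e"
    have "x \<in> {x \<in> carrier A. \<gamma> t x = x}" if t: "t \<in> torus" for t
    proof (rule D(6)[OF t x])
      show "\<exists>y\<in>{x \<in> carrier A. \<gamma> t x = x}. cnorm A (x \<ominus> y) < e" if "e > 0" for e
        using ap[OF that] t by (auto simp: fixed_def)
    qed
    then show "x \<in> fixed" using x by (simp add: fixed_def)
  qed (use D const_one_torus in \<open>auto simp: fixed_def\<close>)
qed

lemma fixed_closed: "x \<in> fixed \<Longrightarrow> x \<in> carrier A"
  by (simp add: fixed_def)

lemma star_subalgebra_fixed: "star_subalgebra A fixed"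
  using closed_subspace_fixed star_homD(3)[OF gauge_hom] star_homD(5)[OF gauge_hom]
  by (auto simp: star_subalgebra_def closed_subspace_def fixed_def)

lemma cstar_algebra_fixed: "cstar_algebra (A\<lparr>carrier := fixed\<rparr>)"
  using cstar_algebra_subalgebra star_subalgebra_fixed closed_subspace_fixed
  by (simp add: closed_subspace_def)

abbreviation gen where "gen \<equiv> stage_generator A u s"

lemma gen_eq: "gen n p = word (repeat_mset n all_edges) p (repeat_mset n all_edges)"
  by (simp add: stage_generator_def word_def)

lemma gen_closed [simp]: "gen n p \<in> carrier A"
  by (simp add: gen_eq)

lemma gen_fixed: "gen n p \<in> fixed"
  by (simp add: fixed_def gauge_action(2) gen_eq)

text \<open>The product formula doubles the path on both sides; \<open>word_shift\<close> removes
  the additional copy together with its factor in the exponent.\<close>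

lemma gen_mult: "gen n p \<otimes> gen n q = gen n (p + q)"
proof -
  have "gen n p \<otimes> gen n q = word (repeat_mset n all_edges + repeat_mset n all_edges)
      ((p + q) * path_factor m (repeat_mset n all_edges))
      (repeat_mset n all_edges + repeat_mset n all_edges)"
    by (simp add: gen_eq word_mult algebra_simps)
  also have "\<dots> = gen n (p + q)" unfolding gen_eq by (rule word_shift)
  finally show ?thesis .
qed

lemma star_gen: "star A (gen n p) = gen n (- p)"
  by (simp add: gen_eq star_word)

lemma gen_zero [simp]: "gen n 0 = \<one>"
  by (simp add: gen_eq word_def)

text \<open>An equality inside one algebra: the prescribed connecting maps are therefore genuine
  inclusions.\<close>

lemma gen_Suc: "gen n p = gen (Suc n) (p * (\<Prod>i\<in>UNIV. m i))"
  using word_shift[of "repeat_mset n all_edges" all_edges p "repeat_mset n all_edges"]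
  by (simp add: gen_eq path_factor_all_edges add.commute)

text \<open>Linear contractions fixing the fixed point algebra and diagonal on words. They commute, so
  finitely many of the averages \<open>(1 + \<gamma>\<^bsub>t\<^esub>) / 2\<close> can be combined to remove all components of nonzero
  degree from an element of the linear span of the words.\<close>

definition averages :: "('a \<Rightarrow> 'a) set"
  where "averages = {T. T \<in> carrier A \<rightarrow> carrier A \<and>
    (\<forall>x\<in>carrier A. \<forall>y\<in>carrier A. T (x \<oplus> y) = T x \<oplus> T y) \<and>
    (\<forall>c. \<forall>x\<in>carrier A. T (c \<odot> x) = c \<odot> T x) \<and>
    (\<forall>x\<in>carrier A. cnorm A (T x) \<le> cnorm A x) \<and> (\<forall>x\<in>fixed. T x = x) \<and>
    (\<forall>\<mu> g \<nu>. \<exists>c. T (word \<mu> g \<nu>) = c \<odot> word \<mu> g \<nu>)}"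

lemma averagesD:
  assumes "T \<in> averages"
  shows "x \<in> carrier A \<Longrightarrow> T x \<in> carrier A"
    and "\<lbrakk>x \<in> carrier A; y \<in> carrier A\<rbrakk> \<Longrightarrow> T (x \<oplus> y) = T x \<oplus> T y"
    and "x \<in> carrier A \<Longrightarrow> T (c \<odot> x) = c \<odot> T x"
    and "x \<in> carrier A \<Longrightarrow> cnorm A (T x) \<le> cnorm A x"
    and "x \<in> fixed \<Longrightarrow> T x = x"
    and "\<exists>c. T (word \<mu> g \<nu>) = c \<odot> word \<mu> g \<nu>"
  using assms by (auto simp: averages_def)

lemma averages_bounded_semilinear: "T \<in> averages \<Longrightarrow> bounded_semilinear A A T"
  unfolding bounded_semilinear_def averages_def
  by (auto intro!: exI[of _ "\<lambda>c. c"] exI[of _ "1::real"])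

lemma averages_comp:
  assumes T: "T \<in> averages" and T': "T' \<in> averages"
  shows "(\<lambda>x. T (T' x)) \<in> averages"
proof -
  note D = averagesD[OF T] and D' = averagesD[OF T']
  have "\<exists>c. T (T' (word \<mu> g \<nu>)) = c \<odot> word \<mu> g \<nu>" for \<mu> g \<nu>
  proof -
    obtain c d where "T (word \<mu> g \<nu>) = c \<odot> word \<mu> g \<nu>" "T' (word \<mu> g \<nu>) = d \<odot> word \<mu> g \<nu>"
      using D(6) D'(6) by blast
    then show ?thesis by (auto simp: D(3) csmult_csmult)
  qed
  moreover have "cnorm A (T (T' x)) \<le> cnorm A x" if "x \<in> carrier A" for x
    using D(4)[of "T' x"] D'(4)[OF that] D'(1)[OF that] by simp
  ultimately show ?thesis
    unfolding averages_def using D D' by auto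
qed

lemma averages_commute:
  assumes T: "T \<in> averages" and T': "T' \<in> averages" and x: "x \<in> carrier A"
  shows "T (T' x) = T' (T x)"
proof (rule eq_on_words[OF cstar_algebra_axioms _ _ _ _ _ x])
  note D = averagesD[OF T] and D' = averagesD[OF T']
  show "T (T' (word \<mu> g \<nu>)) = T' (T (word \<mu> g \<nu>))" for \<mu> g \<nu>
  proof -
    obtain c d where "T (word \<mu> g \<nu>) = c \<odot> word \<mu> g \<nu>" "T' (word \<mu> g \<nu>) = d \<odot> word \<mu> g \<nu>"
      using D(6) D'(6) by blast
    then show ?thesis by (auto simp: D(3) D'(3) csmult_csmult mult.commute)
  qed
  show "bounded_semilinear A A (\<lambda>x. T (T' x))" "bounded_semilinear A A (\<lambda>x. T' (T x))"
    by (rule averages_bounded_semilinear, rule averages_comp, fact, fact)+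
qed (simp_all add: cstar_algebra_axioms averagesD(1,3)[OF T] averagesD(1,3)[OF T'])

lemma id_averages: "(\<lambda>x. x) \<in> averages"
  unfolding averages_def by (auto intro!: exI[of _ 1])

lemma half_averages:
  assumes t: "t \<in> torus"
  shows "(\<lambda>x. (1/2) \<odot> (x \<oplus> \<gamma> t x)) \<in> averages"
proof -
  note D = star_homD[OF gauge_hom[OF t]]
  have "cnorm A ((1/2) \<odot> (x \<oplus> \<gamma> t x)) \<le> cnorm A x" if x: "x \<in> carrier A" for x
    using cnorm_triangle[OF x D(1)[OF x]] x D(1)[OF x]
      star_hom_contractive[OF cstar_algebra_axioms cstar_algebra_axioms gauge_hom[OF t] x]
    by (simp add: cnorm_smult norm_divide)
  moreover have "(1/2) \<odot> (x \<oplus> \<gamma> t x) = x" if x: "x \<in> fixed" for x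
    using x t csmult_add_left[of x "1/2" "1/2"] by (simp add: fixed_def csmult_add_right)
  moreover have "\<exists>c. (1/2) \<odot> (word \<mu> g \<nu> \<oplus> \<gamma> t (word \<mu> g \<nu>)) = c \<odot> word \<mu> g \<nu>" for \<mu> g \<nu>
    by (rule exI[of _ "1/2 + 1/2 * gauge_weight t \<mu> \<nu>"])
      (simp add: gauge_action(2)[OF t] csmult_add_left csmult_add_right csmult_csmult)
  ultimately show ?thesis
    unfolding averages_def using D
    by (auto simp: csmult_add_right M.a_ac csmult_csmult mult.commute)
qed

text \<open>The elements that some average carries into \<open>?K\<close> form a subspace: averages
  commute and fix \<open>?K\<close> pointwise, so the composition of two of them serves a sum. Each
  word belongs to it, hence so does the linear span. If y in the span is close to a fixed x, then T
  y is just as close, since T is contractive and fixes x, and T y lies in \<open>?K\<close>.\<close>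

lemma fixed_eq_closed_span: "fixed = closed_span A (\<Union>n. range (gen n))"
proof
  let ?G = "\<Union>n. range (gen n)"
  let ?K = "closed_span A ?G"
  have G: "?G \<subseteq> carrier A" by auto
  show KF: "?K \<subseteq> fixed"
    by (rule closed_span_minimal[OF closed_subspace_fixed]) (use gen_fixed in auto)
  note K = closed_subspaceD[OF closed_subspace_closed_span[OF G]]
  have GK: "gen n p \<in> ?K" for n p using closed_span_subset[OF G] by auto
  define V where "V = {y \<in> carrier A. \<exists>T\<in>averages. T y \<in> ?K}"
  have V: "submodule V complex_ring A"
  proof (rule submodule_complexI)
    show "\<zero> \<in> V" using id_averages K(2) by (auto simp: V_def)
    show "c \<odot> x \<in> V" if "x \<in> V" for c x
      using that K(4) averagesD(3) unfolding V_def by force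
    show "x \<oplus> y \<in> V" if xyV: "x \<in> V" "y \<in> V" for x y
    proof -
      obtain T T' where T: "T \<in> averages" "T x \<in> ?K" and T': "T' \<in> averages" "T' y \<in> ?K"
        and xy: "x \<in> carrier A" "y \<in> carrier A"
        using xyV by (auto simp: V_def)
      have "T (T' (x \<oplus> y)) = T' (T x) \<oplus> T (T' y)"
        using T T' xy averages_commute[OF T(1) T'(1) xy(1)] by (simp add: averagesD)
      also have "\<dots> = T x \<oplus> T' y"
        using averagesD(5)[OF T(1), of "T' y"] averagesD(5)[OF T'(1), of "T x"] T T' KF
        by (simp add: subset_iff)
      finally have "T (T' (x \<oplus> y)) \<in> ?K" using K(3) T T' by simp
      then show ?thesis using xy averages_comp[OF T(1) T'(1)] unfolding V_def by force
    qed
  qed (auto simp: V_def)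
  have "word \<mu> g \<nu> \<in> V" for \<mu> g \<nu>
  proof (cases "\<mu> = \<nu>")
    case True
    obtain n \<kappa> where "\<mu> + \<kappa> = repeat_mset n all_edges" by (rule ex_path_complement)
    then have "word \<mu> g \<nu> = gen n (g * path_factor m \<kappa>)"
      using word_shift[of \<mu> \<kappa> g \<mu>] True by (simp add: gen_eq)
    then show ?thesis using id_averages GK unfolding V_def by force
  next
    case False
    then obtain t where t: "t \<in> torus" "gauge_weight t \<mu> \<nu> = -1" by (rule ex_gauge_weight_minus_one)
    have "word \<mu> g \<nu> \<oplus> \<gamma> t (word \<mu> g \<nu>) = \<zero>"
      using csmult_add_left[of "word \<mu> g \<nu>" 1 "-1"] t by (simp add: gauge_action(2))
    then have "(1/2) \<odot> (word \<mu> g \<nu> \<oplus> \<gamma> t (word \<mu> g \<nu>)) \<in> ?K" using K(2) by simp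
    then show ?thesis using half_averages[OF t(1)] unfolding V_def by force
  qed
  then have span: "lin_span A words \<subseteq> V" by (intro lin_span_minimal V) auto
  show "fixed \<subseteq> ?K"
  proof
    fix x assume x: "x \<in> fixed"
    then have xA: "x \<in> carrier A" by (rule fixed_closed)
    show "x \<in> ?K"
    proof (rule K(6)[OF xA])
      fix e :: real assume "e > 0"
      moreover have "words \<subseteq> carrier A" by auto
      ultimately obtain y where y: "y \<in> lin_span A words" "cnorm A (x \<ominus> y) < e"
        using closed_span_approx[of words x e] xA closed_span_words by blast
      then obtain T where T: "T \<in> averages" "T y \<in> ?K" and yA: "y \<in> carrier A"
        using span by (auto simp: V_def)
      have "x \<ominus> T y = T (x \<ominus> y)"
        using bounded_semilinear_minus[OF cstar_algebra_axioms cstar_algebra_axioms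
            averages_bounded_semilinear[OF T(1)] xA yA] averagesD(5)[OF T(1) x] by simp
      then have "cnorm A (x \<ominus> T y) < e"
        using averagesD(4)[OF T(1), of "x \<ominus> y"] xA yA y by simp
      then show "\<exists>z\<in>?K. cnorm A (x \<ominus> z) < e" using T by blast
    qed
  qed
qed

section \<open>The stages and their direct limit\<close>

definition stage :: "nat \<Rightarrow> 'a set"
  where "stage n = closed_span A (range (gen n))"

lemma stage_algebra_eq: "stage_algebra A u s n = A\<lparr>carrier := stage n\<rparr>"
  by (simp add: stage_algebra_def stage_def)

lemma closed_subspace_stage: "closed_subspace A (stage n)"
  unfolding stage_def by (rule closed_subspace_closed_span) auto

lemma gen_stage: "gen n p \<in> stage n"
  unfolding stage_def by (rule subsetD[OF closed_span_subset]) auto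

lemma star_subalgebra_stage: "star_subalgebra A (stage n)"
  unfolding stage_def
  by (rule star_subalgebra_closed_span) (auto simp: gen_mult star_gen)

lemma cstar_algebra_stage: "cstar_algebra (A\<lparr>carrier := stage n\<rparr>)"
  using cstar_algebra_subalgebra star_subalgebra_stage closed_subspace_stage
  by (simp add: closed_subspace_def)

lemma stage_subset_Suc: "stage n \<subseteq> stage (Suc n)"
  unfolding stage_def[of n]
  by (rule closed_span_minimal[OF closed_subspace_stage]) (auto simp: gen_Suc[of n] gen_stage)

lemma stage_mono: "n \<le> k \<Longrightarrow> stage n \<subseteq> stage k"
  using stage_subset_Suc by (rule lift_Suc_mono_le)

lemma stage_subset_fixed: "stage n \<subseteq> fixed"
  unfolding stage_def
  by (rule closed_span_minimal[OF closed_subspace_fixed]) (use gen_fixed in auto)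

lemma star_subalgebra_Union_stage: "star_subalgebra A (\<Union>n. stage n)"
proof -
  have D: "star_subalgebra A (stage n)" for n by (rule star_subalgebra_stage)
  note C = closed_subspaceD[OF closed_subspace_stage]
  have both: "\<exists>k. x \<in> stage k \<and> y \<in> stage k" if xy: "x \<in> (\<Union>n. stage n)" "y \<in> (\<Union>n. stage n)" for x y
  proof -
    obtain i j where "x \<in> stage i" "y \<in> stage j" using xy by auto
    then show ?thesis using stage_mono[of i "max i j"] stage_mono[of j "max i j"] by auto
  qed
  have "submodule (\<Union>n. stage n) complex_ring A"
  proof (rule submodule_complexI)
    fix x y assume "x \<in> (\<Union>n. stage n)" "y \<in> (\<Union>n. stage n)"
    from both[OF this] obtain k where "x \<in> stage k" "y \<in> stage k" by blast
    then show "x \<oplus> y \<in> (\<Union>n. stage n)" using C(3) by blast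
  next
    show "(\<Union>n. stage n) \<subseteq> carrier A" using C(1) by blast
    show "\<zero> \<in> (\<Union>n. stage n)" using C(2) by blast
    show "c \<odot> x \<in> (\<Union>n. stage n)" if "x \<in> (\<Union>n. stage n)" for c x using that C(4) by auto
  qed
  moreover have "x \<otimes> y \<in> (\<Union>n. stage n)" if xy: "x \<in> (\<Union>n. stage n)" "y \<in> (\<Union>n. stage n)" for x y
  proof -
    obtain k where "x \<in> stage k" "y \<in> stage k" using both[OF xy] by blast
    then show ?thesis using D[of k] by (auto simp: star_subalgebra_def)
  qed
  moreover have "star A x \<in> (\<Union>n. stage n)" if xU: "x \<in> (\<Union>n. stage n)" for x
  proof -
    obtain k where "x \<in> stage k" using xU by blast
    then have "star A x \<in> stage k" using D[of k] by (auto simp: star_subalgebra_def)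
    then show ?thesis by blast
  qed
  ultimately show ?thesis by (simp add: star_subalgebra_def del: UN_iff)
qed

lemma Union_stage_dense:
  assumes "x \<in> fixed" "e > 0"
  shows "\<exists>y\<in>(\<Union>n. stage n). cnorm A (x \<ominus> y) < e"
proof -
  have "submodule (\<Union>n. stage n) complex_ring A"
    using star_subalgebra_Union_stage by (simp add: star_subalgebra_def)
  then have "lin_span A (\<Union>n. range (gen n)) \<subseteq> (\<Union>n. stage n)"
    by (rule lin_span_minimal) (use gen_stage in blast)
  moreover have "\<exists>y\<in>lin_span A (\<Union>n. range (gen n)). cnorm A (x \<ominus> y) < e"
    by (rule closed_span_approx) (use assms in \<open>auto simp flip: fixed_eq_closed_span\<close>)
  ultimately show ?thesis by blast
qed

text \<open>The compatible maps glue to a homomorphism on the union of the stages, which is dense in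
  \<open>fixed\<close>; being contractive there, it extends uniquely.\<close>

lemma fixed_universal:
  fixes B :: "'b cstar_alg"
  assumes B: "cstar_algebra B" and \<psi>: "\<And>n. \<psi> n \<in> star_hom (A\<lparr>carrier := stage n\<rparr>) B"
    and comp: "\<And>n x. x \<in> stage n \<Longrightarrow> \<psi> (Suc n) x = \<psi> n x"
  shows "\<exists>!h. h \<in> star_hom (A\<lparr>carrier := fixed\<rparr>) B \<and> h \<in> extensional fixed \<and>
    (\<forall>n. \<forall>x\<in>stage n. h x = \<psi> n x)"
proof -
  let ?D = "\<Union>n. stage n"
  have comp_le: "\<psi> k x = \<psi> n x" if "n \<le> k" "x \<in> stage n" for n k x
    using that
  proof (induction k rule: dec_induct)
    case (step k)
    then have "x \<in> stage k" using stage_mono[of n k] by auto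
    then show ?case using comp step by simp
  qed simp
  have comp': "\<psi> k x = \<psi> n x" if "x \<in> stage n" "x \<in> stage k" for n k x
    using comp_le[of n k x] comp_le[of k n x] that by (cases n k rule: le_cases) auto
  \<comment> \<open>The selected stage is immaterial by \<open>comp'\<close>.\<close>
  define f where "f x = \<psi> (SOME n. x \<in> stage n) x" for x
  have f: "f x = \<psi> n x" if "x \<in> stage n" for n x
    unfolding f_def by (rule comp'[OF that]) (rule someI[of _ n], fact)
  note \<psi>D = star_homD[OF \<psi>, simplified]
  note C = closed_subspaceD[OF closed_subspace_stage]
  have S: "x \<otimes> y \<in> stage n" "star A x \<in> stage n" if "x \<in> stage n" "y \<in> stage n" for x y n
    using star_subalgebra_stage[of n] that by (auto simp: star_subalgebra_def)
  have both: "\<exists>k. x \<in> stage k \<and> y \<in> stage k" if xy: "x \<in> ?D" "y \<in> ?D" for x y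
  proof -
    obtain i j where "x \<in> stage i" "y \<in> stage j" using xy by auto
    then show ?thesis using stage_mono[of i "max i j"] stage_mono[of j "max i j"] by auto
  qed
  have fhom: "f \<in> star_hom (A\<lparr>carrier := ?D\<rparr>) B"
  proof -
    have 1: "f x \<in> carrier B" "f (c \<odot> x) = c \<odot>\<^bsub>B\<^esub> f x" "f (star A x) = star B (f x)" if xD: "x \<in> ?D" for c x
    proof -
      obtain n where n: "x \<in> stage n" using xD by auto
      show "f x \<in> carrier B" "f (c \<odot> x) = c \<odot>\<^bsub>B\<^esub> f x" "f (star A x) = star B (f x)"
        using \<psi>D(1,4,5)[OF n] f[OF n] f[OF C(4)[OF n]] f[OF S(2)[OF n n]] by auto
    qed
    have 2: "f (x \<oplus> y) = f x \<oplus>\<^bsub>B\<^esub> f y" "f (x \<otimes> y) = f x \<otimes>\<^bsub>B\<^esub> f y" if xy: "x \<in> ?D" "y \<in> ?D" for x y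
    proof -
      obtain n where n: "x \<in> stage n" "y \<in> stage n" using both[OF xy] by blast
      show "f (x \<oplus> y) = f x \<oplus>\<^bsub>B\<^esub> f y" "f (x \<otimes> y) = f x \<otimes>\<^bsub>B\<^esub> f y"
        using \<psi>D(2,3)[OF n] f[OF n(1)] f[OF n(2)] f[OF C(3)[OF n]] f[OF S(1)[OF n]] by auto
    qed
    show ?thesis by (rule star_homI) (use 1 2 in \<open>simp_all del: UN_iff\<close>)
  qed
  \<comment> \<open>The union of the stages need not be complete, so contractivity is taken from a
    single stage containing x.\<close>
  have contr: "cnorm B (f x) \<le> cnorm A x" if xD: "x \<in> ?D" for x
  proof -
    obtain n where n: "x \<in> stage n" using xD by auto
    then show ?thesis
      using star_hom_contractive[OF cstar_algebra_stage B \<psi>, of x n] f[OF n] by simp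
  qed
  have DF: "?D \<subseteq> fixed" using stage_subset_fixed by auto
  obtain h where h: "h \<in> star_hom (A\<lparr>carrier := fixed\<rparr>) B" "h \<in> extensional fixed"
    "\<And>x. x \<in> ?D \<Longrightarrow> h x = f x"
    using star_hom_extend[OF cstar_algebra_axioms B star_subalgebra_Union_stage
        star_subalgebra_fixed DF Union_stage_dense fhom contr] by blast
  show ?thesis
  proof (intro ex1I[of _ h] conjI allI ballI)
    show "h x = \<psi> n x" if "x \<in> stage n" for n x
    proof -
      have "x \<in> ?D" using that by blast
      then show ?thesis using h(3) f[OF that] by simp
    qed
    fix h' assume h': "h' \<in> star_hom (A\<lparr>carrier := fixed\<rparr>) B \<and> h' \<in> extensional fixed \<and>
      (\<forall>n. \<forall>x\<in>stage n. h' x = \<psi> n x)"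
    show "h' = h"
    proof (rule extensionalityI[of _ fixed])
      fix x assume x: "x \<in> fixed"
      show "h' x = h x"
      proof (rule star_hom_unique_extension[OF cstar_algebra_axioms B, of ?D fixed])
        show "submodule ?D complex_ring A"
          using star_subalgebra_Union_stage by (simp add: star_subalgebra_def)
        show "\<exists>y\<in>?D \<inter> fixed. cnorm A (x \<ominus> y) < e" if "x \<in> fixed" "e > 0" for x e
          using Union_stage_dense[OF that] DF by auto
        show "h' x = h x" if "x \<in> ?D \<inter> fixed" for x
          using that h' h(3) f by auto
      qed (use h h' x star_subalgebra_fixed closed_subspace_fixed in
          \<open>auto simp: closed_subspace_def\<close>)
    qed (use h h' in auto)
  qed (use h in auto)
qed

lemma direct_limit_fixed:
  "cstar_direct_limit TYPE('b) (stage_algebra A u s) (\<lambda>n x. x) (gauge_fixed_algebra A u s) (\<lambda>n x. x)"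
  unfolding cstar_direct_limit_def stage_algebra_eq gauge_fixed_algebra_eq
proof (intro conjI allI impI)
  fix n
  show "(\<lambda>x. x) \<in> star_hom (A\<lparr>carrier := stage n\<rparr>) (A\<lparr>carrier := stage (Suc n)\<rparr>)"
    "(\<lambda>x. x) \<in> star_hom (A\<lparr>carrier := stage n\<rparr>) (A\<lparr>carrier := fixed\<rparr>)"
    using stage_subset_Suc[of n] stage_subset_fixed[of n] by (auto simp: star_hom_def)
next
  fix B :: "'b cstar_alg" and \<psi>
  assume "cstar_algebra B \<and> (\<forall>n. \<psi> n \<in> star_hom (A\<lparr>carrier := stage n\<rparr>) B) \<and>
    (\<forall>n. \<forall>x\<in>carrier (A\<lparr>carrier := stage n\<rparr>). \<psi> (Suc n) x = \<psi> n x)"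
  then show "\<exists>!h. h \<in> star_hom (A\<lparr>carrier := fixed\<rparr>) B \<and>
      h \<in> extensional (carrier (A\<lparr>carrier := fixed\<rparr>)) \<and>
      (\<forall>n. \<forall>x\<in>carrier (A\<lparr>carrier := stage n\<rparr>). h x = \<psi> n x)"
    using fixed_universal[of B \<psi>] by simp
qed (auto simp: cstar_algebra_stage cstar_algebra_fixed)

end

section \<open>Matrix algebras as targets of representations\<close>

definition mat_vec :: "'i set \<Rightarrow> ('i \<Rightarrow> 'i \<Rightarrow> complex) \<Rightarrow> ('i \<Rightarrow> complex) \<Rightarrow> 'i \<Rightarrow> complex"
  where "mat_vec I a v = (\<lambda>i. \<Sum>j\<in>I. a i j * v j)"

text \<open>Vectors are arbitrary functions on the index type and only coordinates in I are
  measured, so this is a seminorm.\<close>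

definition vec_norm :: "'i set \<Rightarrow> ('i \<Rightarrow> complex) \<Rightarrow> real"
  where "vec_norm I v = L2_set (\<lambda>i. cmod (v i)) I"

definition mat_norm :: "'i set \<Rightarrow> ('i \<Rightarrow> 'i \<Rightarrow> complex) \<Rightarrow> real"
  where "mat_norm I a = (SUP v\<in>{v. vec_norm I v \<le> 1}. vec_norm I (mat_vec I a v))"

definition mat_mult :: "'i set \<Rightarrow> ('i \<Rightarrow> 'i \<Rightarrow> complex) \<Rightarrow> ('i \<Rightarrow> 'i \<Rightarrow> complex) \<Rightarrow> 'i \<Rightarrow> 'i \<Rightarrow> complex"
  where "mat_mult I a b = (\<lambda>i j. \<Sum>k\<in>I. a i k * b k j)"

definition mat_adj :: "('i \<Rightarrow> 'i \<Rightarrow> complex) \<Rightarrow> 'i \<Rightarrow> 'i \<Rightarrow> complex"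
  where "mat_adj a = (\<lambda>i j. cnj (a j i))"

definition matrix_algebra :: "'i set \<Rightarrow> ('i \<Rightarrow> 'i \<Rightarrow> complex) cstar_alg"
  where "matrix_algebra I = \<lparr>carrier = {a. \<forall>i j. i \<notin> I \<or> j \<notin> I \<longrightarrow> a i j = 0},
    mult = mat_mult I, one = (\<lambda>i j. if i \<in> I \<and> i = j then 1 else 0), zero = (\<lambda>_ _. 0),
    add = (\<lambda>a b i j. a i j + b i j), smult = (\<lambda>c a i j. c * a i j), star = mat_adj,
    cnorm = mat_norm I\<rparr>"

lemma matrix_algebra_simps [simp]:
  "a \<in> carrier (matrix_algebra I) \<longleftrightarrow> (\<forall>i j. i \<notin> I \<or> j \<notin> I \<longrightarrow> a i j = 0)"
  "a \<otimes>\<^bsub>matrix_algebra I\<^esub> b = mat_mult I a b"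
  "\<one>\<^bsub>matrix_algebra I\<^esub> = (\<lambda>i j. if i \<in> I \<and> i = j then 1 else 0)"
  "\<zero>\<^bsub>matrix_algebra I\<^esub> = (\<lambda>_ _. 0)"
  "a \<oplus>\<^bsub>matrix_algebra I\<^esub> b = (\<lambda>i j. a i j + b i j)"
  "c \<odot>\<^bsub>matrix_algebra I\<^esub> a = (\<lambda>i j. c * a i j)"
  "star (matrix_algebra I) = mat_adj" "cnorm (matrix_algebra I) = mat_norm I"
  by (simp_all add: matrix_algebra_def)

lemma mat_mult_assoc:
  assumes "finite I"
  shows "mat_mult I (mat_mult I a b) c = mat_mult I a (mat_mult I b c)"
proof (intro ext)
  fix i j
  have "mat_mult I (mat_mult I a b) c i j = (\<Sum>k\<in>I. \<Sum>l\<in>I. a i l * (b l k * c k j))"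
    by (simp add: mat_mult_def sum_distrib_right mult.assoc)
  also have "\<dots> = (\<Sum>l\<in>I. \<Sum>k\<in>I. a i l * (b l k * c k j))" by (rule sum.swap)
  also have "\<dots> = mat_mult I a (mat_mult I b c) i j" by (simp add: mat_mult_def sum_distrib_left)
  finally show "mat_mult I (mat_mult I a b) c i j = mat_mult I a (mat_mult I b c) i j" .
qed

lemma mat_vec_mult:
  assumes "finite I"
  shows "mat_vec I (mat_mult I a b) v = mat_vec I a (mat_vec I b v)"
proof
  fix i
  have "mat_vec I (mat_mult I a b) v i = (\<Sum>k\<in>I. \<Sum>l\<in>I. a i l * (b l k * v k))"
    by (simp add: mat_vec_def mat_mult_def sum_distrib_right mult.assoc)
  also have "\<dots> = (\<Sum>l\<in>I. \<Sum>k\<in>I. a i l * (b l k * v k))" by (rule sum.swap)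
  also have "\<dots> = mat_vec I a (mat_vec I b v) i" by (simp add: mat_vec_def sum_distrib_left)
  finally show "mat_vec I (mat_mult I a b) v i = mat_vec I a (mat_vec I b v) i" .
qed

lemma vec_norm_nonneg [simp]: "0 \<le> vec_norm I v"
  by (simp add: vec_norm_def)

lemma vec_norm_smult: "vec_norm I (\<lambda>i. c * v i) = cmod c * vec_norm I v"
  by (simp add: vec_norm_def norm_mult L2_set_right_distrib)

lemma vec_norm_add: "vec_norm I (\<lambda>i. v i + w i) \<le> vec_norm I v + vec_norm I w"
proof -
  have "vec_norm I (\<lambda>i. v i + w i) \<le> L2_set (\<lambda>i. cmod (v i) + cmod (w i)) I"
    unfolding vec_norm_def by (intro L2_set_mono norm_triangle_ineq) auto
  also have "\<dots> \<le> vec_norm I v + vec_norm I w" unfolding vec_norm_def by (rule L2_set_triangle_ineq)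
  finally show ?thesis .
qed

lemma cmod_le_vec_norm: "\<lbrakk>finite I; i \<in> I\<rbrakk> \<Longrightarrow> cmod (v i) \<le> vec_norm I v"
  unfolding vec_norm_def by (rule member_le_L2_set)

lemma mat_vec_smult: "mat_vec I a (\<lambda>i. c * v i) = (\<lambda>i. c * mat_vec I a v i)"
  by (simp add: mat_vec_def sum_distrib_left mult.left_commute)

text \<open>A crude bound with two uses: it makes the supremum in \<open>mat_norm\<close> finite,
  and it turns entrywise convergence into convergence in norm.\<close>

lemma mat_vec_le_entries:
  assumes "finite I"
  shows "vec_norm I (mat_vec I a v) \<le> (\<Sum>i\<in>I. \<Sum>j\<in>I. cmod (a i j)) * vec_norm I v"
proof -
  have "vec_norm I (mat_vec I a v) \<le> (\<Sum>i\<in>I. cmod (mat_vec I a v i))"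
    unfolding vec_norm_def by (rule L2_set_le_sum) auto
  also have "\<dots> \<le> (\<Sum>i\<in>I. (\<Sum>j\<in>I. cmod (a i j)) * vec_norm I v)"
  proof (rule sum_mono)
    fix i
    have "cmod (mat_vec I a v i) \<le> (\<Sum>j\<in>I. cmod (a i j * v j))"
      unfolding mat_vec_def by (rule norm_sum)
    also have "\<dots> \<le> (\<Sum>j\<in>I. cmod (a i j) * vec_norm I v)"
      using assms by (intro sum_mono) (simp add: norm_mult mult_left_mono cmod_le_vec_norm)
    finally show "cmod (mat_vec I a v i) \<le> (\<Sum>j\<in>I. cmod (a i j)) * vec_norm I v"
      by (simp add: sum_distrib_right)
  qed
  finally show ?thesis by (simp add: sum_distrib_right)
qed

lemma mat_norm_upper:
  assumes "\<And>v. vec_norm I (mat_vec I a v) \<le> C * vec_norm I v" "0 \<le> C"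
  shows "mat_norm I a \<le> C"
  unfolding mat_norm_def
proof (rule cSUP_least)
  have "vec_norm I (\<lambda>_. 0) = 0" by (simp add: vec_norm_def L2_set_0')
  then show "{v. vec_norm I v \<le> 1} \<noteq> {}" by (metis (mono_tags) empty_Collect_eq zero_le_one)
  fix v assume "v \<in> {v. vec_norm I v \<le> 1}"
  then have "C * vec_norm I v \<le> C * 1" using assms(2) by (intro mult_left_mono) auto
  then show "vec_norm I (mat_vec I a v) \<le> C" using assms(1)[of v] by linarith
qed

lemma mat_vec_le_mat_norm:
  assumes "finite I"
  shows "vec_norm I (mat_vec I a v) \<le> mat_norm I a * vec_norm I v"
proof -
  have bdd: "bdd_above ((\<lambda>v. vec_norm I (mat_vec I a v)) ` {v. vec_norm I v \<le> 1})"
  proof (rule bdd_aboveI2)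
    fix v assume "v \<in> {v. vec_norm I v \<le> 1}"
    then have "(\<Sum>i\<in>I. \<Sum>j\<in>I. cmod (a i j)) * vec_norm I v \<le> (\<Sum>i\<in>I. \<Sum>j\<in>I. cmod (a i j)) * 1"
      by (intro mult_left_mono sum_nonneg) auto
    then show "vec_norm I (mat_vec I a v) \<le> (\<Sum>i\<in>I. \<Sum>j\<in>I. cmod (a i j))"
      using mat_vec_le_entries[OF assms, of a v] by linarith
  qed
  show ?thesis
  proof (cases "vec_norm I v = 0")
    case True
    \<comment> \<open>A vector of seminorm zero cannot be normalised, but the entry bound forces its
      image to have seminorm zero as well.\<close>
    then show ?thesis using mat_vec_le_entries[OF assms, of a v] by simp
  next
    case False
    define c where "c = complex_of_real (1 / vec_norm I v)"
    have c: "cmod c = 1 / vec_norm I v" by (simp add: c_def norm_divide)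
    have "vec_norm I (\<lambda>i. c * v i) \<le> 1" using False by (simp add: vec_norm_smult c)
    then have "vec_norm I (mat_vec I a (\<lambda>i. c * v i)) \<le> mat_norm I a"
      unfolding mat_norm_def by (intro cSUP_upper bdd) auto
    then have "(1 / vec_norm I v) * vec_norm I (mat_vec I a v) \<le> mat_norm I a"
      by (simp only: mat_vec_smult vec_norm_smult c)
    moreover have "0 < vec_norm I v" using False vec_norm_nonneg[of I v] by linarith
    ultimately show ?thesis by (simp add: divide_le_eq)
  qed
qed

lemma mat_norm_le_entries: "finite I \<Longrightarrow> mat_norm I a \<le> (\<Sum>i\<in>I. \<Sum>j\<in>I. cmod (a i j))"
  by (rule mat_norm_upper) (auto intro!: mat_vec_le_entries sum_nonneg)

lemma entry_le_mat_norm: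
  assumes "finite I" "i \<in> I" "j \<in> I"
  shows "cmod (a i j) \<le> mat_norm I a"
proof -
  define v where "v = (\<lambda>k. if k = j then 1 else 0 :: complex)"
  have "mat_vec I a v i = (\<Sum>k\<in>I. if k = j then a i k else 0)"
    unfolding mat_vec_def by (rule sum.cong) (auto simp: v_def)
  also have "\<dots> = a i j" using assms by simp
  finally have "mat_vec I a v i = a i j" .
  moreover have "vec_norm I v = 1"
  proof -
    have "(\<Sum>k\<in>I. (cmod (v k))\<^sup>2) = (\<Sum>k\<in>I. if k = j then 1 else 0)"
      by (rule sum.cong) (auto simp: v_def)
    then show ?thesis using assms by (simp add: vec_norm_def L2_set_def)
  qed
  ultimately show ?thesis
    using cmod_le_vec_norm[of I i "mat_vec I a v"] mat_vec_le_mat_norm[of I a v] assms by simp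
qed

lemma mat_norm_nonneg: "finite I \<Longrightarrow> I \<noteq> {} \<Longrightarrow> 0 \<le> mat_norm I a"
  using entry_le_mat_norm[of I _ _ a] by (meson ex_in_conv norm_ge_zero order_trans)

lemma mat_norm_add:
  assumes "finite I" "I \<noteq> {}"
  shows "mat_norm I (\<lambda>i j. a i j + b i j) \<le> mat_norm I a + mat_norm I b"
proof (rule mat_norm_upper)
  fix v
  have "mat_vec I (\<lambda>i j. a i j + b i j) v = (\<lambda>i. mat_vec I a v i + mat_vec I b v i)"
    by (simp add: mat_vec_def sum.distrib distrib_right)
  then show "vec_norm I (mat_vec I (\<lambda>i j. a i j + b i j) v) \<le> (mat_norm I a + mat_norm I b) * vec_norm I v"
    using vec_norm_add[of I "mat_vec I a v" "mat_vec I b v"] mat_vec_le_mat_norm[OF assms(1), of a v]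
      mat_vec_le_mat_norm[OF assms(1), of b v] by (simp add: distrib_right)
qed (use mat_norm_nonneg[OF assms] in auto)

lemma mat_norm_smult:
  assumes "finite I" "I \<noteq> {}"
  shows "mat_norm I (\<lambda>i j. c * a i j) = cmod c * mat_norm I a"
proof -
  have le: "mat_norm I (\<lambda>i j. c * a i j) \<le> cmod c * mat_norm I a" for c a
  proof (rule mat_norm_upper)
    fix v
    have "mat_vec I (\<lambda>i j. c * a i j) v = (\<lambda>i. c * mat_vec I a v i)"
      by (simp add: mat_vec_def sum_distrib_left mult.assoc)
    then show "vec_norm I (mat_vec I (\<lambda>i j. c * a i j) v) \<le> cmod c * mat_norm I a * vec_norm I v"
      using mat_vec_le_mat_norm[OF assms(1), of a v]
      by (simp add: vec_norm_smult mult.assoc mult_left_mono)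
  qed (use mat_norm_nonneg[OF assms] in auto)
  show ?thesis
  proof (cases "c = 0")
    case True
    then show ?thesis using le[of 0 a] mat_norm_nonneg[OF assms, of "\<lambda>i j. c * a i j"] by simp
  next
    case False
    have "mat_norm I a \<le> cmod (1 / c) * mat_norm I (\<lambda>i j. c * a i j)"
      using le[of "1 / c" "\<lambda>i j. c * a i j"] False by simp
    then have "cmod c * mat_norm I a \<le> mat_norm I (\<lambda>i j. c * a i j)"
      using False by (simp add: norm_divide field_simps)
    then show ?thesis using le[of c a] by simp
  qed
qed

lemma mat_norm_mult:
  assumes "finite I" "I \<noteq> {}"
  shows "mat_norm I (mat_mult I a b) \<le> mat_norm I a * mat_norm I b"
proof (rule mat_norm_upper)
  fix v
  have "vec_norm I (mat_vec I (mat_mult I a b) v) \<le> mat_norm I a * vec_norm I (mat_vec I b v)"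
    by (simp add: mat_vec_mult[OF assms(1)] mat_vec_le_mat_norm[OF assms(1)])
  also have "\<dots> \<le> mat_norm I a * (mat_norm I b * vec_norm I v)"
    using assms by (intro mult_left_mono mat_vec_le_mat_norm mat_norm_nonneg)
  finally show "vec_norm I (mat_vec I (mat_mult I a b) v) \<le> mat_norm I a * mat_norm I b * vec_norm I v"
    by (simp add: mult.assoc)
qed (use mat_norm_nonneg[OF assms] in auto)

text \<open>The adjoint relation in coordinates: the inner product of a v with itself is that of v
  with the matrix star a times a applied to v.\<close>

lemma vec_norm_square_adj:
  assumes "finite I"
  shows "complex_of_real ((vec_norm I (mat_vec I a v))\<^sup>2) =
    (\<Sum>j\<in>I. cnj (v j) * mat_vec I (mat_mult I (mat_adj a) a) v j)"
proof -
  let ?w = "mat_vec I a v"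
  have "complex_of_real ((vec_norm I ?w)\<^sup>2) = (\<Sum>i\<in>I. cnj (?w i) * ?w i)"
    by (simp add: vec_norm_def L2_set_def sum_nonneg complex_norm_square mult.commute
        flip: of_real_power)
  also have "\<dots> = (\<Sum>i\<in>I. \<Sum>j\<in>I. cnj (v j) * (cnj (a i j) * ?w i))"
    by (simp add: mat_vec_def[of I a v] sum_distrib_right mult.assoc mult.left_commute)
  also have "\<dots> = (\<Sum>j\<in>I. \<Sum>i\<in>I. cnj (v j) * (cnj (a i j) * ?w i))" by (rule sum.swap)
  also have "\<dots> = (\<Sum>j\<in>I. cnj (v j) * mat_vec I (mat_adj a) ?w j)"
    unfolding mat_vec_def[of I "mat_adj a"] by (simp add: mat_adj_def sum_distrib_left)
  finally show ?thesis by (simp add: mat_vec_mult[OF assms])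
qed

text \<open>Cauchy-Schwarz applied to the adjoint relation gives the inequality \<open>sq\<close>.
  With submultiplicativity it shows that taking adjoints preserves the norm, and submultiplicativity
  then gives the reverse inequality.\<close>

lemma mat_norm_cstar:
  assumes "finite I" "I \<noteq> {}"
  shows "mat_norm I (mat_mult I (mat_adj a) a) = (mat_norm I a)\<^sup>2"
proof -
  have sq: "(mat_norm I b)\<^sup>2 \<le> mat_norm I (mat_mult I (mat_adj b) b)" for b
  proof -
    let ?c = "mat_mult I (mat_adj b) b"
    have c0: "0 \<le> mat_norm I ?c" by (rule mat_norm_nonneg[OF assms])
    have "mat_norm I b \<le> sqrt (mat_norm I ?c)"
    proof (rule mat_norm_upper)
      fix v
      have "(vec_norm I (mat_vec I b v))\<^sup>2 = cmod (complex_of_real ((vec_norm I (mat_vec I b v))\<^sup>2))"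
        by (simp only: norm_of_real abs_power2)
      also have "\<dots> = cmod (\<Sum>j\<in>I. cnj (v j) * mat_vec I ?c v j)"
        by (simp only: vec_norm_square_adj[OF assms(1)])
      also have "\<dots> \<le> (\<Sum>j\<in>I. \<bar>cmod (v j)\<bar> * \<bar>cmod (mat_vec I ?c v j)\<bar>)"
        by (rule order_trans[OF norm_sum]) (simp add: norm_mult)
      also have "\<dots> \<le> vec_norm I v * vec_norm I (mat_vec I ?c v)"
        unfolding vec_norm_def by (rule L2_set_mult_ineq)
      also have "\<dots> \<le> vec_norm I v * (mat_norm I ?c * vec_norm I v)"
        by (intro mult_left_mono mat_vec_le_mat_norm assms) auto
      also have "\<dots> = (sqrt (mat_norm I ?c) * vec_norm I v)\<^sup>2"
        using c0 by (simp add: power_mult_distrib power2_eq_square)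
      finally show "vec_norm I (mat_vec I b v) \<le> sqrt (mat_norm I ?c) * vec_norm I v"
        by (rule power2_le_imp_le) (use c0 in auto)
    qed (use c0 in auto)
    then have "(mat_norm I b)\<^sup>2 \<le> (sqrt (mat_norm I ?c))\<^sup>2"
      using mat_norm_nonneg[OF assms] by (intro power_mono) auto
    then show ?thesis using c0 by simp
  qed
  have adj: "mat_norm I b \<le> mat_norm I (mat_adj b)" for b
  proof (cases "mat_norm I b = 0")
    case False
    have "mat_norm I b * mat_norm I b \<le> mat_norm I (mat_adj b) * mat_norm I b"
      using sq[of b] mat_norm_mult[OF assms, of "mat_adj b" b] by (simp add: power2_eq_square)
    then show ?thesis using False mat_norm_nonneg[OF assms, of b] by simp
  qed (use mat_norm_nonneg[OF assms] in simp)
  have "mat_norm I (mat_adj a) \<le> mat_norm I a"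
    using adj[of "mat_adj a"] by (simp add: mat_adj_def)
  then have "mat_norm I (mat_mult I (mat_adj a) a) \<le> (mat_norm I a)\<^sup>2"
    using mat_norm_mult[OF assms, of "mat_adj a" a] mat_norm_nonneg[OF assms, of a]
      mult_right_mono[of "mat_norm I (mat_adj a)" "mat_norm I a" "mat_norm I a"]
    by (simp add: power2_eq_square)
  then show ?thesis using sq[of a] by simp
qed

lemma abelian_group_matrix_algebra: "abelian_group (matrix_algebra I)"
proof (rule abelian_groupI)
  fix x assume "x \<in> carrier (matrix_algebra I)"
  then show "\<exists>y\<in>carrier (matrix_algebra I).
      y \<oplus>\<^bsub>matrix_algebra I\<^esub> x = \<zero>\<^bsub>matrix_algebra I\<^esub>"
    by (intro bexI[of _ "\<lambda>i j. - x i j"]) auto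
qed (auto simp: algebra_simps)

lemma matrix_algebra_minus:
  assumes "a \<in> carrier (matrix_algebra I)" "b \<in> carrier (matrix_algebra I)"
  shows "a \<ominus>\<^bsub>matrix_algebra I\<^esub> b = (\<lambda>i j. a i j - b i j)"
proof -
  interpret abelian_group "matrix_algebra I" by (rule abelian_group_matrix_algebra)
  have "\<ominus>\<^bsub>matrix_algebra I\<^esub> b = (\<lambda>i j. - b i j)"
    using assms by (intro minus_equality) auto
  then show ?thesis by (simp add: a_minus_def)
qed

lemma mat_norm_eq_zero:
  assumes "finite I" "I \<noteq> {}" "a \<in> carrier (matrix_algebra I)"
  shows "mat_norm I a = 0 \<longleftrightarrow> a = (\<lambda>_ _. 0)"
proof
  assume 0: "mat_norm I a = 0"
  show "a = (\<lambda>_ _. 0)"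
  proof (intro ext)
    fix i j show "a i j = 0"
      using entry_le_mat_norm[OF assms(1), of i j a] 0 assms(3) by (cases "i \<in> I \<and> j \<in> I") auto
  qed
qed (use mat_norm_smult[OF assms(1,2), of 0 a] in simp)

lemma ring_matrix_algebra:
  assumes "finite I"
  shows "ring (matrix_algebra I)"
proof (rule ringI)
  have one: "mat_mult I (\<lambda>i j. if i \<in> I \<and> i = j then 1 else 0) x = x"
    "mat_mult I x (\<lambda>i j. if i \<in> I \<and> i = j then 1 else 0) = x"
    if x: "x \<in> carrier (matrix_algebra I)" for x
  proof -
    have "(\<Sum>k\<in>I. (if i \<in> I \<and> i = k then 1 else 0) * x k j) = (\<Sum>k\<in>I. if i = k then x k j else 0)"
      "(\<Sum>k\<in>I. x i k * (if k \<in> I \<and> k = j then 1 else 0)) = (\<Sum>k\<in>I. if k = j then x i k else 0)" for i j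
      by (auto intro!: sum.cong)
    then show "mat_mult I (\<lambda>i j. if i \<in> I \<and> i = j then 1 else 0) x = x"
      "mat_mult I x (\<lambda>i j. if i \<in> I \<and> i = j then 1 else 0) = x"
      using x assms by (auto simp: mat_mult_def fun_eq_iff)
  qed
  show "Group.monoid (matrix_algebra I)"
    by (rule monoidI) (use one in \<open>auto simp: mat_mult_assoc[OF assms]\<close>, auto simp: mat_mult_def)
qed (auto simp: abelian_group_matrix_algebra mat_mult_def algebra_simps sum.distrib)

text \<open>Each entry is dominated by the norm and the norm by the sum of the entries, so
  everything reduces to finitely many Cauchy sequences of complex numbers.\<close>

lemma mat_norm_complete:
  assumes "finite I" "I \<noteq> {}"
  and \<sigma>: "\<And>n::nat. \<sigma> n \<in> carrier (matrix_algebra I)"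
  and cau: "\<And>e. e > 0 \<Longrightarrow> \<exists>N. \<forall>n n'. N \<le> n \<longrightarrow> N \<le> n' \<longrightarrow> mat_norm I (\<lambda>i j. \<sigma> n i j - \<sigma> n' i j) < e"
  shows "\<exists>l\<in>carrier (matrix_algebra I). \<forall>e>0. \<exists>N. \<forall>n\<ge>N. mat_norm I (\<lambda>i j. \<sigma> n i j - l i j) < e"
proof -
  have "Cauchy (\<lambda>n. \<sigma> n i j)" for i j
  proof (cases "i \<in> I \<and> j \<in> I")
    case True
    show ?thesis
    proof (rule metric_CauchyI)
      fix e :: real assume "e > 0"
      then obtain N where N: "\<And>n n'. N \<le> n \<Longrightarrow> N \<le> n' \<Longrightarrow> mat_norm I (\<lambda>i j. \<sigma> n i j - \<sigma> n' i j) < e"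
        using cau by blast
      have "dist (\<sigma> n i j) (\<sigma> n' i j) < e" if "N \<le> n" "N \<le> n'" for n n'
        using N[OF that] entry_le_mat_norm[of I i j "\<lambda>i j. \<sigma> n i j - \<sigma> n' i j"] True assms(1)
        by (simp add: dist_norm)
      then show "\<exists>N. \<forall>m\<ge>N. \<forall>n\<ge>N. dist (\<sigma> m i j) (\<sigma> n i j) < e" by blast
    qed
  next
    case False
    then show ?thesis using \<sigma> by (simp add: Cauchy_def)
  qed
  then have "\<exists>l. (\<lambda>n. \<sigma> n i j) \<longlonglongrightarrow> l" for i j
    using convergent_eq_Cauchy by blast
  then obtain l where l: "\<And>i j. (\<lambda>n. \<sigma> n i j) \<longlonglongrightarrow> l i j" by metis
  have "l i j = 0" if "i \<notin> I \<or> j \<notin> I" for i j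
    using l[of i j] \<sigma> that by (simp add: LIMSEQ_const_iff)
  moreover have "(\<lambda>n. \<Sum>i\<in>I. \<Sum>j\<in>I. cmod (\<sigma> n i j - l i j)) \<longlonglongrightarrow> (\<Sum>i\<in>I. \<Sum>j\<in>I. cmod (l i j - l i j))"
    by (intro tendsto_intros l)
  then have "\<exists>N. \<forall>n\<ge>N. (\<Sum>i\<in>I. \<Sum>j\<in>I. cmod (\<sigma> n i j - l i j)) < e" if "e > 0" for e
    using that order_tendstoD(2)[of _ 0 sequentially e] by (simp add: eventually_sequentially)
  then have "\<forall>e>0. \<exists>N. \<forall>n\<ge>N. mat_norm I (\<lambda>i j. \<sigma> n i j - l i j) < e"
    using mat_norm_le_entries[OF assms(1)] by (meson order_le_less_trans)
  ultimately show ?thesis by (intro bexI[of _ l]) auto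
qed

lemma unital_cstar_algebra_matrix_algebra:
  fixes I :: "'i set"
  assumes I: "finite I" "I \<noteq> {}"
  shows "unital_cstar_algebra (matrix_algebra I)"
proof -
  let ?M = "matrix_algebra I"
  have mod: "Module.module complex_ring ?M"
    by (rule moduleI[OF cring_complex_ring abelian_group_matrix_algebra]) (auto simp: algebra_simps)
  have cd: "cdist ?M a b = mat_norm I (\<lambda>i j. a i j - b i j)"
    if "a \<in> carrier ?M" "b \<in> carrier ?M" for a b
    using that by (simp add: cdist_def matrix_algebra_minus matrix_algebra_simps(8) del: matrix_algebra_simps(1))
  have ms: "Metric_space (carrier ?M) (cdist ?M)"
  proof
    show "0 \<le> cdist ?M a b" for a b
      by (cases "a \<in> carrier ?M \<and> b \<in> carrier ?M")
        (use cd mat_norm_nonneg[OF I] in \<open>auto simp del: matrix_algebra_simps\<close>, auto simp: cdist_def)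
    show "cdist ?M a b = cdist ?M b a" for a b
    proof (cases "a \<in> carrier ?M \<and> b \<in> carrier ?M")
      case True
      then show ?thesis
        using mat_norm_smult[OF I, of "-1" "\<lambda>i j. b i j - a i j"] cd[of a b] cd[of b a]
        by (simp add: algebra_simps)
    qed (auto simp: cdist_def)
    fix a b c assume abc: "a \<in> carrier ?M" "b \<in> carrier ?M" "c \<in> carrier ?M"
    have "(\<lambda>i j. a i j - b i j) \<in> carrier ?M" using abc by auto
    from mat_norm_eq_zero[OF I this] show "cdist ?M a b = 0 \<longleftrightarrow> a = b"
      unfolding cd[OF abc(1,2)] by (auto simp: fun_eq_iff)
    show "cdist ?M a c \<le> cdist ?M a b + cdist ?M b c"
      using mat_norm_add[OF I, of "\<lambda>i j. a i j - b i j" "\<lambda>i j. b i j - c i j"]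
      unfolding cd[OF abc(1,2)] cd[OF abc(1,3)] cd[OF abc(2,3)] by simp
  qed
  have complete: "Metric_space.mcomplete (carrier ?M) (cdist ?M)"
    unfolding Metric_space_mcomplete_iff[OF ms]
  proof (intro allI impI)
    fix \<sigma> :: "nat \<Rightarrow> 'i \<Rightarrow> 'i \<Rightarrow> complex"
    assume \<sigma>: "\<forall>n. \<sigma> n \<in> carrier ?M"
      and cau: "\<forall>e>0. \<exists>N. \<forall>n n'. N \<le> n \<longrightarrow> N \<le> n' \<longrightarrow> cdist ?M (\<sigma> n) (\<sigma> n') < e"
    have "\<exists>l\<in>carrier ?M. \<forall>e>0. \<exists>N. \<forall>n\<ge>N. mat_norm I (\<lambda>i j. \<sigma> n i j - l i j) < e"
      by (rule mat_norm_complete[OF I]) (use \<sigma> cau cd in \<open>auto simp del: matrix_algebra_simps\<close>)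
    then show "\<exists>l\<in>carrier ?M. \<forall>e>0. \<exists>N. \<forall>n\<ge>N. cdist ?M (\<sigma> n) l < e"
      using cd \<sigma> by (auto simp del: matrix_algebra_simps)
  qed
  have "cstar_algebra ?M"
  proof (intro cstar_algebra.intro mod cstar_algebra_axioms.intro complete)
    fix a b c :: "'i \<Rightarrow> 'i \<Rightarrow> complex" and d :: complex
    assume a: "a \<in> carrier ?M"
    show "cnorm ?M a = 0 \<longleftrightarrow> a = \<zero>\<^bsub>?M\<^esub>" using mat_norm_eq_zero[OF I a] by simp
    show "cnorm ?M (star ?M a \<otimes>\<^bsub>?M\<^esub> a) = (cnorm ?M a)\<^sup>2"
      by (simp add: mat_norm_cstar[OF I])
    show "0 \<le> cnorm ?M a" using mat_norm_nonneg[OF I] by simp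
    show "cnorm ?M (d \<odot>\<^bsub>?M\<^esub> a) = cmod d * cnorm ?M a" using mat_norm_smult[OF I] by simp
    assume b: "b \<in> carrier ?M"
    show "cnorm ?M (a \<otimes>\<^bsub>?M\<^esub> b) \<le> cnorm ?M a * cnorm ?M b" using mat_norm_mult[OF I] by simp
    show "cnorm ?M (a \<oplus>\<^bsub>?M\<^esub> b) \<le> cnorm ?M a + cnorm ?M b" using mat_norm_add[OF I] by simp
    assume "c \<in> carrier ?M"
    show "(a \<otimes>\<^bsub>?M\<^esub> b) \<otimes>\<^bsub>?M\<^esub> c = a \<otimes>\<^bsub>?M\<^esub> (b \<otimes>\<^bsub>?M\<^esub> c)" by (simp add: mat_mult_assoc[OF I(1)])
  qed (auto simp: mat_mult_def mat_adj_def algebra_simps sum.distrib sum_distrib_left)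
  moreover have "\<one>\<^bsub>?M\<^esub> \<noteq> \<zero>\<^bsub>?M\<^esub>" using I(2) by (auto simp: fun_eq_iff)
  ultimately show ?thesis
    using ring_matrix_algebra[OF I(1)]
    by (intro unital_cstar_algebra.intro unital_cstar_algebra_axioms.intro)
qed

section \<open>Moving algebras along injections\<close>

definition transport :: "('a \<Rightarrow> 'b) \<Rightarrow> 'a cstar_alg \<Rightarrow> 'b cstar_alg"
  where "transport e A = (let d = inv_into (carrier A) e in
    \<lparr>carrier = e ` carrier A, mult = (\<lambda>x y. e (d x \<otimes>\<^bsub>A\<^esub> d y)), one = e \<one>\<^bsub>A\<^esub>, zero = e \<zero>\<^bsub>A\<^esub>,
     add = (\<lambda>x y. e (d x \<oplus>\<^bsub>A\<^esub> d y)), smult = (\<lambda>c x. e (c \<odot>\<^bsub>A\<^esub> d x)),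
     star = (\<lambda>x. e (star A (d x))), cnorm = (\<lambda>x. cnorm A (d x))\<rparr>)"

lemma transport_simps:
  assumes "inj_on e (carrier A)"
  shows "carrier (transport e A) = e ` carrier A"
    and "\<lbrakk>x \<in> carrier A; y \<in> carrier A\<rbrakk> \<Longrightarrow> e x \<otimes>\<^bsub>transport e A\<^esub> e y = e (x \<otimes>\<^bsub>A\<^esub> y)"
    and "\<one>\<^bsub>transport e A\<^esub> = e \<one>\<^bsub>A\<^esub>" "\<zero>\<^bsub>transport e A\<^esub> = e \<zero>\<^bsub>A\<^esub>"
    and "\<lbrakk>x \<in> carrier A; y \<in> carrier A\<rbrakk> \<Longrightarrow> e x \<oplus>\<^bsub>transport e A\<^esub> e y = e (x \<oplus>\<^bsub>A\<^esub> y)"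
    and "x \<in> carrier A \<Longrightarrow> c \<odot>\<^bsub>transport e A\<^esub> e x = e (c \<odot>\<^bsub>A\<^esub> x)"
    and "x \<in> carrier A \<Longrightarrow> star (transport e A) (e x) = e (star A x)"
    and "x \<in> carrier A \<Longrightarrow> cnorm (transport e A) (e x) = cnorm A x"
  using assms by (simp_all add: transport_def Let_def)

lemma unital_cstar_algebra_transport:
  assumes A: "unital_cstar_algebra A" and e: "inj_on e (carrier A)"
  shows "unital_cstar_algebra (transport e A)"
proof -
  interpret A: unital_cstar_algebra A by fact
  note one = unital_cstar_algebra_one[OF A]
  let ?T = "transport e A"
  note ts = transport_simps[OF e]
  have e_eq: "e x = e y \<longleftrightarrow> x = y" if "x \<in> carrier A" "y \<in> carrier A" for x y
    using e that by (auto dest: inj_onD)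
  have ab: "abelian_group ?T"
  proof (rule abelian_groupI)
    fix x assume "x \<in> carrier ?T"
    then obtain a where "a \<in> carrier A" "x = e a" by (auto simp: ts)
    then show "\<exists>y\<in>carrier ?T. y \<oplus>\<^bsub>?T\<^esub> x = \<zero>\<^bsub>?T\<^esub>"
      by (intro bexI[of _ "e (\<ominus>\<^bsub>A\<^esub> a)"]) (auto simp: ts A.M.l_neg)
  qed (auto simp: ts A.M.a_ac)
  interpret T: abelian_group ?T by fact
  have rg: "ring ?T"
  proof (rule ringI[OF ab])
    show "Group.monoid ?T" by (rule monoidI) (auto simp: ts one A.cmult_assoc A.cmult_closed)
  qed (auto simp: ts A.l_distrib A.r_distrib A.cmult_closed)
  have mod: "Module.module complex_ring ?T"
    by (rule moduleI[OF cring_complex_ring ab])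
      (auto simp: ts A.csmult_add_left A.csmult_add_right A.csmult_csmult)
  have minus: "e a \<ominus>\<^bsub>?T\<^esub> e b = e (a \<ominus>\<^bsub>A\<^esub> b)" if "a \<in> carrier A" "b \<in> carrier A" for a b
  proof -
    have "\<ominus>\<^bsub>?T\<^esub> e b = e (\<ominus>\<^bsub>A\<^esub> b)" by (rule T.minus_equality) (use that in \<open>auto simp: ts A.M.l_neg\<close>)
    then show ?thesis using that by (simp add: a_minus_def ts)
  qed
  have cd: "cdist ?T (e a) (e b) = cdist A a b" if "a \<in> carrier A" "b \<in> carrier A" for a b
    using that by (simp add: cdist_def ts minus)
  have ms: "Metric_space (carrier ?T) (cdist ?T)"
  proof
    show "0 \<le> cdist ?T x y" for x y
      by (cases "x \<in> carrier ?T \<and> y \<in> carrier ?T") (auto simp: ts cd, auto simp: cdist_def ts)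
    show "cdist ?T x y = cdist ?T y x" for x y
      by (cases "x \<in> carrier ?T \<and> y \<in> carrier ?T")
        (auto simp: ts cd A.met.commute, auto simp: cdist_def ts)
  qed (auto simp: ts cd e_eq A.met.triangle)
  have complete: "Metric_space.mcomplete (carrier ?T) (cdist ?T)"
    unfolding Metric_space_mcomplete_iff[OF ms]
  proof (intro allI impI)
    fix \<sigma> :: "nat \<Rightarrow> 'b" assume \<sigma>: "\<forall>n. \<sigma> n \<in> carrier ?T"
      and cau: "\<forall>\<epsilon>>0. \<exists>N. \<forall>n n'. N \<le> n \<longrightarrow> N \<le> n' \<longrightarrow> cdist ?T (\<sigma> n) (\<sigma> n') < \<epsilon>"
    have "\<forall>n. \<exists>a. a \<in> carrier A \<and> \<sigma> n = e a" using \<sigma> by (auto simp: ts)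
    then obtain \<tau> where \<tau>: "\<And>n. \<tau> n \<in> carrier A" "\<And>n. \<sigma> n = e (\<tau> n)" by metis
    obtain l where "l \<in> carrier A" "\<forall>\<epsilon>>0. \<exists>N. \<forall>n\<ge>N. cdist A (\<tau> n) l < \<epsilon>"
      using A.norm_complete[unfolded Metric_space_mcomplete_iff[OF A.met.Metric_space_axioms],
          THEN spec, of \<tau>] cau \<tau> by (auto simp: cd)
    then show "\<exists>l\<in>carrier ?T. \<forall>\<epsilon>>0. \<exists>N. \<forall>n\<ge>N. cdist ?T (\<sigma> n) l < \<epsilon>"
      by (intro bexI[of _ "e l"]) (auto simp: \<tau> cd ts)
  qed
  have "cstar_algebra ?T"
    by (intro cstar_algebra.intro mod cstar_algebra_axioms.intro complete)
      (auto simp: ts e_eq A.cmult_assoc A.cmult_closed A.star_closed A.l_distrib A.r_distrib A.smult_mult_left A.smult_mult_right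
        A.star_star A.star_add A.star_smult A.star_mult A.cnorm_nonneg A.cnorm_eq_zero
        A.cnorm_triangle A.cnorm_smult A.cnorm_mult A.cstar_identity)
  moreover have "\<one>\<^bsub>?T\<^esub> \<noteq> \<zero>\<^bsub>?T\<^esub>" using A.one_neq_zero by (simp add: ts e_eq one)
  ultimately show ?thesis using rg
    by (intro unital_cstar_algebra.intro unital_cstar_algebra_axioms.intro)
qed

text \<open>One coordinate at a time is packed into the code of the others by a bijection between
  pairs of complex numbers and complex numbers, which exists by cardinal arithmetic.\<close>

lemma ex_inj_finite_support:
  assumes "finite J"
  shows "\<exists>e :: ('j \<Rightarrow> complex) \<Rightarrow> complex. inj_on e {f. \<forall>x. x \<notin> J \<longrightarrow> f x = 0}"
  using assms
proof induction
  case empty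
  show ?case by (auto simp: inj_on_def fun_eq_iff)
next
  case (insert y J)
  then obtain e :: "('j \<Rightarrow> complex) \<Rightarrow> complex" where e: "inj_on e {f. \<forall>x. x \<notin> J \<longrightarrow> f x = 0}" by blast
  have "\<exists>p :: complex \<times> complex \<Rightarrow> complex. bij_betw p (UNIV \<times> UNIV) UNIV"
    using card_of_Times_same_infinite[OF infinite_UNIV_char_0] card_of_ordIso by blast
  then obtain p :: "complex \<times> complex \<Rightarrow> complex" where p: "inj p" by (auto simp: bij_betw_def)
  have "inj_on (\<lambda>f. p (f y, e (f(y := 0)))) {f. \<forall>x. x \<notin> insert y J \<longrightarrow> f x = 0}"
  proof (rule inj_onI)
    fix f g :: "'j \<Rightarrow> complex"
    assume f: "f \<in> {f. \<forall>x. x \<notin> insert y J \<longrightarrow> f x = 0}" and g: "g \<in> {f. \<forall>x. x \<notin> insert y J \<longrightarrow> f x = 0}"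
      and eq: "p (f y, e (f(y := 0))) = p (g y, e (g(y := 0)))"
    have "f y = g y" "e (f(y := 0)) = e (g(y := 0))" using injD[OF p eq] by auto
    moreover have "f(y := 0) = g(y := 0)"
      by (rule inj_onD[OF e]) (use calculation f g in auto)
    ultimately show "f = g" by (metis fun_upd_triv fun_upd_upd)
  qed
  then show ?case by blast
qed

text \<open>The multiples of the nonzero unit are a copy of the complex numbers inside the type of
  \<open>A\<close>, and a matrix supported on a finite square is coded by one complex
  number.\<close>

lemma (in graph_algebra) ex_inj_matrix_algebra:
  assumes "finite I"
  shows "\<exists>e :: ('i \<Rightarrow> 'i \<Rightarrow> complex) \<Rightarrow> 'a. inj_on e (carrier (matrix_algebra I))"
proof -
  obtain e :: "('i \<times> 'i \<Rightarrow> complex) \<Rightarrow> complex" where e: "inj_on e {f. \<forall>x. x \<notin> I \<times> I \<longrightarrow> f x = 0}"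
    using ex_inj_finite_support[of "I \<times> I"] assms by blast
  have inj_c: "inj (\<lambda>c. c \<odot> \<one>)"
  proof (rule injI)
    fix c d :: complex assume "c \<odot> \<one> = d \<odot> \<one>"
    then have "(c - d) \<odot> \<one> = \<zero>"
      using csmult_add_left[of \<one> c "- d"] csmult_add_left[of \<one> d "- d"] by simp
    then have "cmod (c - d) * cnorm A \<one> = 0" using cnorm_smult[of \<one> "c - d"] by simp
    then show "c = d" using cnorm_eq_zero[of \<one>] one_neq_zero by auto
  qed
  have "inj_on (\<lambda>a. e (case_prod a)) (carrier (matrix_algebra I))"
  proof (rule inj_onI)
    fix a b assume "a \<in> carrier (matrix_algebra I)" "b \<in> carrier (matrix_algebra I)"
      "e (case_prod a) = e (case_prod b)"
    then have "case_prod a = case_prod b" by (intro inj_onD[OF e]) auto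
    then show "a = b" by (metis curry_case_prod)
  qed
  then have "inj_on (\<lambda>a. e (case_prod a) \<odot> \<one>) (carrier (matrix_algebra I))"
    using inj_c by (auto simp: inj_on_def)
  then show ?thesis by blast
qed

text \<open>Universality yields a homomorphism into the transported copy of the matrices, and the
  inverse of the injection leads back to the matrices themselves.\<close>

lemma (in graph_algebra) ex_hom_matrix_algebra:
  fixes I :: "'i set"
  assumes I: "finite I" "I \<noteq> {}" and fam: "graph_family m (matrix_algebra I) U S"
  shows "\<exists>\<phi>\<in>unital_star_hom A (matrix_algebra I). (\<forall>g. \<phi> (u g) = U g) \<and> (\<forall>\<mu>. \<phi> (s \<mu>) = S \<mu>)"
proof -
  let ?M = "matrix_algebra I"
  have M: "unital_cstar_algebra ?M" using I by (rule unital_cstar_algebra_matrix_algebra)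
  interpret M: unital_cstar_algebra ?M by (rule M)
  obtain e :: "('i \<Rightarrow> 'i \<Rightarrow> complex) \<Rightarrow> 'a" where e: "inj_on e (carrier ?M)"
    using ex_inj_matrix_algebra[OF I(1)] by blast
  note ts = transport_simps[OF e]
  have US: "U g \<in> carrier ?M" "S \<mu> \<in> carrier ?M" for g \<mu>
    using fam unfolding graph_family_def is_unitary_def is_isometry_def by blast+
  have "graph_family m (transport e ?M) (\<lambda>g. e (U g)) (\<lambda>\<mu>. e (S \<mu>))"
    using fam US unfolding graph_family_def is_unitary_def is_isometry_def
    by (simp add: ts M.star_closed M.cmult_closed del: matrix_algebra_simps)
  from universal_hom[OF unital_cstar_algebra_transport[OF M e] this]
  obtain \<phi> where \<phi>: "\<phi> \<in> star_hom A (transport e ?M)" "\<phi> \<one> = e \<one>\<^bsub>?M\<^esub>"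
    "\<And>g. \<phi> (u g) = e (U g)" "\<And>\<mu>. \<phi> (s \<mu>) = e (S \<mu>)"
    by (auto simp: unital_star_hom_def ts simp del: matrix_algebra_simps)
  define d where "d = inv_into (carrier ?M) e"
  have d: "d (e x) = x" if "x \<in> carrier ?M" for x using that e by (simp add: d_def)
  have \<phi>e: "\<exists>y. y \<in> carrier ?M \<and> \<phi> x = e y" if "x \<in> carrier A" for x
    using star_homD(1)[OF \<phi>(1) that] by (auto simp: ts simp del: matrix_algebra_simps)
  have hom: "(\<lambda>x. d (\<phi> x)) \<in> star_hom A ?M"
  proof (rule star_homI)
    fix x y c assume x: "x \<in> carrier A"
    obtain x' where x': "x' \<in> carrier ?M" "\<phi> x = e x'" using \<phi>e[OF x] by blast
    show "d (\<phi> x) \<in> carrier ?M" by (simp only: x' d)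
    show "d (\<phi> (c \<odot> x)) = c \<odot>\<^bsub>?M\<^esub> d (\<phi> x)"
      by (simp only: star_homD[OF \<phi>(1)] x x' ts d M.csmult_closed)
    show "d (\<phi> (star A x)) = star ?M (d (\<phi> x))"
      by (simp only: star_homD[OF \<phi>(1)] x x' ts d M.star_closed)
    assume y: "y \<in> carrier A"
    obtain y' where y': "y' \<in> carrier ?M" "\<phi> y = e y'" using \<phi>e[OF y] by blast
    show "d (\<phi> (x \<oplus> y)) = d (\<phi> x) \<oplus>\<^bsub>?M\<^esub> d (\<phi> y)" "d (\<phi> (x \<otimes> y)) = d (\<phi> x) \<otimes>\<^bsub>?M\<^esub> d (\<phi> y)"
      by (simp_all only: star_homD[OF \<phi>(1)] x x' y y' ts d M.M.a_closed M.cmult_closed)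
  qed
  show ?thesis
    by (rule bexI[of _ "\<lambda>x. d (\<phi> x)"])
      (use hom \<phi> US in \<open>simp_all only: unital_star_hom_def mem_Collect_eq d unital_cstar_algebra_one(1)[OF M] simp_thms\<close>)
qed

section \<open>The spectrum of the fixed point algebra\<close>

definition monomial_matrix :: "'i set \<Rightarrow> ('i \<Rightarrow> 'i) \<Rightarrow> ('i \<Rightarrow> complex) \<Rightarrow> 'i \<Rightarrow> 'i \<Rightarrow> complex"
  where "monomial_matrix I f c = (\<lambda>i j. if j \<in> I \<and> i = f j then c j else 0)"

lemma monomial_matrix_mult:
  assumes "finite I" "\<And>j. j \<in> I \<Longrightarrow> g j \<in> I"
  shows "mat_mult I (monomial_matrix I f c) (monomial_matrix I g d) =
    monomial_matrix I (\<lambda>j. f (g j)) (\<lambda>j. c (g j) * d j)"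
proof (intro ext)
  fix i j
  have "mat_mult I (monomial_matrix I f c) (monomial_matrix I g d) i j =
      (\<Sum>k\<in>I. if k = g j then (if j \<in> I \<and> i = f k then c k * d j else 0) else 0)"
    unfolding mat_mult_def by (rule sum.cong) (auto simp: monomial_matrix_def)
  also have "\<dots> = monomial_matrix I (\<lambda>j. f (g j)) (\<lambda>j. c (g j) * d j) i j"
    using assms by (auto simp: monomial_matrix_def)
  finally show "mat_mult I (monomial_matrix I f c) (monomial_matrix I g d) i j =
    monomial_matrix I (\<lambda>j. f (g j)) (\<lambda>j. c (g j) * d j) i j" .
qed

lemma monomial_matrix_adj:
  assumes "\<And>j. j \<in> I \<Longrightarrow> f j \<in> I \<and> f' j \<in> I \<and> f (f' j) = j \<and> f' (f j) = j"
  shows "mat_adj (monomial_matrix I f c) = monomial_matrix I f' (\<lambda>j. cnj (c (f' j)))"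
proof (intro ext)
  fix i j
  have "i \<in> I \<and> j = f i \<longleftrightarrow> j \<in> I \<and> i = f' j" using assms by metis
  then show "mat_adj (monomial_matrix I f c) i j = monomial_matrix I f' (\<lambda>j. cnj (c (f' j))) i j"
    by (auto simp: mat_adj_def monomial_matrix_def)
qed

lemma monomial_matrix_cong:
  "(\<And>j. j \<in> I \<Longrightarrow> f j = g j \<and> c j = d j) \<Longrightarrow> monomial_matrix I f c = monomial_matrix I g d"
  by (auto simp: monomial_matrix_def fun_eq_iff)

lemma monomial_matrix_carrier:
  "(\<And>j. j \<in> I \<Longrightarrow> f j \<in> I) \<Longrightarrow> monomial_matrix I f c \<in> carrier (matrix_algebra I)"
  by (auto simp: monomial_matrix_def)

lemma monomial_matrix_one: "monomial_matrix I (\<lambda>j. j) (\<lambda>_. 1) = \<one>\<^bsub>matrix_algebra I\<^esub>"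
  by (auto simp: monomial_matrix_def fun_eq_iff)

section \<open>Powers and density of roots of unity\<close>

lemma root_of_unity_powi:
  fixes z :: complex
  assumes "z ^ N = 1" "N > 0"
  shows "z \<noteq> 0" "(z powi k) ^ N = 1" "[k = l] (mod int N) \<Longrightarrow> z powi k = z powi l"
proof -
  show z: "z \<noteq> 0" using assms by (auto simp: power_0_left)
  show "(z powi k) ^ N = 1"
    using assms by (metis power_int_1_left power_int_commutes power_int_mult power_int_of_nat mult.commute)
  assume "[k = l] (mod int N)"
  then obtain q where "k = l + int N * q" by (metis cong_iff_lin cong_sym)
  then show "z powi k = z powi l"
    using z assms by (simp add: power_int_add power_int_mult)
qed

lemma root_of_unity_powi_inverse:
  fixes z :: complex
  assumes "z ^ N = 1" "N > 0" "[k * l = 1] (mod int N)"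
  shows "(z powi k) powi l = z"
  using root_of_unity_powi(3)[OF assms] by (simp add: power_int_mult)

lemma coprime_path_factor:
  "coprime (\<Prod>i\<in>UNIV. m i) (int N) \<Longrightarrow> coprime (path_factor m \<mu>) (int N)"
  unfolding path_factor_def
  by (metis (no_types, lifting) UNIV_I coprime_power_left_iff finite prod_coprime_left
      coprime_divisors dvd_prodI dvd_refl)

lemma cis_diff_bound: "cmod (cis a - cis b) \<le> \<bar>a - b\<bar>"
proof -
  have "cis a - cis b = cis b * (cis (a - b) - 1)"
    by (simp add: right_diff_distrib cis_mult)
  then have "cmod (cis a - cis b) = cmod (exp (\<i> * complex_of_real (a - b)) - 1)"
    by (simp add: norm_mult cis_conv_exp)
  also have "\<dots> = 2 * \<bar>sin ((a - b) / 2)\<bar>" by (rule dist_exp_i_1)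
  also have "\<dots> \<le> \<bar>a - b\<bar>" using abs_sin_x_le_abs_x[of "(a - b) / 2"] by simp
  finally show ?thesis .
qed

lemma root_of_unity_near:
  fixes z :: complex
  assumes "cmod z = 1" "e > 0" "M \<noteq> 0"
  obtains \<eta> N where "N > 0" "coprime M (int N)" "\<eta> ^ N = 1" "cmod (\<eta> - z) < e"
proof -
  obtain L :: nat where L: "2 * pi / e < real L" using reals_Archimedean2 by blast
  \<comment> \<open>Being 1 modulo M makes \<open>N\<close> coprime to M, and the factor
    \<open>L\<close> makes the arc between neighbouring \<open>N\<close>-th roots shorter than
    e.\<close>
  define N where "N = nat \<bar>M\<bar> * L + 1"
  define \<theta> where "\<theta> = Arg z"
  \<comment> \<open>Rounding down selects the last root of unity before the angle of z.\<close>
  define k where "k = \<lfloor>real N * \<theta> / (2 * pi)\<rfloor>"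
  define \<eta> where "\<eta> = cis (2 * pi * of_int k / real N)"
  have N: "N > 0" by (simp add: N_def)
  have "real L \<le> real N"
  proof -
    have "1 \<le> nat \<bar>M\<bar>" using assms(3) by linarith
    then have "L \<le> nat \<bar>M\<bar> * L" by simp
    then have "L \<le> N" unfolding N_def by linarith
    then show ?thesis by simp
  qed
  have "coprime M (int N)"
  proof -
    have "int N = \<bar>M\<bar> * int L + 1" by (simp add: N_def)
    then have "[int N = 1] (mod M)" by (simp add: cong_iff_dvd_diff)
    then show ?thesis by (metis cong_imp_coprime coprime_1_left coprime_commute cong_sym)
  qed
  moreover have "\<eta> ^ N = 1"
  proof -
    have "\<eta> ^ N = cis (real N * (2 * pi * of_int k / real N))" by (simp only: \<eta>_def Complex.DeMoivre)
    also have "real N * (2 * pi * of_int k / real N) = 2 * pi * of_int k" using N by simp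
    also have "cis (2 * pi * of_int k) = 1" by (rule cis_multiple_2pi) auto
    finally show ?thesis .
  qed
  moreover have "cmod (\<eta> - z) < e"
  proof -
    have z: "z = cis \<theta>" using assms(1) by (metis \<theta>_def cis_Arg norm_zero sgn_eq div_by_1
          of_real_1 zero_neq_one)
    have "cmod (\<eta> - z) \<le> \<bar>2 * pi * of_int k / real N - \<theta>\<bar>"
      unfolding z \<eta>_def by (rule cis_diff_bound)
    also have "2 * pi * of_int k / real N - \<theta> = (of_int k - real N * \<theta> / (2 * pi)) * (2 * pi / real N)"
      using N by (simp add: field_simps)
    also have "\<bar>\<dots>\<bar> = \<bar>of_int k - real N * \<theta> / (2 * pi)\<bar> * (2 * pi / real N)"
      by (simp add: abs_mult)
    also have "\<dots> \<le> 1 * (2 * pi / real N)"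
    proof (rule mult_right_mono)
      show "\<bar>of_int k - real N * \<theta> / (2 * pi)\<bar> \<le> 1" unfolding k_def by linarith
    qed auto
    also have "\<dots> < e"
    proof -
      have "2 * pi / e < real N" using L \<open>real L \<le> real N\<close> by linarith
      then show ?thesis using N assms(2) by (simp add: field_simps)
    qed
    finally show ?thesis .
  qed
  ultimately show thesis using that N by blast
qed

text \<open>Negative exponents do occur, since the m_i may be negative. On the unit circle inversion
  is complex conjugation, an isometry, which reduces them to natural exponents.\<close>

lemma norm_powi_diff:
  fixes z w :: complex
  assumes "cmod z = 1" "cmod w = 1"
  shows "cmod (z powi k - w powi k) \<le> real_of_int \<bar>k\<bar> * cmod (z - w)"
proof (cases "k \<ge> 0")
  case True
  then show ?thesis using norm_power_diff[of z w "nat k"] assms by (simp add: power_int_def)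
next
  case False
  have inv: "inverse v = cnj v" if "cmod v = 1" for v :: complex
    using that complex_norm_square[of v] by (intro inverse_unique) simp
  have "cmod (cnj z ^ nat (- k) - cnj w ^ nat (- k)) \<le> real (nat (- k)) * cmod (cnj z - cnj w)"
    using assms by (intro norm_power_diff) auto
  also have "cmod (cnj z - cnj w) = cmod (z - w)" by (metis complex_cnj_diff complex_mod_cnj)
  finally show ?thesis using False assms by (simp add: power_int_def inv)
qed

lemma int_hom_eq_powi:
  fixes w :: "int \<Rightarrow> complex"
  assumes "w 0 = 1" and add: "\<And>p q. w (p + q) = w p * w q"
  shows "w p = w 1 powi p"
proof -
  have nat: "w (int n) = w 1 ^ n" for n
    by (induction n) (simp_all add: assms mult.commute)
  show ?thesis
  proof (cases p rule: int_cases2)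
    case (nonpos n)
    have "w p * w (int n) = 1" using add[of p "int n"] nonpos assms by simp
    then have "w p = inverse (w (int n))" by (metis inverse_unique mult.commute)
    then show ?thesis using nonpos nat by (simp add: power_int_minus)
  qed (simp add: nat)
qed

lemma continuous_map_complex_mult:
  fixes f g :: "'x \<Rightarrow> complex"
  shows "\<lbrakk>continuous_map X euclidean f; continuous_map X euclidean g\<rbrakk>
    \<Longrightarrow> continuous_map X euclidean (\<lambda>x. f x * g x)"
  by (simp add: continuous_map_atin tendsto_mult)

lemma closedin_Collect_Ball:
  assumes "\<And>i. i \<in> J \<Longrightarrow> closedin X {x \<in> topspace X. P i x}"
  shows "closedin X {x \<in> topspace X. \<forall>i\<in>J. P i x}"
proof (cases "J = {}")
  case False
  then have "{x \<in> topspace X. \<forall>i\<in>J. P i x} = (\<Inter>i\<in>J. {x \<in> topspace X. P i x})" by auto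
  then show ?thesis using assms False by (auto intro: closedin_INT)
qed auto

section \<open>Characters of the fixed point algebra\<close>

context graph_algebra
begin

abbreviation "F \<equiv> A\<lparr>carrier := fixed\<rparr>"

lemma one_fixed: "\<one> \<in> fixed"
  using gen_fixed[of 0 0] by simp

lemma cnorm_one: "cnorm A \<one> = 1"
proof -
  have "(cnorm A \<one>)\<^sup>2 = cnorm A \<one>" using cstar_identity[of \<one>] by simp
  then show ?thesis using cnorm_eq_zero[of \<one>] one_neq_zero by (simp add: power2_eq_square)
qed

lemma cnorm_gen: "cnorm A (gen n p) = 1"
proof -
  have "(cnorm A (gen n p))\<^sup>2 = 1"
    using cstar_identity[of "gen n p"] by (simp add: star_gen gen_mult cnorm_one)
  then show ?thesis using cnorm_nonneg[of "gen n p"] by (simp add: power2_eq_1_iff)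
qed

lemma charactersD:
  assumes "\<xi> \<in> characters F"
  shows "\<xi> \<in> extensional fixed"
    and "\<lbrakk>x \<in> fixed; y \<in> fixed\<rbrakk> \<Longrightarrow> \<xi> (x \<oplus> y) = \<xi> x + \<xi> y"
    and "\<lbrakk>x \<in> fixed; y \<in> fixed\<rbrakk> \<Longrightarrow> \<xi> (x \<otimes> y) = \<xi> x * \<xi> y"
    and "x \<in> fixed \<Longrightarrow> \<xi> (c \<odot> x) = c * \<xi> x"
    and "\<xi> \<one> = 1"
    and "x \<in> fixed \<Longrightarrow> cmod (\<xi> x) \<le> cnorm A x"
proof -
  show *: "\<xi> \<in> extensional fixed"
    "\<lbrakk>x \<in> fixed; y \<in> fixed\<rbrakk> \<Longrightarrow> \<xi> (x \<oplus> y) = \<xi> x + \<xi> y"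
    "\<lbrakk>x \<in> fixed; y \<in> fixed\<rbrakk> \<Longrightarrow> \<xi> (x \<otimes> y) = \<xi> x * \<xi> y"
    "x \<in> fixed \<Longrightarrow> \<xi> (c \<odot> x) = c * \<xi> x" for x y c
    using assms by (auto simp: characters_def)
  obtain w where w: "w \<in> fixed" "\<xi> w \<noteq> 0" using assms by (auto simp: characters_def)
  then show "\<xi> \<one> = 1" using *(3)[OF w(1) one_fixed] fixed_closed by simp
  show "x \<in> fixed \<Longrightarrow> cmod (\<xi> x) \<le> cnorm A x"
    using cstar_algebra.character_bound[OF cstar_algebra_fixed assms] by simp
qed

lemma charactersI:
  assumes "\<xi> \<in> extensional fixed" "\<xi> \<one> = 1"
    and "\<And>x y. \<lbrakk>x \<in> fixed; y \<in> fixed\<rbrakk> \<Longrightarrow> \<xi> (x \<oplus> y) = \<xi> x + \<xi> y"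
    and "\<And>x y. \<lbrakk>x \<in> fixed; y \<in> fixed\<rbrakk> \<Longrightarrow> \<xi> (x \<otimes> y) = \<xi> x * \<xi> y"
    and "\<And>c x. x \<in> fixed \<Longrightarrow> \<xi> (c \<odot> x) = c * \<xi> x"
  shows "\<xi> \<in> characters F"
  using assms one_fixed by (auto simp: characters_def intro!: bexI[of _ \<one>])

text \<open>Unimodularity is not built into the notion of a character. It follows because the values
  at p and -p have product 1 while neither has modulus above 1, the generators being of norm
  1.\<close>

lemma character_gen:
  assumes "\<xi> \<in> characters F"
  shows "\<xi> (gen n p) = \<xi> (gen n 1) powi p" and "cmod (\<xi> (gen n p)) = 1"
proof -
  note D = charactersD[OF assms]
  show "\<xi> (gen n p) = \<xi> (gen n 1) powi p"
    by (rule int_hom_eq_powi) (simp_all add: D gen_fixed flip: gen_mult)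
  have "\<xi> (gen n p) * \<xi> (gen n (- p)) = 1"
    using D(3)[OF gen_fixed gen_fixed, of n p n "- p"] by (simp add: gen_mult D(5))
  then have "cmod (\<xi> (gen n p)) * cmod (\<xi> (gen n (- p))) = 1" by (metis norm_mult norm_one)
  moreover have "cmod (\<xi> (gen n q)) \<le> 1" for q using D(6)[OF gen_fixed] cnorm_gen by metis
  ultimately show "cmod (\<xi> (gen n p)) = 1"
    by (metis dual_order.antisym mult.right_neutral mult_left_mono norm_ge_zero)
qed

definition solenoid_point :: "('a \<Rightarrow> complex) \<Rightarrow> nat \<Rightarrow> complex"
  where "solenoid_point \<xi> = (\<lambda>n. \<xi> (gen n 1))"

lemma topspace_solenoid:
  "z \<in> topspace (solenoid M) \<longleftrightarrow> (\<forall>n. cmod (z n) = 1 \<and> z n = z (Suc n) powi M)"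
  by (simp add: solenoid_def PiE_UNIV_domain Pi_iff all_conj_distrib)

lemma solenoid_point_in:
  assumes "\<xi> \<in> characters F"
  shows "solenoid_point \<xi> \<in> topspace (solenoid (\<Prod>i\<in>UNIV. m i))"
  unfolding topspace_solenoid solenoid_point_def
  using character_gen[OF assms] gen_Suc[of _ 1] by (metis mult_1)

lemma topspace_spectrum: "topspace (spectrum F) = characters F"
  by (auto simp: spectrum_def characters_def PiE_def)

text \<open>The values at p = 1 determine those at all p, hence on the generators of every stage.
  Agreement spreads to the closed span because characters are bounded by the norm.\<close>

lemma inj_on_solenoid_point: "inj_on solenoid_point (characters F)"
proof (rule inj_onI)
  fix \<xi> \<psi> assume \<xi>: "\<xi> \<in> characters F" and \<psi>: "\<psi> \<in> characters F"
    and eq: "solenoid_point \<xi> = solenoid_point \<psi>"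
  note D = charactersD[OF \<xi>] and E = charactersD[OF \<psi>]
  have gen: "\<xi> (gen n p) = \<psi> (gen n p)" for n p
    unfolding character_gen(1)[OF \<xi>, of n p] character_gen(1)[OF \<psi>, of n p]
    using fun_cong[OF eq, of n] by (simp add: solenoid_point_def)
  note C = closed_subspaceD[OF closed_subspace_fixed]
  let ?V = "{x \<in> fixed. \<xi> x = \<psi> x}"
  have "closed_subspace A ?V"
  proof (rule closed_subspaceI)
    show "?V \<subseteq> carrier A" using fixed_closed by auto
    show "\<zero> \<in> ?V" using C(2) D(4)[OF one_fixed, of 0] E(4)[OF one_fixed, of 0] by simp
    show "x \<oplus> y \<in> ?V" if "x \<in> ?V" "y \<in> ?V" for x y using that C(3) D(2) E(2) by simp
    show "c \<odot> x \<in> ?V" if "x \<in> ?V" for c x using that C(4) D(4) E(4) by simp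
    fix x assume x: "x \<in> carrier A" and ap: "\<And>e. e > 0 \<Longrightarrow> \<exists>y\<in>?V. cnorm A (x \<ominus> y) < e"
    have xF: "x \<in> fixed" using C(6)[OF x] ap by blast
    have "cmod (\<xi> x - \<psi> x) \<le> 2 * e" if "e > 0" for e
    proof -
      obtain y where y: "y \<in> fixed" "\<xi> y = \<psi> y" "cnorm A (x \<ominus> y) < e" using ap[OF \<open>e > 0\<close>] by blast
      have yn: "(-1) \<odot> y \<in> fixed" using C(4) y by simp
      have xy: "x \<ominus> y \<in> fixed" using C(5) xF y by blast
      have "\<xi> x - \<psi> x = \<xi> (x \<ominus> y) - \<psi> (x \<ominus> y)"
        using y xF yn fixed_closed by (simp add: minus_conv_smult D(2,4) E(2,4))
      also have "cmod \<dots> \<le> cmod (\<xi> (x \<ominus> y)) + cmod (\<psi> (x \<ominus> y))" by (rule norm_triangle_ineq4)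
      also have "\<dots> \<le> 2 * e" using D(6)[OF xy] E(6)[OF xy] y by linarith
      finally show ?thesis .
    qed
    then have "cmod (\<xi> x - \<psi> x) \<le> 0" by (intro le_zero_eps) auto
    then show "x \<in> ?V" using xF by simp
  qed
  then have "closed_span A (\<Union>n. range (gen n)) \<subseteq> ?V"
    by (rule closed_span_minimal) (use gen gen_fixed in auto)
  then show "\<xi> = \<psi>"
    by (intro extensionalityI[OF D(1) E(1)]) (auto simp flip: fixed_eq_closed_span)
qed

lemma continuous_map_solenoid_point:
  "continuous_map (spectrum F) (solenoid (\<Prod>i\<in>UNIV. m i)) solenoid_point"
proof -
  have "continuous_map (spectrum F) euclidean (\<lambda>\<xi>. solenoid_point \<xi> n)" for n
    unfolding spectrum_def solenoid_point_def
    by (intro continuous_map_from_subtopology continuous_map_product_projection)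
      (use gen_fixed in simp)
  moreover have "(\<lambda>\<xi>. solenoid_point \<xi> n) \<in> topspace (spectrum F) \<rightarrow> sphere 0 1" for n
    using character_gen(2) by (simp add: topspace_spectrum solenoid_point_def Pi_iff)
  ultimately show ?thesis
    using solenoid_point_in unfolding topspace_solenoid
    unfolding solenoid_def continuous_map_in_subtopology continuous_map_componentwise_UNIV
      topspace_spectrum by blast
qed

text \<open>The Banach-Alaoglu argument: the bound by the norm places the characters in a product of
  closed discs, and they are cut out of it by closed conditions on finitely many coordinates at a
  time.\<close>

lemma compact_space_spectrum: "compact_space (spectrum F)"
proof -
  let ?X = "product_topology (\<lambda>_. euclidean) fixed :: ('a \<Rightarrow> complex) topology"
  let ?K = "PiE fixed (\<lambda>x. cball 0 (cnorm A x))"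
  have K: "compactin ?X ?K" by (simp add: compactin_PiE)
  have sub: "characters F \<subseteq> ?K"
  proof
    fix f assume "f \<in> characters F"
    from charactersD(1,6)[OF this] show "f \<in> ?K" by (simp add: PiE_def)
  qed
  have proj: "continuous_map ?X euclidean (\<lambda>f. f x)" if "x \<in> fixed" for x
    using that by (rule continuous_map_product_projection)
  have const: "continuous_map ?X euclidean (\<lambda>f. c)" for c :: complex
    by simp
  note C = closed_subspaceD[OF closed_subspace_fixed]
  have M: "x \<otimes> y \<in> fixed" if "x \<in> fixed" "y \<in> fixed" for x y
    using star_subalgebra_fixed that by (auto simp: star_subalgebra_def)
  note eq = closedin_continuous_maps_eq[of "euclidean :: complex topology" ?X, OF Hausdorff_space_euclidean]
  \<comment> \<open>Being nonzero is not a closed condition. For a multiplicative functional on a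
    unital algebra it amounts to taking the value 1 at the unit, which is one.\<close>
  have "closedin ?X {f \<in> topspace ?X. f \<one> = 1}"
    by (intro eq proj const one_fixed)
  moreover have "closedin ?X {f \<in> topspace ?X. \<forall>x\<in>fixed. \<forall>y\<in>fixed. f (x \<oplus> y) = f x + f y}"
    by (rule closedin_Collect_Ball, rule closedin_Collect_Ball)
      (intro eq proj continuous_map_add C(3))
  moreover have "closedin ?X {f \<in> topspace ?X. \<forall>x\<in>fixed. \<forall>y\<in>fixed. f (x \<otimes> y) = f x * f y}"
    by (rule closedin_Collect_Ball, rule closedin_Collect_Ball)
      (intro eq proj continuous_map_complex_mult M)
  moreover have "closedin ?X {f \<in> topspace ?X. \<forall>x\<in>fixed. \<forall>c\<in>UNIV. f (c \<odot> x) = c * f x}"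
    by (rule closedin_Collect_Ball, rule closedin_Collect_Ball)
      (intro eq proj const continuous_map_complex_mult C(4))
  ultimately have "closedin ?X ({f \<in> topspace ?X. f \<one> = 1} \<inter>
      {f \<in> topspace ?X. \<forall>x\<in>fixed. \<forall>y\<in>fixed. f (x \<oplus> y) = f x + f y} \<inter>
      {f \<in> topspace ?X. \<forall>x\<in>fixed. \<forall>y\<in>fixed. f (x \<otimes> y) = f x * f y} \<inter>
      {f \<in> topspace ?X. \<forall>x\<in>fixed. \<forall>c\<in>UNIV. f (c \<odot> x) = c * f x})" (is "closedin ?X ?C")
    by (intro closedin_Int)
  also have "?C = characters F"
  proof (intro Set.set_eqI iffI)
    fix f assume "f \<in> ?C"
    then show "f \<in> characters F" by (intro charactersI) (auto simp: PiE_def)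
  next
    fix f assume "f \<in> characters F"
    from charactersD[OF this] show "f \<in> ?C" by (auto simp: PiE_def)
  qed
  finally have "compactin ?X (characters F)" using closed_compactin[OF K sub] by blast
  then show ?thesis by (simp add: spectrum_def compact_space_subtopology)
qed

text \<open>Reading off a diagonal entry is multiplicative on diagonal matrices, and all of
  \<open>fixed\<close> is represented by such, because the generators of the stages are. The
  exponent r inverts M modulo N, so \<open>\<zeta> powi (r ^ n)\<close> is the one M^n-th root of
  \<open>\<zeta>\<close> among the N-th roots of unity; conjugating by the n-th power of all edges
  produces exactly this eigenvalue.\<close>

lemma ex_periodic_character:
  assumes N: "N > 0" and cop: "coprime (\<Prod>i\<in>UNIV. m i) (int N)"
    and r: "[(\<Prod>i\<in>UNIV. m i) * r = 1] (mod int N)" and \<zeta>: "\<zeta> ^ N = 1"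
  shows "\<exists>\<xi>\<in>characters F. \<forall>n. \<xi> (gen n 1) = \<zeta> powi (r ^ n)"
proof -
  define I :: "complex set" where "I = {z. z ^ N = 1}"
  have I: "finite I" "I \<noteq> {}"
    using finite_roots_unity[of N] N by (auto simp: I_def intro: exI[of _ 1])
  let ?M = "matrix_algebra I"
  note powi = root_of_unity_powi[OF _ N]
  have powI: "j powi k \<in> I" if "j \<in> I" for j k using powi(2) that by (simp add: I_def)
  have nz: "j \<noteq> 0" if "j \<in> I" for j using powi(1) that by (simp add: I_def)
  have inverse_pow: "(j powi k) powi l = j" "(j powi l) powi k = j"
    if "j \<in> I" "[k * l = 1] (mod int N)" for j k l
    using root_of_unity_powi_inverse[of j N k l] root_of_unity_powi_inverse[of j N l k] that N
    by (simp_all add: I_def mult.commute)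
  define U where "U g = monomial_matrix I (\<lambda>j. j) (\<lambda>j. j powi g)" for g
  \<comment> \<open>On the basis vector j, both sides of the relation between \<open>u g\<close> and
    \<open>s \<mu>\<close> give j to the power g * \<open>path_factor m \<mu>\<close>, times the
    basis vector j to the power \<open>path_factor m \<mu>\<close>.\<close>
  define S where "S \<mu> = monomial_matrix I (\<lambda>j. j powi path_factor m \<mu>) (\<lambda>_. 1)" for \<mu>
  have adj_S: "mat_adj (S \<mu>) = monomial_matrix I (\<lambda>j. j powi k) (\<lambda>_. 1)"
    if "[path_factor m \<mu> * k = 1] (mod int N)" for \<mu> k
    unfolding S_def using monomial_matrix_adj[of I "\<lambda>j. j powi path_factor m \<mu>" "\<lambda>j. j powi k" "\<lambda>_. 1"]
      powI inverse_pow that by simp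
  have adj_U: "mat_adj (U g) = monomial_matrix I (\<lambda>j. j) (\<lambda>j. cnj (j powi g))" for g
    unfolding U_def by (rule monomial_matrix_adj) auto
  \<comment> \<open>An inverse exponent modulo N makes the power map a permutation of the roots; its
    inverse describes the adjoint of \<open>S \<mu>\<close>.\<close>
  have ex_k: "\<exists>k. [path_factor m \<mu> * k = 1] (mod int N)" for \<mu>
    using coprime_path_factor[OF cop] cong_solve_coprime_int by blast
  have unit_norm: "j powi g * cnj (j powi g) = 1" "cnj (j powi g) * j powi g = 1" if "j \<in> I" for j g
  proof -
    have "cmod (j powi g) = 1"
      using powI[OF that, of g] power_eq_1_iff[of "j powi g" N] N by (simp add: I_def)
    then show "j powi g * cnj (j powi g) = 1" "cnj (j powi g) * j powi g = 1"
      using complex_norm_square[of "j powi g"] by (simp_all add: mult.commute)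
  qed
  have fam: "graph_family m ?M U S"
    unfolding graph_family_def is_unitary_def is_isometry_def
  proof (intro conjI allI)
    show "U g \<in> carrier ?M" "S \<mu> \<in> carrier ?M" for g \<mu>
      unfolding U_def S_def by (intro monomial_matrix_carrier; use powI in simp)+
    show "star ?M (U g) \<otimes>\<^bsub>?M\<^esub> U g = \<one>\<^bsub>?M\<^esub>" "U g \<otimes>\<^bsub>?M\<^esub> star ?M (U g) = \<one>\<^bsub>?M\<^esub>" for g
      unfolding monomial_matrix_one[symmetric] matrix_algebra_simps adj_U
      unfolding U_def using I unit_norm
      by (simp_all add: monomial_matrix_mult cong: monomial_matrix_cong)
    show "star ?M (S \<mu>) \<otimes>\<^bsub>?M\<^esub> S \<mu> = \<one>\<^bsub>?M\<^esub>" "S \<mu> \<otimes>\<^bsub>?M\<^esub> star ?M (S \<mu>) = \<one>\<^bsub>?M\<^esub>" for \<mu>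
    proof -
      obtain k where k: "[path_factor m \<mu> * k = 1] (mod int N)" using ex_k by blast
      show "star ?M (S \<mu>) \<otimes>\<^bsub>?M\<^esub> S \<mu> = \<one>\<^bsub>?M\<^esub>" "S \<mu> \<otimes>\<^bsub>?M\<^esub> star ?M (S \<mu>) = \<one>\<^bsub>?M\<^esub>"
        unfolding monomial_matrix_one[symmetric] matrix_algebra_simps adj_S[OF k]
        unfolding S_def using I powI inverse_pow[OF _ k]
        by (auto simp: monomial_matrix_mult intro!: monomial_matrix_cong)
    qed
    show "U (g + h) = U g \<otimes>\<^bsub>?M\<^esub> U h" for g h
      unfolding U_def matrix_algebra_simps using I nz
      by (auto simp: monomial_matrix_mult power_int_add intro!: monomial_matrix_cong)
    show "S \<mu> \<otimes>\<^bsub>?M\<^esub> S \<nu> = S (\<mu> + \<nu>)" for \<mu> \<nu>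
      unfolding S_def matrix_algebra_simps using I powI
      by (auto simp: monomial_matrix_mult path_factor_add power_int_mult mult.commute[of "path_factor m \<mu>"]
          intro!: monomial_matrix_cong)
    show "U g \<otimes>\<^bsub>?M\<^esub> S \<mu> = S \<mu> \<otimes>\<^bsub>?M\<^esub> U (restriction m g \<mu>)" for g \<mu>
      unfolding S_def U_def matrix_algebra_simps using I powI
      by (auto simp: monomial_matrix_mult restriction_eq power_int_mult mult.commute[of g]
          intro!: monomial_matrix_cong)
  qed
  obtain \<phi> where \<phi>: "\<phi> \<in> star_hom A ?M" "\<phi> \<one> = \<one>\<^bsub>?M\<^esub>" "\<And>g. \<phi> (u g) = U g" "\<And>\<mu>. \<phi> (s \<mu>) = S \<mu>"
    using ex_hom_matrix_algebra[OF I fam] by (auto simp: unital_star_hom_def)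
  note D = star_homD[OF \<phi>(1)]
  have M: "unital_cstar_algebra ?M" using I by (rule unital_cstar_algebra_matrix_algebra)
  interpret M: unital_cstar_algebra ?M by (rule M)
  have \<phi>_gen: "\<phi> (gen n p) = monomial_matrix I (\<lambda>j. j) (\<lambda>j. (j powi (r ^ n)) powi p)" for n p
  proof -
    let ?e = "repeat_mset n all_edges :: 'k path"
    have k: "[path_factor m ?e * r ^ n = 1] (mod int N)"
      using cong_pow[OF r, of n] by (simp add: path_factor_repeat power_mult_distrib)
    have "\<phi> (gen n p) = mat_mult I (mat_mult I (S ?e) (U p)) (mat_adj (S ?e))"
      by (simp add: stage_generator_def D \<phi>)
    also have "\<dots> = monomial_matrix I (\<lambda>j. j) (\<lambda>j. (j powi (r ^ n)) powi p)"
      unfolding adj_S[OF k] unfolding S_def U_def using I powI inverse_pow[OF _ k]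
      by (auto simp: monomial_matrix_mult intro!: monomial_matrix_cong)
    finally show ?thesis .
  qed
  let ?Diag = "{a \<in> carrier ?M. \<forall>i j. i \<noteq> j \<longrightarrow> a i j = 0}"
  have diag: "closed_subspace ?M ?Diag"
  proof (rule M.closed_subspaceI)
    fix a assume a: "a \<in> carrier ?M"
      and ap: "\<And>e. e > 0 \<Longrightarrow> \<exists>b\<in>?Diag. cnorm ?M (a \<ominus>\<^bsub>?M\<^esub> b) < e"
    have "a i j = 0" if "i \<noteq> j" for i j
    proof (cases "i \<in> I \<and> j \<in> I")
      case True
      have "cmod (a i j) \<le> 1 * e" if "e > 0" for e
      proof -
        obtain b where b: "b \<in> ?Diag" "cnorm ?M (a \<ominus>\<^bsub>?M\<^esub> b) < e" using ap[OF \<open>e > 0\<close>] by blast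
        then have "b \<in> carrier ?M" "b i j = 0" using \<open>i \<noteq> j\<close> by blast+
        then have "mat_norm I (\<lambda>i j. a i j - b i j) < e"
          using b(2) matrix_algebra_minus[OF a, of b] by (simp only: matrix_algebra_simps(8))
        then show ?thesis
          using entry_le_mat_norm[OF I(1), of i j "\<lambda>i j. a i j - b i j"] True \<open>b i j = 0\<close> by simp
      qed
      then have "cmod (a i j) \<le> 0" by (intro le_zero_eps) blast
      then show ?thesis by simp
    qed (use a in auto)
    then show "a \<in> ?Diag" using a by blast
  qed auto
  have "closed_subspace A {x \<in> carrier A. \<phi> x \<in> ?Diag}"
    using cstar_algebra_axioms M.cstar_algebra_axioms _ diag
    by (rule closed_subspace_vimage)
      (rule star_hom_bounded_semilinear[OF cstar_algebra_axioms M.cstar_algebra_axioms \<phi>(1)])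
  then have "closed_span A (\<Union>n. range (gen n)) \<subseteq> {x \<in> carrier A. \<phi> x \<in> ?Diag}"
    by (rule closed_span_minimal) (auto simp: \<phi>_gen monomial_matrix_def)
  then have \<phi>_diag: "\<phi> x i j = 0" if "x \<in> fixed" "i \<noteq> j" for x i j
    using that unfolding fixed_eq_closed_span[symmetric] by auto
  define \<xi> where "\<xi> = restrict (\<lambda>x. \<phi> x \<zeta> \<zeta>) fixed"
  have \<zeta>I: "\<zeta> \<in> I" using \<zeta> by (simp add: I_def)
  note C = closed_subspaceD[OF closed_subspace_fixed]
  have mult_fixed: "x \<otimes> y \<in> fixed" if "x \<in> fixed" "y \<in> fixed" for x y
    using star_subalgebra_fixed that by (auto simp: star_subalgebra_def)
  have "\<xi> \<in> characters F"
  proof (rule charactersI)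
    show "\<xi> \<in> extensional fixed" by (simp add: \<xi>_def)
    show "\<xi> \<one> = 1" using one_fixed \<zeta>I by (simp add: \<xi>_def \<phi>(2))
    fix x y c assume x: "x \<in> fixed"
    show "\<xi> (c \<odot> x) = c * \<xi> x" using x C(4) fixed_closed by (simp add: \<xi>_def D)
    assume y: "y \<in> fixed"
    show "\<xi> (x \<oplus> y) = \<xi> x + \<xi> y" using x y C(3) fixed_closed by (simp add: \<xi>_def D)
    have "(\<Sum>k\<in>I. \<phi> x \<zeta> k * \<phi> y k \<zeta>) = (\<Sum>k\<in>I. if k = \<zeta> then \<phi> x \<zeta> k * \<phi> y k \<zeta> else 0)"
      by (rule sum.cong) (use \<phi>_diag[OF x] in auto)
    also have "\<dots> = \<phi> x \<zeta> \<zeta> * \<phi> y \<zeta> \<zeta>" using I \<zeta>I by simp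
    finally show "\<xi> (x \<otimes> y) = \<xi> x * \<xi> y"
      using x y mult_fixed fixed_closed by (simp add: \<xi>_def D mat_mult_def)
  qed
  moreover have "\<xi> (gen n 1) = \<zeta> powi (r ^ n)" for n
    using \<zeta>I gen_fixed by (simp add: \<xi>_def \<phi>_gen monomial_matrix_def)
  ultimately show ?thesis by blast
qed

text \<open>Only coordinate j is approximated directly. The earlier coordinates are its powers with
  exponent M^(j - n), so their errors grow by a factor of at most |M|^j.\<close>

lemma solenoid_point_approx:
  assumes nz: "\<forall>i. m i \<noteq> 0" and z: "z \<in> topspace (solenoid (\<Prod>i\<in>UNIV. m i))"
  shows "\<exists>\<xi>\<in>characters F. \<forall>n\<le>j. cmod (solenoid_point \<xi> n - z n) \<le> inverse (real (Suc j))"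
proof -
  let ?M = "\<Prod>i\<in>UNIV. m i"
  have M: "?M \<noteq> 0" using nz by simp
  have z1: "cmod (z n) = 1" "z n = z (Suc n) powi ?M" for n
    using iffD1[OF topspace_solenoid z] by blast+
  have z_pow: "z n = z (n + k) powi (?M ^ k)" for n k
  proof (induction k)
    case (Suc k)
    then show ?case using z1(2)[of "n + k"] by (simp add: power_int_mult)
  qed simp
  define a where "a = real_of_int (\<bar>?M\<bar> ^ j)"
  \<comment> \<open>Divides the desired accuracy by the largest factor by which an error at
    coordinate j can grow.\<close>
  define e where "e = inverse (a * real (Suc j))"
  have M1: "1 \<le> \<bar>?M\<bar>" using M by linarith
  then have "0 < \<bar>?M\<bar> ^ j" by (intro zero_less_power) linarith
  then have a: "a > 0" unfolding a_def of_int_0_less_iff .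
  then have e: "e > 0" by (simp add: e_def)
  obtain \<eta> N where \<eta>: "N > 0" "coprime ?M (int N)" "\<eta> ^ N = 1" "cmod (\<eta> - z j) < e"
    using root_of_unity_near[OF z1(1) e M] by blast
  obtain r where r: "[?M * r = 1] (mod int N)" using cong_solve_coprime_int[OF \<eta>(2)] by blast
  note powi = root_of_unity_powi[OF \<eta>(3,1)]
  have \<eta>1: "cmod \<eta> = 1"
    using power_eq_1_iff[OF \<eta>(3)] \<eta>(1) by simp
  \<comment> \<open>The eigenvalue is \<open>\<eta>\<close> raised to M^j, so that undoing j powers
    of M returns \<open>\<eta>\<close> at coordinate j, and undoing only n of them leaves the power
    M^(j - n).\<close>
  obtain \<xi> where \<xi>: "\<xi> \<in> characters F" "\<And>n. \<xi> (gen n 1) = (\<eta> powi (?M ^ j)) powi (r ^ n)"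
    using ex_periodic_character[OF \<eta>(1,2) r powi(2)] by blast
  have "cmod (solenoid_point \<xi> n - z n) \<le> inverse (real (Suc j))" if n: "n \<le> j" for n
  proof -
    have "[?M ^ (j - n) * (?M * r) ^ n = ?M ^ (j - n) * 1 ^ n] (mod int N)"
      by (intro cong_scalar_left cong_pow r)
    moreover have "?M ^ j * r ^ n = ?M ^ (j - n) * (?M * r) ^ n"
      using n by (simp add: power_mult_distrib flip: power_add mult.assoc)
    ultimately have "\<eta> powi (?M ^ j * r ^ n) = \<eta> powi (?M ^ (j - n))"
      using powi(3)[of "?M ^ j * r ^ n" "?M ^ (j - n)"] by simp
    then have "solenoid_point \<xi> n = \<eta> powi (?M ^ (j - n))"
      by (simp add: solenoid_point_def \<xi>(2) power_int_mult)
    moreover have "z n = z j powi (?M ^ (j - n))" using z_pow[of n "j - n"] n by simp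
    ultimately have "cmod (solenoid_point \<xi> n - z n) \<le> real_of_int \<bar>?M ^ (j - n)\<bar> * cmod (\<eta> - z j)"
      using norm_powi_diff[OF \<eta>1 z1(1)[of j], of "?M ^ (j - n)"] by (simp only:)
    also have "\<dots> \<le> a * e"
    proof (rule mult_mono)
      have "\<bar>?M\<bar> ^ (j - n) \<le> \<bar>?M\<bar> ^ j" using M1 by (intro power_increasing) auto
      then show "real_of_int \<bar>?M ^ (j - n)\<bar> \<le> a" by (simp only: a_def power_abs of_int_le_iff)
    qed (use \<eta>(4) a in auto)
    also have "\<dots> = inverse (real (Suc j))" using a by (simp add: e_def)
    finally show ?thesis .
  qed
  then show ?thesis using \<xi>(1) by blast
qed

lemma solenoid_point_image:
  assumes nz: "\<forall>i. m i \<noteq> 0"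
  shows "solenoid_point ` topspace (spectrum F) = topspace (solenoid (\<Prod>i\<in>UNIV. m i))"
proof
  let ?S = "solenoid (\<Prod>i\<in>UNIV. m i)"
  show "solenoid_point ` topspace (spectrum F) \<subseteq> topspace ?S"
    using solenoid_point_in by (auto simp: topspace_spectrum)
  have H: "Hausdorff_space ?S"
    unfolding solenoid_def
    by (intro Hausdorff_space_subtopology) (simp add: Hausdorff_space_product_topology Hausdorff_space_subtopology)
  have "compactin ?S (solenoid_point ` topspace (spectrum F))"
    using compact_space_spectrum continuous_map_solenoid_point
    by (intro image_compactin) (auto simp: compact_space_def)
  then have closed: "closedin ?S (solenoid_point ` topspace (spectrum F))"
    using H by (rule compactin_imp_closedin[rotated])
  show "topspace ?S \<subseteq> solenoid_point ` topspace (spectrum F)"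
  proof
    fix z assume z: "z \<in> topspace ?S"
    obtain \<xi> where \<xi>: "\<And>j. \<xi> j \<in> characters F"
      "\<And>j n. n \<le> j \<Longrightarrow> cmod (solenoid_point (\<xi> j) n - z n) \<le> inverse (real (Suc j))"
      using solenoid_point_approx[OF nz z] by metis
    \<comment> \<open>For fixed n the estimate holds from j = n onwards. Convergence in every
      coordinate is convergence in the product topology.\<close>
    have "(\<lambda>j. solenoid_point (\<xi> j) n) \<longlonglongrightarrow> z n" for n
    proof (rule LIM_zero_cancel, rule Lim_null_comparison)
      show "\<forall>\<^sub>F j in sequentially. cmod (solenoid_point (\<xi> j) n - z n) \<le> inverse (real (Suc j))"
        using \<xi>(2) by (auto simp: eventually_sequentially)
    qed (rule LIMSEQ_inverse_real_of_nat)
    moreover have "cmod (solenoid_point (\<xi> j) n) = 1" "cmod (z n) = 1" for j n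
      using iffD1[OF topspace_solenoid solenoid_point_in[OF \<xi>(1)]] iffD1[OF topspace_solenoid z]
      by blast+
    ultimately have "limitin (product_topology (\<lambda>_. top_of_set (sphere 0 1)) UNIV)
        (\<lambda>j. solenoid_point (\<xi> j)) z sequentially"
      by (simp add: limitin_componentwise limitin_subtopology PiE_UNIV_domain Pi_iff)
    moreover have eqn: "w \<in> {z. \<forall>n. z n = z (Suc n) powi (\<Prod>i\<in>UNIV. m i)}" if "w \<in> topspace ?S" for w
      using iffD1[OF topspace_solenoid that] by blast
    ultimately have lim: "limitin ?S (\<lambda>j. solenoid_point (\<xi> j)) z sequentially"
      unfolding solenoid_def limitin_subtopology
      by (intro conjI always_eventually allI eqn z solenoid_point_in \<xi>(1))
    show "z \<in> solenoid_point ` topspace (spectrum F)"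
      by (rule limitin_closedin[OF lim closed]) (use \<xi>(1) in \<open>auto simp: topspace_spectrum\<close>)
  qed
qed

lemma spectrum_homeomorphic_solenoid:
  assumes "\<forall>i. m i \<noteq> 0"
  shows "spectrum F homeomorphic_space solenoid (\<Prod>i\<in>UNIV. m i)"
proof -
  have "Hausdorff_space (solenoid (\<Prod>i\<in>UNIV. m i))"
    unfolding solenoid_def
    by (intro Hausdorff_space_subtopology) (simp add: Hausdorff_space_product_topology Hausdorff_space_subtopology)
  then have "homeomorphic_map (spectrum F) (solenoid (\<Prod>i\<in>UNIV. m i)) solenoid_point"
    using continuous_map_solenoid_point compact_space_spectrum solenoid_point_image[OF assms]
      inj_on_solenoid_point by (intro continuous_imp_homeomorphic_map) (auto simp: topspace_spectrum)
  then show ?thesis by (rule homeomorphic_map_imp_homeomorphic_space)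
qed

end

theorem proposition4p24:
  fixes m :: "'k::finite \<Rightarrow> int"
    and A :: "'a cstar_alg"
    and u :: "int \<Rightarrow> 'a"
    and s :: "'k path \<Rightarrow> 'a"
  assumes "\<forall>i. m i \<noteq> 0"
    and "universal_graph_algebra m A u s"
  shows "(\<exists>\<phi>. (\<forall>n. \<phi> n \<in> unital_star_hom (stage_algebra A u s n) (stage_algebra A u s (Suc n)) \<and>
             (\<forall>x\<in>carrier (stage_algebra A u s n). \<phi> n x = x) \<and>
             (\<forall>p. \<phi> n (stage_generator A u s n p) =
                    stage_generator A u s (Suc n) (p * (\<Prod>i\<in>UNIV. m i)))) \<and>
           cstar_direct_limit TYPE('b) (stage_algebra A u s) \<phi> (gauge_fixed_algebra A u s) (\<lambda>n x. x)) \<and>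
         spectrum (gauge_fixed_algebra A u s) homeomorphic_space solenoid (\<Prod>i\<in>UNIV. m i)"
proof -
  interpret graph_algebra A m u s
    using assms(2)
    by (intro graph_algebra.intro graph_algebra_axioms.intro) (auto simp: universal_graph_algebra_def)
  \<comment> \<open>The stages share the operations and the unit of \<open>A\<close> and differ only
    in their carriers, so the identity function serves as every connecting map.\<close>
  have "(\<lambda>x. x) \<in> unital_star_hom (stage_algebra A u s n) (stage_algebra A u s (Suc n))" for n
    using stage_subset_Suc[of n] by (auto simp: stage_algebra_eq unital_star_hom_def star_hom_def)
  then show ?thesis
    using direct_limit_fixed gen_Suc spectrum_homeomorphic_solenoid[OF assms(1)]
    by (intro conjI exI[of _ "\<lambda>n x. x"]) (auto simp: gauge_fixed_algebra_eq)
qed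

end
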